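(* Let $X$ be any one of the $\Lambda$-lattices $R(1),R(2),R(3),K(1),K(2),K(3)$. Then there is an integer $a\ge 0$ such that $K(3)\otimes X\cong X\oplus\Lambda^{a}$ as $\Lambda$-modules.
   Context: Let $p=3d+1$ be prime, and let $\alpha\in\{2,\dots,p-2\}$ be an integer of multiplicative order $3$ modulo $p$. Let $G(p,3)=\langle x,y\mid x^p=y^3=1,\ yxy^{-1}=x^{\alpha}\rangle$, $\Lambda=\mathbb{Z}[G(p,3)]$ and $\Lambda_0=\mathbb{Z}[C_p]$ with $C_p=\langle x\rangle$. Modules are right modules; a lattice is a module whose underlying abelian group is finitely generated and free. $\otimes$ means $\otimes_{\mathbb{Z}}$ with diagonal action $(m\otimes n)g=mg\otimes ng$. Let $I_C$ be the augmentation ideal of $\Lambda_0$, and let $I_C^{*}=\Lambda_0/(\Sigma_x)$, where $\Sigma_x=\sum_{i=0}^{p-1}x^i$ (this is identified with the dual of $I_C$). If $J$ is $I_C$, $(x-1)I_C$ or $I_C^*$, then $\overline{J}$ denotes the right $\Lambda$-module with underlying $\Lambda_0$-module $J$ on which $y$ acts by conjugation, $m\cdot y=y^{-1}my$. $R(i)$ ($i=1,2,3$) is the $i$-th row of the ring $\mathcal{T}_3(A,\pi)=\{X\in M_3(A)\mid x_{ij}\in(\pi)\text{ if } i>j\}$, where $A=\mathbb{Z}[\zeta_p]^{C_3}$ and $(\pi)$ is the prime of $A$ over $p$, regarded as a right $\Lambda$-module via the canonical surjection $\Lambda\to\mathcal{T}_3(A,\pi)$. One has (and this may be taken as the definition up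 to isomorphism) $R(1)\cong\overline{I_C}$, $R(2)\cong\overline{(x-1)I_C}$, $R(3)\cong\overline{I_C^*}$. Each $R(i)$ is cyclic (monogenic) over $\Lambda$, and $K(i)$ denotes a module occurring in an exact sequence of $\Lambda$-modules $0\to K(i)\to\Lambda\to R(i)\to 0$. *)

theory Defs
  imports "HOL-Algebra.QuotRing" "HOL-Algebra.Free_Abelian_Groups" "HOL-Number_Theory.Number_Theory"
begin

text \<open>
  A letter \<open>(s, True)\<close> stands for the generator \<open>s\<close>, and \<open>(s, False)\<close> for its formal inverse.
  \<open>pres_eq Rels\<close> is the congruence on words generated by free cancellation and by the
  relations \<open>l = r\<close> with \<open>(l, r) \<in> Rels\<close>.
\<close>

type_synonym 's word = "('s \<times> bool) list"

inductive pres_eq :: "('s word \<times> 's word) set \<Rightarrow> 's word \<Rightarrow> 's word \<Rightarrow> bool"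
  for Rels where
  pres_cancel: "pres_eq Rels (u @ [(s, b), (s, \<not> b)] @ v) (u @ v)"
| pres_rel: "(l, r) \<in> Rels \<Longrightarrow> pres_eq Rels (u @ l @ v) (u @ r @ v)"
| pres_refl: "pres_eq Rels u u"
| pres_sym: "pres_eq Rels u v \<Longrightarrow> pres_eq Rels v u"
| pres_trans: "pres_eq Rels u v \<Longrightarrow> pres_eq Rels v w \<Longrightarrow> pres_eq Rels u w"

definition pres_class :: "('s word \<times> 's word) set \<Rightarrow> 's word \<Rightarrow> 's word set" where
  "pres_class Rels u = {v. pres_eq Rels u v}"

definition presented_group :: "('s word \<times> 's word) set \<Rightarrow> 's word set monoid" where
  "presented_group Rels =
     \<lparr>carrier = range (pres_class Rels),
      monoid.mult = (\<lambda>A B. \<Union>u\<in>A. \<Union>v\<in>B. pres_class Rels (u @ v)),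
      one = pres_class Rels []\<rparr>"

datatype xy = gx | gy

definition rels3 :: "nat \<Rightarrow> nat \<Rightarrow> (xy word \<times> xy word) set" where
  "rels3 p \<alpha> =
     {(replicate p (gx, True), []),
      (replicate 3 (gy, True), []),
      ([(gy, True), (gx, True), (gy, False)], replicate \<alpha> (gx, True))}"

definition G3 :: "nat \<Rightarrow> nat \<Rightarrow> xy word set monoid" where
  "G3 p \<alpha> = presented_group (rels3 p \<alpha>)"

definition gen_x :: "nat \<Rightarrow> nat \<Rightarrow> xy word set" where
  "gen_x p \<alpha> = pres_class (rels3 p \<alpha>) [(gx, True)]"

definition gen_y :: "nat \<Rightarrow> nat \<Rightarrow> xy word set" where
  "gen_y p \<alpha> = pres_class (rels3 p \<alpha>) [(gy, True)]"

text \<open>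
  The group element \<open>g\<close> of the group ring is \<open>frag_of g\<close>, and multiplication is the bilinear
  extension of the group multiplication.
\<close>

definition group_ring :: "('g, 'z) monoid_scheme \<Rightarrow> ('g \<Rightarrow>\<^sub>0 int) ring" where
  "group_ring G =
     \<lparr>carrier = {c. Poly_Mapping.keys c \<subseteq> carrier G},
      monoid.mult = (\<lambda>a b. frag_extend (\<lambda>g. frag_extend (\<lambda>h. frag_of (g \<otimes>\<^bsub>G\<^esub> h)) b) a),
      one = frag_of \<one>\<^bsub>G\<^esub>,
      ring.zero = 0,
      ring.add = (+)\<rparr>"

definition augmentation :: "('g \<Rightarrow>\<^sub>0 int) \<Rightarrow> int" where
  "augmentation c = (\<Sum>g\<in>Poly_Mapping.keys c. Poly_Mapping.lookup c g)"

definition augmentation_ideal :: "('g, 'z) monoid_scheme \<Rightarrow> ('g \<Rightarrow>\<^sub>0 int) set" where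
  "augmentation_ideal G = {c \<in> carrier (group_ring G). augmentation c = 0}"

text \<open>
  As for the library's \<open>module\<close> record, the additive group of a module is given by the
  fields \<open>zero\<close> and \<open>add\<close> of the \<open>ring\<close> record; the fields \<open>mult\<close> and \<open>one\<close> are not used.
\<close>

record ('r, 'm) rmod = "'m ring" +
  ract :: "'m \<Rightarrow> 'r \<Rightarrow> 'm" (infixl \<open>\<star>\<index>\<close> 70)

locale right_module = R?: ring R + M: abelian_group M
  for R :: "('r, 'a) ring_scheme" (structure) and M :: "('r, 'm, 'b) rmod_scheme" (structure) +
  assumes ract_closed: "\<lbrakk>m \<in> carrier M; r \<in> carrier R\<rbrakk> \<Longrightarrow> m \<star>\<^bsub>M\<^esub> r \<in> carrier M"
    and ract_add: "\<lbrakk>m \<in> carrier M; r \<in> carrier R; s \<in> carrier R\<rbrakk>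
      \<Longrightarrow> m \<star>\<^bsub>M\<^esub> (r \<oplus>\<^bsub>R\<^esub> s) = m \<star>\<^bsub>M\<^esub> r \<oplus>\<^bsub>M\<^esub> m \<star>\<^bsub>M\<^esub> s"
    and add_ract: "\<lbrakk>m \<in> carrier M; n \<in> carrier M; r \<in> carrier R\<rbrakk>
      \<Longrightarrow> (m \<oplus>\<^bsub>M\<^esub> n) \<star>\<^bsub>M\<^esub> r = m \<star>\<^bsub>M\<^esub> r \<oplus>\<^bsub>M\<^esub> n \<star>\<^bsub>M\<^esub> r"
    and ract_mult: "\<lbrakk>m \<in> carrier M; r \<in> carrier R; s \<in> carrier R\<rbrakk>
      \<Longrightarrow> m \<star>\<^bsub>M\<^esub> (r \<otimes>\<^bsub>R\<^esub> s) = (m \<star>\<^bsub>M\<^esub> r) \<star>\<^bsub>M\<^esub> s"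
    and ract_one: "m \<in> carrier M \<Longrightarrow> m \<star>\<^bsub>M\<^esub> \<one>\<^bsub>R\<^esub> = m"

definition rmod_hom :: "('r, 'a) ring_scheme \<Rightarrow> ('r, 'm, 'b) rmod_scheme
    \<Rightarrow> ('r, 'n, 'c) rmod_scheme \<Rightarrow> ('m \<Rightarrow> 'n) set" where
  "rmod_hom R M N = {f \<in> carrier M \<rightarrow> carrier N.
     (\<forall>m\<in>carrier M. \<forall>n\<in>carrier M. f (m \<oplus>\<^bsub>M\<^esub> n) = f m \<oplus>\<^bsub>N\<^esub> f n) \<and>
     (\<forall>m\<in>carrier M. \<forall>r\<in>carrier R. f (m \<star>\<^bsub>M\<^esub> r) = f m \<star>\<^bsub>N\<^esub> r)}"

definition rmod_iso :: "('r, 'a) ring_scheme \<Rightarrow> ('r, 'm, 'b) rmod_scheme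
    \<Rightarrow> ('r, 'n, 'c) rmod_scheme \<Rightarrow> bool" where
  "rmod_iso R M N \<longleftrightarrow> (\<exists>f\<in>rmod_hom R M N. bij_betw f (carrier M) (carrier N))"

definition regular_rmod :: "('r, 'a) ring_scheme \<Rightarrow> ('r, 'r) rmod" where
  "regular_rmod R =
     \<lparr>carrier = carrier R, monoid.mult = undefined, one = undefined,
      ring.zero = \<zero>\<^bsub>R\<^esub>, ring.add = ring.add R, ract = monoid.mult R\<rparr>"

definition ideal_rmod :: "('r, 'a) ring_scheme \<Rightarrow> 'r set \<Rightarrow> ('r, 'r) rmod" where
  "ideal_rmod R I = (regular_rmod R)\<lparr>carrier := I\<rparr>"

definition quot_rmod :: "('r, 'a) ring_scheme \<Rightarrow> 'r set \<Rightarrow> ('r, 'r set) rmod" where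
  "quot_rmod R I =
     \<lparr>carrier = carrier (R Quot I), monoid.mult = undefined, one = undefined,
      ring.zero = \<zero>\<^bsub>R Quot I\<^esub>, ring.add = ring.add (R Quot I),
      ract = (\<lambda>A r. A \<otimes>\<^bsub>R Quot I\<^esub> (I +>\<^bsub>R\<^esub> r))\<rparr>"

definition direct_sum :: "('r, 'm, 'b) rmod_scheme \<Rightarrow> ('r, 'n, 'c) rmod_scheme
    \<Rightarrow> ('r, 'm \<times> 'n) rmod" where
  "direct_sum M N =
     \<lparr>carrier = carrier M \<times> carrier N, monoid.mult = undefined, one = undefined,
      ring.zero = (\<zero>\<^bsub>M\<^esub>, \<zero>\<^bsub>N\<^esub>),
      ring.add = (\<lambda>(m, n) (m', n'). (m \<oplus>\<^bsub>M\<^esub> m', n \<oplus>\<^bsub>N\<^esub> n')),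
      ract = (\<lambda>(m, n) r. (m \<star>\<^bsub>M\<^esub> r, n \<star>\<^bsub>N\<^esub> r))\<rparr>"

definition free_rmod :: "('r, 'a) ring_scheme \<Rightarrow> nat \<Rightarrow> ('r, nat \<Rightarrow> 'r) rmod" where
  "free_rmod R a =
     \<lparr>carrier = {..<a} \<rightarrow>\<^sub>E carrier R, monoid.mult = undefined, one = undefined,
      ring.zero = (\<lambda>i\<in>{..<a}. \<zero>\<^bsub>R\<^esub>),
      ring.add = (\<lambda>u v. \<lambda>i\<in>{..<a}. u i \<oplus>\<^bsub>R\<^esub> v i),
      ract = (\<lambda>u r. \<lambda>i\<in>{..<a}. u i \<otimes>\<^bsub>R\<^esub> r)\<rparr>"

definition short_exact :: "('r, 'a) ring_scheme \<Rightarrow> ('r, 'k, 'b) rmod_scheme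
    \<Rightarrow> ('r, 'm, 'c) rmod_scheme \<Rightarrow> ('r, 'n, 'd) rmod_scheme
    \<Rightarrow> ('k \<Rightarrow> 'm) \<Rightarrow> ('m \<Rightarrow> 'n) \<Rightarrow> bool" where
  "short_exact R K M N f g \<longleftrightarrow>
     right_module R K \<and> right_module R M \<and> right_module R N \<and>
     f \<in> rmod_hom R K M \<and> g \<in> rmod_hom R M N \<and>
     inj_on f (carrier K) \<and>
     f ` carrier K = {m \<in> carrier M. g m = \<zero>\<^bsub>N\<^esub>} \<and>
     g ` carrier M = carrier N"

definition tensor_rels :: "('r, 'm, 'b) rmod_scheme \<Rightarrow> ('r, 'n, 'c) rmod_scheme
    \<Rightarrow> ('m \<times> 'n \<Rightarrow>\<^sub>0 int) set" where
  "tensor_rels M N =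
     {frag_of (m \<oplus>\<^bsub>M\<^esub> m', n) - frag_of (m, n) - frag_of (m', n) | m m' n.
        m \<in> carrier M \<and> m' \<in> carrier M \<and> n \<in> carrier N} \<union>
     {frag_of (m, n \<oplus>\<^bsub>N\<^esub> n') - frag_of (m, n) - frag_of (m, n') | m n n'.
        m \<in> carrier M \<and> n \<in> carrier N \<and> n' \<in> carrier N}"

definition tensor_free :: "('r, 'm, 'b) rmod_scheme \<Rightarrow> ('r, 'n, 'c) rmod_scheme
    \<Rightarrow> ('m \<times> 'n \<Rightarrow>\<^sub>0 int) monoid" where
  "tensor_free M N = free_Abelian_group (carrier M \<times> carrier N)"

definition tensor_sub :: "('r, 'm, 'b) rmod_scheme \<Rightarrow> ('r, 'n, 'c) rmod_scheme
    \<Rightarrow> ('m \<times> 'n \<Rightarrow>\<^sub>0 int) set" where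
  "tensor_sub M N = generate (tensor_free M N) (tensor_rels M N)"

text \<open>
  The action of \<open>\<lambda> = \<Sum> \<lambda>\<^sub>g g\<close> on \<open>\<Sum> c\<^sub>i (m\<^sub>i, n\<^sub>i)\<close> is \<open>\<Sum> \<lambda>\<^sub>g c\<^sub>i (m\<^sub>i g, n\<^sub>i g)\<close>;
  it induces the action on the quotient group.
\<close>

definition diag_act :: "('g \<Rightarrow>\<^sub>0 int, 'm, 'b) rmod_scheme \<Rightarrow> ('g \<Rightarrow>\<^sub>0 int, 'n, 'c) rmod_scheme
    \<Rightarrow> ('m \<times> 'n \<Rightarrow>\<^sub>0 int) \<Rightarrow> ('g \<Rightarrow>\<^sub>0 int) \<Rightarrow> ('m \<times> 'n \<Rightarrow>\<^sub>0 int)" where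
  "diag_act M N c l =
     frag_extend (\<lambda>g. frag_extend (\<lambda>(m, n). frag_of (m \<star>\<^bsub>M\<^esub> frag_of g, n \<star>\<^bsub>N\<^esub> frag_of g)) c) l"

definition tensor_rmod :: "('g \<Rightarrow>\<^sub>0 int, 'm, 'b) rmod_scheme \<Rightarrow> ('g \<Rightarrow>\<^sub>0 int, 'n, 'c) rmod_scheme
    \<Rightarrow> ('g \<Rightarrow>\<^sub>0 int, ('m \<times> 'n \<Rightarrow>\<^sub>0 int) set) rmod" where
  "tensor_rmod M N =
     \<lparr>carrier = carrier (tensor_free M N Mod tensor_sub M N),
      monoid.mult = undefined, one = undefined,
      ring.zero = \<one>\<^bsub>tensor_free M N Mod tensor_sub M N\<^esub>,
      ring.add = monoid.mult (tensor_free M N Mod tensor_sub M N),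
      ract = (\<lambda>A l. \<Union>c\<in>A. tensor_sub M N #>\<^bsub>tensor_free M N\<^esub> diag_act M N c l)\<rparr>"

type_synonym lam = "xy word set \<Rightarrow>\<^sub>0 int"

definition Lam :: "nat \<Rightarrow> nat \<Rightarrow> lam ring" where
  "Lam p \<alpha> = group_ring (G3 p \<alpha>)"

definition Cp :: "nat \<Rightarrow> nat \<Rightarrow> xy word set monoid" where
  "Cp p \<alpha> = (G3 p \<alpha>)\<lparr>carrier := generate (G3 p \<alpha>) {gen_x p \<alpha>}\<rparr>"

definition Lam0 :: "nat \<Rightarrow> nat \<Rightarrow> lam ring" where
  "Lam0 p \<alpha> = group_ring (Cp p \<alpha>)"

definition I_C :: "nat \<Rightarrow> nat \<Rightarrow> lam set" where
  "I_C p \<alpha> = augmentation_ideal (Cp p \<alpha>)"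

definition xm1_I_C :: "nat \<Rightarrow> nat \<Rightarrow> lam set" where
  "xm1_I_C p \<alpha> =
     {(frag_of (gen_x p \<alpha>) - frag_of \<one>\<^bsub>Cp p \<alpha>\<^esub>) \<otimes>\<^bsub>Lam0 p \<alpha>\<^esub> c | c. c \<in> I_C p \<alpha>}"

definition Sigma_x :: "nat \<Rightarrow> nat \<Rightarrow> lam" where
  "Sigma_x p \<alpha> = (\<Sum>i<p. frag_of (gen_x p \<alpha> [^]\<^bsub>G3 p \<alpha>\<^esub> i))"

definition I_C_dual :: "nat \<Rightarrow> nat \<Rightarrow> (lam, lam set) rmod" where
  "I_C_dual p \<alpha> = quot_rmod (Lam0 p \<alpha>) (PIdl\<^bsub>Lam0 p \<alpha>\<^esub> (Sigma_x p \<alpha>))"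

definition conj_y :: "nat \<Rightarrow> nat \<Rightarrow> lam \<Rightarrow> lam" where
  "conj_y p \<alpha> m =
     frag_of (inv\<^bsub>G3 p \<alpha>\<^esub> gen_y p \<alpha>) \<otimes>\<^bsub>Lam p \<alpha>\<^esub> m \<otimes>\<^bsub>Lam p \<alpha>\<^esub> frag_of (gen_y p \<alpha>)"

text \<open>
  \<open>is_bar p \<alpha> J \<kappa> M\<close>: up to isomorphism, \<open>M\<close> is the right module over \<open>Lam p \<alpha>\<close> whose
  underlying \<open>Lam0 p \<alpha>\<close>-module is \<open>J\<close> and on which \<open>y\<close> acts by \<open>\<kappa>\<close>. Since \<open>x\<close> and \<open>y\<close>
  generate the group, this determines \<open>M\<close> up to isomorphism.
\<close>

definition is_bar :: "nat \<Rightarrow> nat \<Rightarrow> (lam, 'j) rmod \<Rightarrow> ('j \<Rightarrow> 'j) \<Rightarrow> (lam, 'm) rmod \<Rightarrow> bool" where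
  "is_bar p \<alpha> J \<kappa> M \<longleftrightarrow>
     right_module (Lam p \<alpha>) M \<and>
     (\<exists>\<phi>\<in>rmod_hom (Lam0 p \<alpha>) M J. bij_betw \<phi> (carrier M) (carrier J) \<and>
        (\<forall>m\<in>carrier M. \<phi> (m \<star>\<^bsub>M\<^esub> frag_of (gen_y p \<alpha>)) = \<kappa> (\<phi> m)))"

definition is_R :: "nat \<Rightarrow> nat \<Rightarrow> nat \<Rightarrow> (lam, 'm) rmod \<Rightarrow> bool" where
  "is_R p \<alpha> i M \<longleftrightarrow>
     i = 1 \<and> is_bar p \<alpha> (ideal_rmod (Lam0 p \<alpha>) (I_C p \<alpha>)) (conj_y p \<alpha>) M \<or>
     i = 2 \<and> is_bar p \<alpha> (ideal_rmod (Lam0 p \<alpha>) (xm1_I_C p \<alpha>)) (conj_y p \<alpha>) M \<or>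
     i = 3 \<and> is_bar p \<alpha> (I_C_dual p \<alpha>) (image (conj_y p \<alpha>)) M"

definition is_K :: "nat \<Rightarrow> nat \<Rightarrow> (lam, 'n) rmod \<Rightarrow> (lam, 'm) rmod \<Rightarrow> bool" where
  "is_K p \<alpha> R K \<longleftrightarrow> (\<exists>f g. short_exact (Lam p \<alpha>) K (regular_rmod (Lam p \<alpha>)) R f g)"

end

theory Submission
  imports Defs "HOL-Library.Set_Algebras"
begin

text \<open>
  Let \<open>H = \<langle>y\<rangle>\<close>, of order 3, and let \<open>X\<close> be one of the six lattices. The sequences
  \<open>0 \<rightarrow> \<int> \<rightarrow> \<int>[H\G] \<rightarrow> R(3) \<rightarrow> 0\<close> and \<open>0 \<rightarrow> K(3) \<rightarrow> \<Lambda> \<rightarrow> R(3) \<rightarrow> 0\<close>, tensored with \<open>X\<close>, present the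
  same module \<open>R(3) \<otimes> X\<close> in two ways: its kernel is \<open>X\<close> under the surjection from
  \<open>\<int>[H\G] \<otimes> X\<close>, and \<open>K(3) \<otimes> X\<close> under the surjection from \<open>\<Lambda> \<otimes> X\<close>. The module \<open>\<Lambda> \<otimes> X\<close> is free.
  If \<open>X\<close> is free of rank \<open>k\<close> over \<open>\<int>[H]\<close>, then \<open>\<int>[H\G] \<otimes> X\<close>, which is induced from the
  restriction of \<open>X\<close>, is free of rank \<open>k\<close> and \<open>\<Lambda> \<otimes> X\<close> is free of rank \<open>3k\<close>. Schanuel's lemma
  then gives \<open>K(3) \<otimes> X \<oplus> \<Lambda>\<^sup>k \<cong> X \<oplus> \<Lambda>\<^sup>3\<^sup>k\<close>, and two things remain: to cancel \<open>\<Lambda>\<^sup>k\<close>, and to prove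
  the freeness over \<open>\<int>[H]\<close>.

  The cancellation is \<open>submodule_split\<close>, for the integral group ring of any finite group: if a
  quotient \<open>V/N\<close> of a free module \<open>V\<close> of rank \<open>n\<close> is generated by the images of \<open>m\<close> elements
  \<open>\<pi>\<^sub>i\<close>, and \<open>n \<ge> 3m\<close>, then \<open>V\<close> has a basis with \<open>n - m\<close> members in \<open>N\<close> and the other \<open>m\<close>
  congruent to the \<open>\<pi>\<^sub>i\<close> modulo \<open>N\<close>. Hence \<open>N\<close> is the sum of a free module of rank \<open>n - m\<close> and
  of the module of relations between the \<open>\<pi>\<^sub>i\<close>. The basis is reached by elementary
  transformations, and the tool that finds them is Gaschuetz's lemma: in a finite module
  generated by \<open>m\<close> elements, every \<open>m\<close> generators of a quotient lift to \<open>m\<close> generators. Applied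
  modulo 2 it makes a first block of \<open>m\<close> basis vectors span a submodule that together with \<open>N\<close>
  has odd index; applied to the finite quotient by that submodule it makes a second block span
  the rest. The last block is now superfluous, so it can be changed to lift the \<open>\<pi>\<^sub>i\<close>,
  whereupon all other basis vectors can be moved into \<open>N\<close>.

  Over \<open>\<int>[H]\<close> the same theorem shows that \<open>K(i)\<close> is free as soon as \<open>R(i)\<close> is free of rank \<open>d\<close>,
  because \<open>\<Lambda>\<close> has rank \<open>p \<ge> 3d\<close>. The lattices \<open>R(1)\<close> and \<open>R(3)\<close> have a \<open>\<int>\<close>-basis indexed by
  the nonzero residues modulo \<open>p\<close>, on which \<open>y\<close> acts as multiplication by an element of order 3,
  hence freely. In these coordinates \<open>R(2)\<close> is the sublattice \<open>p | \<Sum> a c\<^sub>a\<close> of index \<open>p\<close> in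
  \<open>R(1)\<close>; it is free because a prime ideal over \<open>p\<close> in \<open>\<int>[H]\<close> is principal, a generator coming
  from a solution of \<open>a\<^sup>2 - ab + b\<^sup>2 = p\<close>.

  For the isomorphism itself, \<open>k \<otimes> u\<close> in \<open>K(3) \<otimes> X\<close> is sent to \<open>\<Sum>\<^sub>g k\<^sub>g (u g\<^sup>-\<^sup>1) g\<close>, where \<open>k\<^sub>g\<close> is the
  coefficient of \<open>k \<in> \<Lambda>\<close> at \<open>g\<close> and \<open>X\<close> is written in its \<open>\<int>\<close>-basis; this makes \<open>\<Lambda> \<otimes> X\<close> the
  standard free module, with \<open>G\<close> translating the basis.
\<close>

section \<open>Gaschuetz's lemma\<close>

text \<open>
  Submodules enter the counting argument only as a family of subgroups that is closed under
  sums and intersections.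
\<close>

locale subgroup_family =
  fixes sub :: "'a::ab_group_add set \<Rightarrow> bool"
  assumes sub_zero: "sub U \<Longrightarrow> 0 \<in> U"
    and sub_diff: "sub U \<Longrightarrow> a \<in> U \<Longrightarrow> b \<in> U \<Longrightarrow> a - b \<in> U"
    and sub_plus: "sub U \<Longrightarrow> sub W \<Longrightarrow> sub (U + W)"
    and sub_Inter: "F \<noteq> {} \<Longrightarrow> (\<And>U. U \<in> F \<Longrightarrow> sub U) \<Longrightarrow> sub (\<Inter>F)"
begin

definition gen :: "'a set \<Rightarrow> 'a set" where
  "gen S = \<Inter>{U. sub U \<and> S \<subseteq> U}"

lemma sub_uminus: "sub U \<Longrightarrow> a \<in> U \<Longrightarrow> - a \<in> U"
  using sub_diff[of U 0 a] sub_zero by auto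

lemma sub_add: "sub U \<Longrightarrow> a \<in> U \<Longrightarrow> b \<in> U \<Longrightarrow> a + b \<in> U"
  using sub_diff[of U a "- b"] sub_uminus by auto

lemma gen_superset: "S \<subseteq> gen S"
  by (auto simp: gen_def)

lemma gen_least: "sub U \<Longrightarrow> S \<subseteq> U \<Longrightarrow> gen S \<subseteq> U"
  by (auto simp: gen_def)

lemma sub_gen: "sub V \<Longrightarrow> S \<subseteq> V \<Longrightarrow> sub (gen S)"
  unfolding gen_def by (rule sub_Inter) auto

lemma sub_plus_left: "sub W \<Longrightarrow> U \<subseteq> U + W"
  by (metis add.right_neutral set_plus_intro sub_zero subsetI)

lemma sub_plus_right: "sub U \<Longrightarrow> W \<subseteq> U + W"
  by (metis add.left_neutral set_plus_intro sub_zero subsetI)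

lemma sub_plus_least: "sub C \<Longrightarrow> U \<subseteq> C \<Longrightarrow> W \<subseteq> C \<Longrightarrow> U + W \<subseteq> C"
  by (auto elim!: set_plus_elim intro: sub_add)

lemma coset_eq:
  assumes N: "sub N" and vw: "v - w \<in> N"
  shows "(+) v ` N = (+) w ` N"
proof -
  have "(+) v ` N \<subseteq> (+) w ` N" if "v - w \<in> N" for v w
  proof
    fix z assume "z \<in> (+) v ` N"
    then obtain n where "n \<in> N" "z = v + n" by auto
    then have "z = w + ((v - w) + n)" "(v - w) + n \<in> N"
      using sub_add[OF N that] by auto
    then show "z \<in> (+) w ` N" by blast
  qed
  from this[OF vw] this[of w v] show ?thesis
    using sub_uminus[OF N vw] by auto
qed

text \<open>
  For a submodule \<open>C\<close> that contains \<open>N\<close>, consider the tuples \<open>t\<close> that are congruent to a given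
  tuple \<open>c\<close> modulo \<open>D\<close> and generate \<open>C\<close> over \<open>N\<close>. If \<open>c\<close> generates \<open>C\<close> modulo \<open>D\<close>, their number,
  taken modulo \<open>N\<close>, does not depend on \<open>c\<close>: all tuples in \<open>C\<close> congruent to \<open>c\<close> are as many as the
  tuples in \<open>C \<inter> D\<close>, and those that generate a smaller submodule are counted by induction. For
  \<open>C = V\<close> the tuple \<open>\<pi>\<close> shows that the number is not zero.
\<close>

lemma gaschutz:
  fixes c \<pi> :: "nat \<Rightarrow> 'a"
  assumes V: "sub V" and N: "sub N" and D: "sub D" and ND: "N \<subseteq> D" and DV: "D \<subseteq> V"
    and fin: "finite ((\<lambda>v. (+) v ` N) ` V)"
    and cV: "\<And>i. i < m \<Longrightarrow> c i \<in> V" and cD: "V \<subseteq> gen (N \<union> c ` {..<m}) + D"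
    and piV: "\<And>i. i < m \<Longrightarrow> \<pi> i \<in> V" and pigen: "V \<subseteq> gen (N \<union> \<pi> ` {..<m})"
  shows "\<exists>t. (\<forall>i<m. t i \<in> V \<and> t i - c i \<in> D) \<and> V \<subseteq> gen (N \<union> t ` {..<m})"
proof -
  have NV: "N \<subseteq> V" using ND DV by auto
  define rep where "rep v = (SOME w. w \<in> (+) v ` N)" for v
  have rep_in: "rep v \<in> (+) v ` N" for v
    unfolding rep_def by (rule someI[where x = "v + 0"]) (use sub_zero[OF N] in blast)
  have repN: "rep v - v \<in> N" for v
    using rep_in[of v] by auto
  have repN': "v - rep v \<in> N" for v
    using sub_uminus[OF N repN[of v]] by simp
  have rep_eq: "rep v = rep w" if "v - w \<in> N" for v w
    using coset_eq[OF N that] by (simp add: rep_def)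
  define T where "T = rep ` V"
  have finT: "finite T"
  proof -
    have "T = (\<lambda>S. SOME w. w \<in> S) ` (\<lambda>v. (+) v ` N) ` V"
      by (auto simp: T_def rep_def image_image)
    with fin show ?thesis by auto
  qed
  have rep_T: "rep s = s" if "s \<in> T" for s
    using that rep_eq[OF repN] by (auto simp: T_def)
  have in_sub_rep: "rep v \<in> C \<longleftrightarrow> v \<in> C" if "sub C" "N \<subseteq> C" for v C
  proof
    assume "rep v \<in> C" then have "rep v - (rep v - v) \<in> C" using that repN sub_diff by blast
    then show "v \<in> C" by simp
  next
    assume "v \<in> C" then have "v - (v - rep v) \<in> C" using that repN' sub_diff by blast
    then show "rep v \<in> C" by simp
  qed
  have TV: "T \<subseteq> V"
    using in_sub_rep[OF V NV] by (auto simp: T_def)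
  have repT: "v \<in> V \<Longrightarrow> rep v \<in> T" for v by (simp add: T_def)
  define G where "G t = gen (N \<union> t ` {..<m})" for t :: "nat \<Rightarrow> 'a"
  have G_least: "G t \<subseteq> U" if "sub U" "N \<subseteq> U" "\<And>i. i < m \<Longrightarrow> t i \<in> U" for t U
    unfolding G_def using that by (intro gen_least) auto
  have G_sub: "sub (G t)" if "\<And>i. i < m \<Longrightarrow> t i \<in> V" for t
    unfolding G_def using that NV by (intro sub_gen[OF V]) auto
  have G_N: "N \<subseteq> G t" for t using gen_superset[of "N \<union> t ` {..<m}"] by (auto simp: G_def)
  have G_t: "i < m \<Longrightarrow> t i \<in> G t" for t i
    using gen_superset[of "N \<union> t ` {..<m}"] by (auto simp: G_def)
  have G_shift: "G s + D \<subseteq> G t + D"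
    if tV: "\<And>i. i < m \<Longrightarrow> t i \<in> V" and sD: "\<And>i. i < m \<Longrightarrow> s i - t i \<in> D" for s t
  proof -
    have sGt: "sub (G t + D)" using G_sub[OF tV] D by (rule sub_plus)
    have "s i \<in> G t + D" if "i < m" for i
      using set_plus_intro[OF G_t[OF that, of t] sD[OF that]] by simp
    moreover have "N \<subseteq> G t + D"
      using ND sub_plus_right[OF G_sub[OF tV], where W = D] by (rule order_trans)
    ultimately have "G s \<subseteq> G t + D"
      by (intro G_least[OF sGt])
    then show ?thesis
      by (rule sub_plus_least[OF sGt _ sub_plus_right[OF G_sub[OF tV]]])
  qed
  define B where
    "B C c = {t \<in> {..<m} \<rightarrow>\<^sub>E T. (\<forall>i<m. t i - c i \<in> D) \<and> G t = C}" for C c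
  define adm where "adm C c \<longleftrightarrow> (\<forall>i<m. c i \<in> C) \<and> C \<subseteq> G c + D" for C c
  have finB: "finite (B C c)" for C c
    by (rule finite_subset[OF _ finite_PiE[of "{..<m}" "\<lambda>_. T"]]) (auto simp: B_def finT)
  have indep: "card (B C c) = card (B C c')"
    if "sub C" "N \<subseteq> C" "C \<subseteq> V" "adm C c" "adm C c'" for C c c'
    using that
  proof (induction "card (T \<inter> C)" arbitrary: C c c' rule: less_induct)
    case less
    note C = less.prems(1,2,3)
    define Sub where "Sub = {C'. sub C' \<and> N \<subseteq> C' \<and> C' \<subseteq> C \<and> C \<subseteq> C' + D}"
    have inj_T: "C1 \<subseteq> C2" if "sub C1" "N \<subseteq> C1" "sub C2" "N \<subseteq> C2" "C1 \<subseteq> V" "T \<inter> C1 \<subseteq> C2" for C1 C2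
    proof
      fix v assume "v \<in> C1"
      then have "rep v \<in> T \<inter> C1" using that repT in_sub_rep by auto
      then show "v \<in> C2" using that in_sub_rep by blast
    qed
    have finSub: "finite Sub"
    proof (rule finite_imageD[where f = "\<lambda>C'. T \<inter> C'"])
      show "finite ((\<lambda>C'. T \<inter> C') ` Sub)"
        by (rule finite_subset[of _ "Pow T"]) (use finT in auto)
      show "inj_on (\<lambda>C'. T \<inter> C') Sub"
      proof (rule inj_onI)
        fix C1 C2 assume *: "C1 \<in> Sub" "C2 \<in> Sub" "T \<inter> C1 = T \<inter> C2"
        then have "C1 \<subseteq> V" "C2 \<subseteq> V" using C(3) by (auto simp: Sub_def)
        with * have "C1 \<subseteq> C2" "C2 \<subseteq> C1"
          using inj_T[of C1 C2] inj_T[of C2 C1] by (simp_all add: Sub_def, blast+)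
        then show "C1 = C2" by simp
      qed
    qed
    have CSub: "C \<in> Sub" using C sub_plus_left[OF D] by (auto simp: Sub_def)
    have total: "(\<Sum>C'\<in>Sub. card (B C' c)) = card (T \<inter> C \<inter> D) ^ m" if adm: "adm C c" for c
    proof -
      let ?A = "{..<m} \<rightarrow>\<^sub>E T \<inter> C"
      have cC: "c i \<in> C" if "i < m" for i using adm that by (auto simp: adm_def)
      have "(\<Union>C'\<in>Sub. B C' c) = PiE {..<m} (\<lambda>i. {s \<in> T \<inter> C. s - c i \<in> D})" (is "?L = ?R")
      proof (intro equalityI subsetI)
        fix t assume "t \<in> ?L"
        then show "t \<in> ?R" using G_t[of _ t] by (auto simp: B_def Sub_def PiE_iff)
      next
        fix t assume t: "t \<in> ?R"
        then have t': "t i \<in> T" "t i \<in> C" "t i - c i \<in> D" if "i < m" for i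
          using that by (auto simp: PiE_iff)
        have tV: "t i \<in> V" if "i < m" for i using t'[OF that] C by auto
        have "c i - t i \<in> D" if "i < m" for i
          using sub_uminus[OF D t'(3)[OF that]] by simp
        then have "C \<subseteq> G t + D"
          using adm G_shift[of t c] tV unfolding adm_def by blast
        then have "G t \<in> Sub"
          using G_sub[of t] tV G_N[of t] G_least[of C t] C t' by (auto simp: Sub_def)
        then show "t \<in> ?L" using t t' by (auto simp: B_def PiE_iff)
      qed
      moreover have "card (\<Union>C'\<in>Sub. B C' c) = (\<Sum>C'\<in>Sub. card (B C' c))"
        using finSub finB by (intro card_UN_disjoint) (auto simp: B_def)
      moreover have "card {s \<in> T \<inter> C. s - c i \<in> D} = card (T \<inter> C \<inter> D)" if "i < m" for i
      proof (rule bij_betw_same_card[of "\<lambda>s. rep (s - c i)"],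
             rule bij_betw_byWitness[where f' = "\<lambda>u. rep (u + c i)"])
        have DD: "rep v \<in> D \<longleftrightarrow> v \<in> D" for v using in_sub_rep[OF D ND] .
        have CC: "rep v \<in> C \<longleftrightarrow> v \<in> C" for v using in_sub_rep[OF C(1,2)] .
        have cancel: "rep (rep (a - e) + e) = a" if "a \<in> T" for a e
          using rep_T[OF that] rep_eq[of "rep (a - e) + e" a] repN[of "a - e"]
          by (simp add: algebra_simps)
        show "\<forall>a\<in>{s \<in> T \<inter> C. s - c i \<in> D}. rep (rep (a - c i) + c i) = a"
          using cancel by blast
        show "\<forall>a'\<in>T \<inter> C \<inter> D. rep (rep (a' + c i) - c i) = a'"
          using cancel[of _ "- c i"] by simp
        show "(\<lambda>s. rep (s - c i)) ` {s \<in> T \<inter> C. s - c i \<in> D} \<subseteq> T \<inter> C \<inter> D"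
          using DD CC repT[OF subsetD[OF C(3)]] sub_diff[OF C(1) _ cC[OF that]] by auto
        show "(\<lambda>u. rep (u + c i)) ` (T \<inter> C \<inter> D) \<subseteq> {s \<in> T \<inter> C. s - c i \<in> D}"
        proof
          fix z assume "z \<in> (\<lambda>u. rep (u + c i)) ` (T \<inter> C \<inter> D)"
          then obtain u where u: "u \<in> T" "u \<in> C" "u \<in> D" "z = rep (u + c i)" by auto
          have uc: "u + c i \<in> C" using u cC[OF that] sub_add[OF C(1)] by auto
          then have "z \<in> T" "z \<in> C" using u CC repT C by auto
          moreover have "z - c i = (z - (u + c i)) + u" by simp
          then have "z - c i \<in> D" using u ND repN[of "u + c i"] sub_add[OF D] by (metis subsetD)
          ultimately show "z \<in> {s \<in> T \<inter> C. s - c i \<in> D}" by auto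
        qed
      qed
      ultimately show ?thesis by (simp add: card_PiE)
    qed
    have smaller: "card (B C' c) = card (B C' c')" if C': "C' \<in> Sub - {C}" for C'
    proof -
      have C'': "sub C'" "N \<subseteq> C'" "C' \<subseteq> V" "C' \<subseteq> C" "C \<subseteq> C' + D" "C' \<noteq> C"
        using C' C by (auto simp: Sub_def)
      have "T \<inter> C' \<subset> T \<inter> C"
        using C'' inj_T[of C C'] C by blast
      then have lt: "card (T \<inter> C') < card (T \<inter> C)"
        using finT by (intro psubset_card_mono) auto
      have move: "\<exists>b. adm C' b \<and> B C' a = B C' b" if adm: "adm C a" for a
      proof -
        have "\<forall>i<m. \<exists>u. u \<in> C' \<and> a i - u \<in> D"
        proof (intro allI impI)
          fix i assume "i < m"
          then have "a i \<in> C' + D" using adm C'' by (auto simp: adm_def)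
          then show "\<exists>u. u \<in> C' \<and> a i - u \<in> D" by (auto elim!: set_plus_elim)
        qed
        then obtain b where b: "b i \<in> C'" "a i - b i \<in> D" if "i < m" for i by metis
        have "G a + D \<subseteq> G b + D" using b C''(3) by (intro G_shift) auto
        then have "adm C' b" using adm b C''(4) unfolding adm_def by blast
        moreover have "t i - a i \<in> D \<longleftrightarrow> t i - b i \<in> D" if "i < m" for t :: "nat \<Rightarrow> 'a" and i
          using sub_add[OF D _ b(2)[OF that], of "t i - a i"]
            sub_diff[OF D _ b(2)[OF that], of "t i - b i"] by auto
        then have "B C' a = B C' b" by (auto simp: B_def)
        ultimately show ?thesis by blast
      qed
      obtain b b' where "adm C' b" "B C' c = B C' b" "adm C' b'" "B C' c' = B C' b'"
        using move[OF less.prems(4)] move[OF less.prems(5)] by blast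
      then show ?thesis using less.hyps[OF lt C''(1,2,3)] by metis
    qed
    have "card (B C c) + (\<Sum>C'\<in>Sub - {C}. card (B C' c)) =
          card (B C c') + (\<Sum>C'\<in>Sub - {C}. card (B C' c'))"
      using total[OF less.prems(4)] total[OF less.prems(5)] finSub CSub
      by (simp add: sum.remove)
    then show ?case using smaller by simp
  qed
  let ?t = "\<lambda>i\<in>{..<m}. rep (\<pi> i)"
  have "V \<subseteq> G \<pi>" using pigen by (simp add: G_def)
  moreover have "G \<pi> = G ?t"
  proof -
    have tV: "?t i \<in> V" if "i < m" for i using piV[OF that] in_sub_rep[OF V NV] that by simp
    have "?t i \<in> G \<pi>" if "i < m" for i
      using G_t[OF that, of \<pi>] in_sub_rep[OF G_sub[of \<pi>] G_N] piV that by simp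
    moreover have "\<pi> i \<in> G ?t" if "i < m" for i
      using G_t[OF that, of ?t] in_sub_rep[OF G_sub[of ?t] G_N] tV that by simp
    ultimately show ?thesis
      using G_least[of "G \<pi>" ?t] G_least[of "G ?t" \<pi>] G_sub[of ?t] G_sub[of \<pi>] G_N tV piV
      by (intro equalityI) auto
  qed
  moreover have "G \<pi> \<subseteq> V" using piV NV by (intro G_least[OF V]) auto
  ultimately have "?t \<in> B V \<pi>"
    using repT piV repN ND by (auto simp: B_def)
  moreover have "adm V \<pi>"
    using piV \<open>V \<subseteq> G \<pi>\<close> sub_plus_left[OF D, of "G \<pi>"] by (auto simp: adm_def)
  moreover have "adm V c" using cV cD by (auto simp: adm_def G_def)
  ultimately have "card (B V c) \<noteq> 0"
    using indep[OF V NV order_refl, of \<pi> c] finB[of V \<pi>] by (metis card_0_eq empty_iff)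
  then obtain t where "t \<in> B V c" by fastforce
  then show ?thesis using TV by (intro exI[of _ t]) (auto simp: B_def G_def PiE_iff)
qed

end

abbreviation cf :: "('a \<Rightarrow>\<^sub>0 int) \<Rightarrow> 'a \<Rightarrow> int" where
  "cf \<equiv> Poly_Mapping.lookup"

section \<open>Free modules over integral group rings\<close>

definition frags :: "'a set \<Rightarrow> ('a \<Rightarrow>\<^sub>0 int) set" where
  "frags A = {c. Poly_Mapping.keys c \<subseteq> A}"

lemma frags_zero [simp]: "0 \<in> frags A"
  by (simp add: frags_def)

lemma frags_diff: "a \<in> frags A \<Longrightarrow> b \<in> frags A \<Longrightarrow> a - b \<in> frags A"
  using keys_diff[of a b] by (auto simp: frags_def)

lemma frags_add: "a \<in> frags A \<Longrightarrow> b \<in> frags A \<Longrightarrow> a + b \<in> frags A"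
  using keys_add[of a b] by (auto simp: frags_def)

lemma frags_cmul: "a \<in> frags A \<Longrightarrow> frag_cmul k a \<in> frags A"
  using keys_cmul[of k a] by (auto simp: frags_def)

lemma frag_of_in_frags [simp]: "frag_of x \<in> frags A \<longleftrightarrow> x \<in> A"
  by (simp add: frags_def)

lemma frags_mono: "A \<subseteq> B \<Longrightarrow> frags A \<subseteq> frags B"
  by (auto simp: frags_def)

lemma frags_lookup: "c \<in> frags A \<Longrightarrow> x \<notin> A \<Longrightarrow> Poly_Mapping.lookup c x = 0"
  by (auto simp: frags_def in_keys_iff)

lemma frags_support:
  assumes "v \<in> frags A" "\<And>x. cf v x = 0 \<Longrightarrow> cf u x = 0"
  shows "u \<in> frags A"
proof -
  have "Poly_Mapping.keys u \<subseteq> Poly_Mapping.keys v" using assms(2) by (auto simp: in_keys_iff)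
  then show ?thesis using assms(1) by (auto simp: frags_def)
qed

lemma frags_induct [consumes 1, case_names zero one diff]:
  assumes "c \<in> frags A" "P 0" "\<And>x. x \<in> A \<Longrightarrow> P (frag_of x)"
    "\<And>a b. a \<in> frags A \<Longrightarrow> b \<in> frags A \<Longrightarrow> P a \<Longrightarrow> P b \<Longrightarrow> P (a - b)"
  shows "P c"
proof -
  have "c \<in> frags A \<and> P c"
    using assms(1) unfolding frags_def mem_Collect_eq
    by (induction c rule: frag_induction) (use assms frags_diff[of _ A] in \<open>auto simp: frags_def\<close>)
  then show ?thesis ..
qed

lemma frag_extend_closed:
  assumes "c \<in> frags A" "0 \<in> S" "\<And>a b. a \<in> S \<Longrightarrow> b \<in> S \<Longrightarrow> a - b \<in> S" "\<And>x. x \<in> A \<Longrightarrow> f x \<in> S"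
  shows "frag_extend f c \<in> S"
  using assms(1) by (induction c rule: frags_induct) (auto simp: frag_extend_diff assms)

lemma frag_extend_in_frags:
  "c \<in> frags A \<Longrightarrow> (\<And>x. x \<in> A \<Longrightarrow> f x \<in> frags B) \<Longrightarrow> frag_extend f c \<in> frags B"
  by (rule frag_extend_closed) (auto intro: frags_diff)

lemma frag_extend_cong:
  "c \<in> frags A \<Longrightarrow> (\<And>x. x \<in> A \<Longrightarrow> f x = g x) \<Longrightarrow> frag_extend f c = frag_extend g c"
  by (rule frag_extend_eq) (auto simp: frags_def)

lemma frag_extend_frag_extend:
  "frag_extend f (frag_extend g c) = frag_extend (\<lambda>x. frag_extend f (g x)) c"
proof -
  have "c \<in> frags UNIV" by (simp add: frags_def)
  then show ?thesis by (induction c rule: frags_induct) (auto simp: frag_extend_diff)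
qed

lemma frag_extend_id:
  assumes "c \<in> frags A" "\<And>x. x \<in> A \<Longrightarrow> f x = frag_of x"
  shows "frag_extend f c = c"
  using assms(1) by (induction c rule: frags_induct) (auto simp: frag_extend_diff assms)

lemma frag_extend_plus_fun: "frag_extend (\<lambda>x. f x + g x) c = frag_extend f c + frag_extend g c"
  by (simp add: frag_extend_def frag_cmul_distrib2 sum.distrib)

lemma frag_cmul_closed:
  fixes v :: "'a \<Rightarrow>\<^sub>0 int"
  assumes "0 \<in> S" "\<And>a b. a \<in> S \<Longrightarrow> b \<in> S \<Longrightarrow> a - b \<in> S" "v \<in> S"
  shows "frag_cmul k v \<in> S"
  using frag_closure_minus_cmul[of "\<lambda>x. x \<in> S"] assms by blast

text \<open>
  The free right module over \<open>\<int>[G]\<close> with basis \<open>I\<close> is the group of integral combinations of the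
  pairs \<open>(i, g)\<close>, where \<open>(i, g)\<close> stands for \<open>e\<^sub>i g\<close>. Then \<open>tr G h\<close> is the action of \<open>h\<close>, and
  \<open>lin G b\<close> is the module homomorphism that sends the basis element \<open>i\<close> to \<open>b i\<close>.
\<close>

definition tr :: "('g, 'z) monoid_scheme \<Rightarrow> 'g \<Rightarrow> ('i \<times> 'g \<Rightarrow>\<^sub>0 int) \<Rightarrow> ('i \<times> 'g \<Rightarrow>\<^sub>0 int)" where
  "tr G h = frag_extend (\<lambda>(i, g). frag_of (i, g \<otimes>\<^bsub>G\<^esub> h))"

definition Fr :: "('g, 'z) monoid_scheme \<Rightarrow> 'i set \<Rightarrow> ('i \<times> 'g \<Rightarrow>\<^sub>0 int) set" where
  "Fr G I = frags (I \<times> carrier G)"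

definition lin :: "('g, 'z) monoid_scheme \<Rightarrow> ('i \<Rightarrow> ('j \<times> 'g \<Rightarrow>\<^sub>0 int))
    \<Rightarrow> ('i \<times> 'g \<Rightarrow>\<^sub>0 int) \<Rightarrow> ('j \<times> 'g \<Rightarrow>\<^sub>0 int)" where
  "lin G b = frag_extend (\<lambda>(i, g). tr G g (b i))"

definition submodule_of :: "('g, 'z) monoid_scheme \<Rightarrow> 'i set \<Rightarrow> ('i \<times> 'g \<Rightarrow>\<^sub>0 int) set \<Rightarrow> bool" where
  "submodule_of G I U \<longleftrightarrow> U \<subseteq> Fr G I \<and> 0 \<in> U \<and> (\<forall>a\<in>U. \<forall>b\<in>U. a - b \<in> U) \<and>
     (\<forall>a\<in>U. \<forall>g\<in>carrier G. tr G g a \<in> U)"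

definition is_basis :: "('g, 'z) monoid_scheme \<Rightarrow> 'i set \<Rightarrow> ('i \<Rightarrow> ('i \<times> 'g \<Rightarrow>\<^sub>0 int)) \<Rightarrow> bool" where
  "is_basis G I b \<longleftrightarrow> (\<forall>i\<in>I. b i \<in> Fr G I) \<and> bij_betw (lin G b) (Fr G I) (Fr G I)"

lemmas tr_diff = frag_extend_diff[of "\<lambda>(i, g). frag_of (i, g \<otimes>\<^bsub>G\<^esub> h)" for G h, folded tr_def]
lemmas tr_add = frag_extend_add[of "\<lambda>(i, g). frag_of (i, g \<otimes>\<^bsub>G\<^esub> h)" for G h, folded tr_def]
lemmas lin_diff = frag_extend_diff[of "\<lambda>(i, g). tr G g (b i)" for G b, folded lin_def]
lemmas lin_add = frag_extend_add[of "\<lambda>(i, g). tr G g (b i)" for G b, folded lin_def]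

lemma tr_zero [simp]: "tr G h 0 = 0" by (simp add: tr_def)
lemma lin_zero [simp]: "lin G b 0 = 0" by (simp add: lin_def)
lemma tr_of [simp]: "tr G h (frag_of (i, g)) = frag_of (i, g \<otimes>\<^bsub>G\<^esub> h)" by (simp add: tr_def)
lemma lin_of [simp]: "lin G b (frag_of (i, g)) = tr G g (b i)" by (simp add: lin_def)
lemma Fr_zero [simp]: "0 \<in> Fr G I" by (simp add: Fr_def)
lemma Fr_diff: "a \<in> Fr G I \<Longrightarrow> b \<in> Fr G I \<Longrightarrow> a - b \<in> Fr G I" by (simp add: Fr_def frags_diff)
lemma Fr_add: "a \<in> Fr G I \<Longrightarrow> b \<in> Fr G I \<Longrightarrow> a + b \<in> Fr G I" by (simp add: Fr_def frags_add)
lemma Fr_mono: "I \<subseteq> J \<Longrightarrow> Fr G I \<subseteq> Fr G J" unfolding Fr_def by (rule frags_mono) auto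
lemma Fr_of [simp]: "frag_of (i, g) \<in> Fr G I \<longleftrightarrow> i \<in> I \<and> g \<in> carrier G" by (simp add: Fr_def)

lemma lin_cong: "v \<in> Fr G A \<Longrightarrow> (\<And>i. i \<in> A \<Longrightarrow> b i = c i) \<Longrightarrow> lin G b v = lin G c v"
  unfolding lin_def Fr_def by (rule frag_extend_cong) auto

lemma lin_add_fun: "lin G (\<lambda>i. b i + c i) v = lin G b v + lin G c v"
  unfolding lin_def by (simp add: tr_add case_prod_unfold flip: frag_extend_plus_fun)

lemma lin_submodule:
  assumes "submodule_of G J U" "v \<in> Fr G A" "\<And>i. i \<in> A \<Longrightarrow> b i \<in> U"
  shows "lin G b v \<in> U"
  using assms(2) unfolding Fr_def lin_def
  by (rule frag_extend_closed) (use assms in \<open>auto simp: submodule_of_def\<close>)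

lemma Fr_induct [consumes 1, case_names zero one diff]:
  assumes "v \<in> Fr G I" "P 0" "\<And>i g. i \<in> I \<Longrightarrow> g \<in> carrier G \<Longrightarrow> P (frag_of (i, g))"
    "\<And>a b. a \<in> Fr G I \<Longrightarrow> b \<in> Fr G I \<Longrightarrow> P a \<Longrightarrow> P b \<Longrightarrow> P (a - b)"
  shows "P v"
  using assms(1) unfolding Fr_def
  by (induction rule: frags_induct) (use assms in \<open>auto simp: Fr_def\<close>)

locale finite_group = group G for G :: "('g, 'z) monoid_scheme" (structure) +
  assumes fin_carrier: "finite (carrier G)"
begin

lemma tr_in: "v \<in> Fr G I \<Longrightarrow> h \<in> carrier G \<Longrightarrow> tr G h v \<in> Fr G I"
  by (induction rule: Fr_induct) (auto simp: tr_diff Fr_diff)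

lemma tr_tr: "v \<in> Fr G I \<Longrightarrow> g \<in> carrier G \<Longrightarrow> h \<in> carrier G \<Longrightarrow> tr G h (tr G g v) = tr G (g \<otimes> h) v"
  by (induction rule: Fr_induct) (auto simp: tr_diff m_assoc)

lemma tr_one: "v \<in> Fr G I \<Longrightarrow> tr G \<one> v = v"
  by (induction rule: Fr_induct) (auto simp: tr_diff)

lemma submodule_Fr: "J \<subseteq> I \<Longrightarrow> submodule_of G I (Fr G J)"
  using Fr_mono[of J I G] by (auto simp: submodule_of_def Fr_diff tr_in)

lemma lin_in: "v \<in> Fr G A \<Longrightarrow> (\<And>i. i \<in> A \<Longrightarrow> b i \<in> Fr G I) \<Longrightarrow> lin G b v \<in> Fr G I"
  using lin_submodule[OF submodule_Fr[OF order_refl]] .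

lemma lin_tr:
  assumes "v \<in> Fr G A" "\<And>i. i \<in> A \<Longrightarrow> b i \<in> Fr G I" "h \<in> carrier G"
  shows "lin G b (tr G h v) = tr G h (lin G b v)"
  using assms(1) by (induction rule: Fr_induct) (use assms in \<open>auto simp: tr_diff lin_diff tr_tr[OF assms(2)]\<close>)

lemma lin_lin:
  assumes "v \<in> Fr G A" "\<And>i. i \<in> A \<Longrightarrow> c i \<in> Fr G B" "\<And>i. i \<in> B \<Longrightarrow> b i \<in> Fr G I"
  shows "lin G b (lin G c v) = lin G (\<lambda>i. lin G b (c i)) v"
  using assms(1) by (induction rule: Fr_induct) (use assms in \<open>auto simp: lin_diff lin_tr[OF assms(2,3)]\<close>)

lemma lin_unit: "b i \<in> Fr G I \<Longrightarrow> lin G b (frag_of (i, \<one>)) = b i"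
  by (simp add: tr_one)

lemma lin_units: "v \<in> Fr G A \<Longrightarrow> lin G (\<lambda>i. frag_of (i, \<one>)) v = v"
  by (induction rule: Fr_induct) (auto simp: lin_diff)

sublocale submodules: subgroup_family "submodule_of G I"
proof
  fix U W assume UW: "submodule_of G I U" "submodule_of G I W"
  show "submodule_of G I (U + W)"
    unfolding submodule_of_def
  proof (intro conjI ballI subsetI)
    fix a assume "a \<in> U + W" then show "a \<in> Fr G I"
      using UW by (auto elim!: set_plus_elim intro: Fr_add simp: submodule_of_def)
  next
    show "0 \<in> U + W" using UW set_plus_intro[of 0 U 0 W] by (auto simp: submodule_of_def)
  next
    fix a b assume "a \<in> U + W" "b \<in> U + W"
    then obtain u w u' w' where *: "u \<in> U" "w \<in> W" "u' \<in> U" "w' \<in> W" "a = u + w" "b = u' + w'"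
      by (auto elim!: set_plus_elim)
    then have "(u - u') + (w - w') \<in> U + W" using UW by (intro set_plus_intro) (auto simp: submodule_of_def)
    then show "a - b \<in> U + W" using * by (simp add: algebra_simps)
  next
    fix a g assume "a \<in> U + W" "g \<in> carrier G"
    then show "tr G g a \<in> U + W"
      using UW by (auto elim!: set_plus_elim simp: tr_add submodule_of_def intro!: set_plus_intro)
  qed
next
  fix F assume "F \<noteq> {}" "\<And>U. U \<in> F \<Longrightarrow> submodule_of G I U"
  then show "submodule_of G I (\<Inter>F)" unfolding submodule_of_def by blast
qed (auto simp: submodule_of_def)

lemma submodule_span:
  assumes "\<And>i. i \<in> A \<Longrightarrow> b i \<in> Fr G I"
  shows "submodule_of G I (lin G b ` Fr G A)"
  unfolding submodule_of_def
proof (intro conjI ballI subsetI)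
  fix x assume "x \<in> lin G b ` Fr G A" then show "x \<in> Fr G I" using lin_in assms by auto
next
  show "0 \<in> lin G b ` Fr G A" by (rule image_eqI[where x = 0]) auto
next
  fix x y assume "x \<in> lin G b ` Fr G A" "y \<in> lin G b ` Fr G A"
  then show "x - y \<in> lin G b ` Fr G A" by (auto simp: Fr_diff simp flip: lin_diff)
next
  fix x g assume "x \<in> lin G b ` Fr G A" and g: "g \<in> carrier G"
  then obtain v where "v \<in> Fr G A" "x = lin G b v" by auto
  then have "tr G g x = lin G b (tr G g v)" "tr G g v \<in> Fr G A"
    using lin_tr[of v A b I g] assms g tr_in[of v A g] by auto
  then show "tr G g x \<in> lin G b ` Fr G A" by blast
qed

lemma span_least:
  "submodule_of G I U \<Longrightarrow> (\<And>i. i \<in> A \<Longrightarrow> b i \<in> U) \<Longrightarrow> lin G b ` Fr G A \<subseteq> U"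
  using lin_submodule[of G I U] by auto

lemma span_gen:
  assumes "i \<in> A" "b i \<in> Fr G I"
  shows "b i \<in> lin G b ` Fr G A"
  by (rule image_eqI[where x = "frag_of (i, \<one>)"]) (use assms lin_unit[of b i I] in auto)

lemma span_mono: "A \<subseteq> B \<Longrightarrow> lin G b ` Fr G A \<subseteq> lin G b ` Fr G B"
  using Fr_mono by blast

lemma basis_span: "is_basis G I b \<Longrightarrow> lin G b ` Fr G I = Fr G I"
  by (simp add: is_basis_def bij_betw_def)

lemma is_basis_units: "is_basis G I (\<lambda>i. frag_of (i, \<one>))"
  unfolding is_basis_def
proof
  show "bij_betw (lin G (\<lambda>i. frag_of (i, \<one>))) (Fr G I) (Fr G I)"
    by (subst bij_betw_cong[of _ _ id]) (auto simp: lin_units)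
qed auto

text \<open>
  Elementary transformations: adding to some members of a basis combinations of the others.
  The transformation differs from the identity by a map of square zero, so reversing the signs
  inverts it.
\<close>

lemma basis_change:
  fixes b b' :: "'i \<Rightarrow> ('i \<times> 'g \<Rightarrow>\<^sub>0 int)"
  assumes b: "is_basis G I b" and J: "J \<subseteq> I"
    and same: "\<And>i. i \<in> J \<Longrightarrow> b' i = b i"
    and diff: "\<And>i. i \<in> I - J \<Longrightarrow> b' i - b i \<in> lin G b ` Fr G J"
  shows "is_basis G I b'"
proof -
  have bI: "\<And>i. i \<in> I \<Longrightarrow> b i \<in> Fr G I" and bij: "bij_betw (lin G b) (Fr G I) (Fr G I)"
    using b by (auto simp: is_basis_def)
  have "\<forall>i\<in>I - J. \<exists>u\<in>Fr G J. b' i - b i = lin G b u" using diff by blast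
  then obtain u0 where u0: "\<And>i. i \<in> I - J \<Longrightarrow> u0 i \<in> Fr G J" "\<And>i. i \<in> I - J \<Longrightarrow> b' i - b i = lin G b (u0 i)"
    by metis
  define u where "u i = (if i \<in> I - J then u0 i else 0)" for i
  have uJ: "u i \<in> Fr G J" for i using u0 by (auto simp: u_def)
  have ub: "b' i = b i + lin G b (u i)" if "i \<in> I" for i
    using u0 same that by (auto simp: u_def algebra_simps)
  define e where "e i = frag_of (i, \<one>)" for i :: 'i
  have eI: "e i \<in> Fr G I" if "i \<in> I" for i using that by (simp add: e_def)
  have uI: "u i \<in> Fr G I" for i using uJ[of i] Fr_mono[OF J] by auto
  let ?c = "\<lambda>i. e i + u i" and ?c' = "\<lambda>i. e i - u i"
  have fixJ: "lin G ?c w = w" "lin G ?c' w = w" if "w \<in> Fr G J" for w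
  proof -
    have "lin G ?c w = lin G e w" "lin G ?c' w = lin G e w"
      using that J by (auto intro!: lin_cong simp: u_def)
    then show "lin G ?c w = w" "lin G ?c' w = w" using lin_units[OF that] by (auto simp: e_def[abs_def])
  qed
  have ce: "lin G ?c (e i) = e i + u i" "lin G ?c' (e i) = e i - u i" if "i \<in> I" for i
    using lin_unit[of ?c i I] lin_unit[of ?c' i I] eI[OF that] uI[of i]
    by (auto simp: e_def[of i] Fr_add Fr_diff)
  have inv1: "lin G ?c (lin G ?c' v) = v" if "v \<in> Fr G I" for v
  proof -
    have "lin G ?c (lin G ?c' v) = lin G (\<lambda>i. lin G ?c (e i - u i)) v"
      using that by (intro lin_lin[where B = I and I = I]) (auto intro: Fr_add Fr_diff eI uI)
    also have "\<dots> = lin G e v"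
      using that by (intro lin_cong)
        (auto simp: lin_diff fixJ uJ ce)
    finally show ?thesis using lin_units[OF that] by (simp add: e_def[abs_def])
  qed
  have inv2: "lin G ?c' (lin G ?c v) = v" if "v \<in> Fr G I" for v
  proof -
    have "lin G ?c' (lin G ?c v) = lin G (\<lambda>i. lin G ?c' (e i + u i)) v"
      using that by (intro lin_lin[where B = I and I = I]) (auto intro: Fr_add Fr_diff eI uI)
    also have "\<dots> = lin G e v"
      using that by (intro lin_cong)
        (auto simp: lin_add fixJ uJ ce)
    finally show ?thesis using lin_units[OF that] by (simp add: e_def[abs_def])
  qed
  have cI: "lin G ?c v \<in> Fr G I" "lin G ?c' v \<in> Fr G I" if "v \<in> Fr G I" for v
    using that by (auto intro!: lin_in Fr_add Fr_diff eI uI)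
  have "bij_betw (lin G ?c) (Fr G I) (Fr G I)"
    by (rule bij_betw_byWitness[where f' = "lin G ?c'"]) (auto simp: inv1 inv2 cI)
  then have "bij_betw (lin G b \<circ> lin G ?c) (Fr G I) (Fr G I)" using bij by (rule bij_betw_trans)
  moreover have "(lin G b \<circ> lin G ?c) v = lin G b' v" if v: "v \<in> Fr G I" for v
  proof -
    have "lin G b (lin G ?c v) = lin G (\<lambda>i. lin G b (e i + u i)) v"
      using v by (intro lin_lin[where B = I and I = I]) (auto intro: Fr_add Fr_diff eI uI bI)
    also have "\<dots> = lin G b' v"
      using v by (intro lin_cong) (auto simp: lin_add ub e_def bI tr_one[OF bI])
    finally show ?thesis by simp
  qed
  ultimately have "bij_betw (lin G b') (Fr G I) (Fr G I)" by (simp cong: bij_betw_cong)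
  moreover have "b' i \<in> Fr G I" if "i \<in> I" for i
    using ub[OF that] bI that lin_in[OF uI[of i] bI] by (auto intro: Fr_add)
  ultimately show ?thesis by (simp add: is_basis_def)
qed

end

lemma set_plus_diffE:
  fixes x :: "'a::ab_group_add"
  assumes "x \<in> A + B"
  shows "\<exists>a\<in>A. x - a \<in> B" "\<exists>b\<in>B. x - b \<in> A"
  using assms by (auto elim!: set_plus_elim intro: bexI[rotated])

section \<open>Adapted bases and cancellation\<close>

text \<open>
  A finitely generated abelian group \<open>Q\<close> with \<open>Q = 2Q\<close> is finite of odd order. Generators are
  removed one at a time: modulo the others a generator \<open>\<omega>\<close> satisfies \<open>k \<omega> = 2 a \<omega>\<close> with \<open>k\<close> odd,
  so the odd multiple \<open>(k - 2a) \<omega>\<close> lies in the span of the others.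
\<close>

lemma odd_multiple:
  fixes N :: "('a \<Rightarrow>\<^sub>0 int) set"
  assumes fin: "finite \<Omega>" and N0: "0 \<in> N" and Nd: "\<And>a b. a \<in> N \<Longrightarrow> b \<in> N \<Longrightarrow> a - b \<in> N"
    and half: "\<And>v. v \<in> frags \<Omega> \<Longrightarrow> \<exists>u\<in>frags \<Omega>. v - (u + u) \<in> N"
  shows "\<exists>k. odd k \<and> (\<forall>v\<in>frags \<Omega>. frag_cmul k v \<in> N)"
proof -
  have Na: "a + b \<in> N" if "a \<in> N" "b \<in> N" for a b
    using Nd[OF that(1) Nd[OF N0 that(2)]] by simp
  have Nc: "frag_cmul k a \<in> N" if "a \<in> N" for a k
    using frag_cmul_closed[OF N0 Nd that] .
  have "\<exists>k. odd k \<and> (\<forall>v\<in>frags \<Omega>. \<exists>w\<in>frags (\<Omega> - A). frag_cmul k v - w \<in> N)" if "A \<subseteq> \<Omega>" for A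
    using finite_subset[OF that fin] that
  proof (induction A)
    case empty
    have "\<exists>w\<in>frags \<Omega>. v - w \<in> N" if "v \<in> frags \<Omega>" for v
      using that N0 by (intro bexI[of _ v]) auto
    then show ?case by (intro exI[of _ 1]) simp
  next
    case (insert x A)
    then obtain k where k: "odd k"
      "\<And>v. v \<in> frags \<Omega> \<Longrightarrow> \<exists>w\<in>frags (\<Omega> - A). frag_cmul k v - w \<in> N" by auto
    have split: "\<exists>w'\<in>frags (\<Omega> - insert x A). \<exists>a. w = w' + frag_cmul a (frag_of x)"
      if "w \<in> frags (\<Omega> - A)" for w
    proof (intro bexI exI)
      show "w = (w - frag_cmul (cf w x) (frag_of x)) + frag_cmul (cf w x) (frag_of x)" by simp
      have "cf (w - frag_cmul (cf w x) (frag_of x)) x = 0"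
        by (simp add: lookup_minus)
      moreover have "w - frag_cmul (cf w x) (frag_of x) \<in> frags (\<Omega> - A)"
        using that insert by (intro frags_diff frags_cmul) auto
      ultimately show "w - frag_cmul (cf w x) (frag_of x) \<in> frags (\<Omega> - insert x A)"
        by (auto simp: frags_def in_keys_iff)
    qed
    have x: "frag_of x \<in> frags \<Omega>" using insert by simp
    obtain u where u: "u \<in> frags \<Omega>" "frag_of x - (u + u) \<in> N" using half[OF x] by auto
    obtain w where w: "w \<in> frags (\<Omega> - A)" "frag_cmul k u - w \<in> N" using k(2)[OF u(1)] by auto
    obtain w' a where w': "w' \<in> frags (\<Omega> - insert x A)" "w = w' + frag_cmul a (frag_of x)"
      using split[OF w(1)] by auto
    define l where "l = k - 2 * a"
    have "odd l" using k by (simp add: l_def)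
    have lx: "frag_cmul l (frag_of x) - (w' + w') \<in> N"
    proof -
      have "frag_cmul l (frag_of x) - (w' + w') =
        frag_cmul k (frag_of x - (u + u)) + ((frag_cmul k u - w) + (frag_cmul k u - w))"
        unfolding l_def w'(2)
        by (rule poly_mapping_eqI) (simp add: lookup_minus lookup_add algebra_simps)
      also have "\<dots> \<in> N" by (intro Na Nc u w)
      finally show ?thesis .
    qed
    show ?case
    proof (intro exI conjI ballI)
      show "odd (l * k)" using \<open>odd l\<close> k by simp
      fix v assume "v \<in> frags \<Omega>"
      then obtain y where y: "y \<in> frags (\<Omega> - A)" "frag_cmul k v - y \<in> N" using k by auto
      obtain y' c where y': "y' \<in> frags (\<Omega> - insert x A)" "y = y' + frag_cmul c (frag_of x)"
        using split[OF y(1)] by auto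
      show "\<exists>w\<in>frags (\<Omega> - insert x A). frag_cmul (l * k) v - w \<in> N"
      proof (rule bexI[where x = "frag_cmul l y' + frag_cmul c (w' + w')"])
        show "frag_cmul l y' + frag_cmul c (w' + w') \<in> frags (\<Omega> - insert x A)"
          by (intro frags_add frags_cmul w' y')
        have "frag_cmul (l * k) v - (frag_cmul l y' + frag_cmul c (w' + w')) =
          frag_cmul l (frag_cmul k v - y) + frag_cmul c (frag_cmul l (frag_of x) - (w' + w'))"
          unfolding y'(2)
          by (rule poly_mapping_eqI) (simp add: lookup_minus lookup_add algebra_simps)
        also have "\<dots> \<in> N" by (intro Na Nc y lx)
        finally show "frag_cmul (l * k) v - (frag_cmul l y' + frag_cmul c (w' + w')) \<in> N" .
      qed
    qed
  qed
  from this[of \<Omega>] obtain k where k: "odd k"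
    "\<And>v. v \<in> frags \<Omega> \<Longrightarrow> \<exists>w\<in>frags (\<Omega> - \<Omega>). frag_cmul k v - w \<in> N" by auto
  have "frag_cmul k v \<in> N" if "v \<in> frags \<Omega>" for v
    using k(2)[OF that] by (auto simp: frags_def)
  with k show ?thesis by blast
qed

lemma finite_frags_bounded:
  assumes "finite \<Omega>" "finite (B :: int set)"
  shows "finite {c \<in> frags \<Omega>. \<forall>x\<in>\<Omega>. cf c x \<in> B}" (is "finite ?S")
proof (rule finite_imageD)
  have "cf ` ?S \<subseteq> {f. \<forall>x. (x \<in> \<Omega> \<longrightarrow> f x \<in> B) \<and> (x \<notin> \<Omega> \<longrightarrow> f x = 0)}"
    using frags_lookup[of _ \<Omega>] by auto
  then show "finite (cf ` ?S)"
    by (rule finite_subset[OF _ finite_set_of_finite_funs[OF assms, of 0]])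
  show "inj_on cf ?S" by (rule inj_onI, rule poly_mapping_eqI) metis
qed

text \<open>
  \<open>\<theta>\<close> is an isomorphism of modules from \<open>M \<oplus> F\<close> onto \<open>N\<close>, where \<open>F\<close> is free on \<open>J\<close>.
\<close>

definition split_iso :: "('g, 'z) monoid_scheme \<Rightarrow> ('i \<times> 'g \<Rightarrow>\<^sub>0 int) set \<Rightarrow> 'j set
    \<Rightarrow> ('l \<times> 'g \<Rightarrow>\<^sub>0 int) set \<Rightarrow> (('i \<times> 'g \<Rightarrow>\<^sub>0 int) \<Rightarrow> ('j \<times> 'g \<Rightarrow>\<^sub>0 int) \<Rightarrow> ('l \<times> 'g \<Rightarrow>\<^sub>0 int)) \<Rightarrow> bool" where
  "split_iso G M J N \<theta> \<longleftrightarrow> bij_betw (case_prod \<theta>) (M \<times> Fr G J) N \<and>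
    (\<forall>\<mu>\<in>M. \<forall>\<mu>'\<in>M. \<forall>l\<in>Fr G J. \<forall>l'\<in>Fr G J. \<theta> (\<mu> + \<mu>') (l + l') = \<theta> \<mu> l + \<theta> \<mu>' l') \<and>
    (\<forall>\<mu>\<in>M. \<forall>l\<in>Fr G J. \<forall>g\<in>carrier G. \<theta> (tr G g \<mu>) (tr G g l) = tr G g (\<theta> \<mu> l))"

lemma split_isoD:
  assumes "split_iso G M J N \<theta>"
  shows "bij_betw (case_prod \<theta>) (M \<times> Fr G J) N"
    "\<And>\<mu> \<mu>' l l'. \<mu> \<in> M \<Longrightarrow> \<mu>' \<in> M \<Longrightarrow> l \<in> Fr G J \<Longrightarrow> l' \<in> Fr G J \<Longrightarrow>
      \<theta> (\<mu> + \<mu>') (l + l') = \<theta> \<mu> l + \<theta> \<mu>' l'"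
    "\<And>\<mu> l g. \<mu> \<in> M \<Longrightarrow> l \<in> Fr G J \<Longrightarrow> g \<in> carrier G \<Longrightarrow>
      \<theta> (tr G g \<mu>) (tr G g l) = tr G g (\<theta> \<mu> l)"
  using assms unfolding split_iso_def by simp_all

context finite_group begin

lemma finite_index:
  fixes N :: "('i \<times> 'g \<Rightarrow>\<^sub>0 int) set"
  assumes "finite I" and N: "submodule_of G I N" and k: "k \<noteq> 0"
    and kN: "\<And>v. v \<in> Fr G I \<Longrightarrow> frag_cmul k v \<in> N"
  shows "finite ((\<lambda>v. (+) v ` N) ` Fr G I)"
proof -
  let ?S = "{c \<in> frags (I \<times> carrier G). \<forall>x\<in>I \<times> carrier G. cf c x \<in> {- \<bar>k\<bar>..\<bar>k\<bar>}}"
  have "(\<lambda>v. (+) v ` N) ` Fr G I \<subseteq> (\<lambda>v. (+) v ` N) ` ?S"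
  proof (rule image_subsetI)
    fix v assume v: "v \<in> Fr G I"
    define r where "r = Poly_Mapping.map (\<lambda>a. a mod k) v"
    define q where "q = Poly_Mapping.map (\<lambda>a. a div k) v"
    have lr: "cf r x = cf v x mod k" and lq: "cf q x = cf v x div k" for x
      by (auto simp: r_def q_def Poly_Mapping.map.rep_eq when_def)
    have "v - r = frag_cmul k q"
      by (rule poly_mapping_eqI) (simp add: lookup_minus lr lq minus_mod_eq_mult_div)
    moreover have "q \<in> Fr G I"
      using v lq frags_support[of v _ q] by (auto simp: Fr_def)
    ultimately have vr: "v - r \<in> N" using kN by simp
    have "cf r x \<in> {- \<bar>k\<bar>..\<bar>k\<bar>}" for x
      using k lr[of x] abs_mod_less[of k "cf v x"] by auto
    moreover have "r \<in> frags (I \<times> carrier G)"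
      using v lr frags_support[of v _ r] by (auto simp: Fr_def)
    ultimately have "r \<in> ?S" by simp
    moreover have "(+) v ` N = (+) r ` N" by (rule submodules.coset_eq[OF N vr])
    ultimately show "(+) v ` N \<in> (\<lambda>v. (+) v ` N) ` ?S" by blast
  qed
  moreover have "finite ?S"
    using assms(1) fin_carrier by (intro finite_frags_bounded) auto
  ultimately show ?thesis by (meson finite_imageI finite_subset)
qed

text \<open>
  Gaschuetz's lemma for a block of a basis: if the block together with \<open>J\<close> spans a finite
  quotient, and that quotient is generated by as many elements as the block has, then
  elementary transformations make the block alone span it.
\<close>

lemma concentrate_generators:
  fixes n :: nat and b :: "nat \<Rightarrow> (nat \<times> 'g \<Rightarrow>\<^sub>0 int)"
  defines "I \<equiv> {..<n}"
  assumes b: "is_basis G I b" and s: "s + m \<le> n" and J: "J \<subseteq> I" "J \<inter> {s..<s + m} = {}"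
    and N: "submodule_of G I N" and fin: "finite ((\<lambda>v. (+) v ` N) ` Fr G I)"
    and bgen: "Fr G I \<subseteq> lin G b ` Fr G ({s..<s + m} \<union> J) + N"
    and pI: "\<And>i. i < m \<Longrightarrow> \<pi> i \<in> Fr G I" and pgen: "Fr G I \<subseteq> lin G \<pi> ` Fr G {..<m} + N"
  shows "\<exists>b'. is_basis G I b' \<and> (\<forall>i\<in>I - {s..<s + m}. b' i = b i) \<and>
    Fr G I \<subseteq> lin G b' ` Fr G {s..<s + m} + N"
proof -
  let ?B = "{s..<s + m}"
  have bI: "i \<in> I \<Longrightarrow> b i \<in> Fr G I" for i using b by (simp add: is_basis_def)
  have B: "?B \<subseteq> I" using s by (auto simp: I_def)
  have V: "submodule_of G I (Fr G I)" by (rule submodule_Fr) simp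
  have NV: "N \<subseteq> Fr G I" using N by (simp add: submodule_of_def)
  define W where "W = lin G b ` Fr G J"
  have W: "submodule_of G I W" unfolding W_def using bI J by (intro submodule_span) auto
  have D: "submodule_of G I (N + W)" using N W by (rule submodules.sub_plus)
  have gen: "submodule_of G I (submodules.gen I (N \<union> t ` {..<m}))"
    if "\<And>i. i < m \<Longrightarrow> t i \<in> Fr G I" for t
    using that NV by (intro submodules.sub_gen[OF V]) auto
  have "\<exists>t. (\<forall>i<m. t i \<in> Fr G I \<and> t i - b (s + i) \<in> N + W) \<and>
      Fr G I \<subseteq> submodules.gen I (N \<union> t ` {..<m})"
  proof (rule submodules.gaschutz[OF V N D _ _ fin, where \<pi> = \<pi>])
    show "N \<subseteq> N + W" by (rule submodules.sub_plus_left[OF W])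
    show "N + W \<subseteq> Fr G I" using D by (simp add: submodule_of_def)
    show "b (s + i) \<in> Fr G I" if "i < m" for i using that by (intro bI subsetD[OF B]) auto
    let ?H = "submodules.gen I (N \<union> (\<lambda>i. b (s + i)) ` {..<m})"
    have H: "submodule_of G I ?H" by (intro gen bI subsetD[OF B]) auto
    have H': "N \<union> (\<lambda>i. b (s + i)) ` {..<m} \<subseteq> ?H" by (rule submodules.gen_superset)
    have HD: "submodule_of G I (?H + (N + W))" using H D by (rule submodules.sub_plus)
    have i1: "?H \<subseteq> ?H + (N + W)" by (rule submodules.sub_plus_left[OF D])
    have i2: "N + W \<subseteq> ?H + (N + W)" by (rule submodules.sub_plus_right[OF H])
    have i3: "W \<subseteq> N + W" by (rule submodules.sub_plus_right[OF N])
    have i4: "N \<subseteq> N + W" by (rule submodules.sub_plus_left[OF W])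
    have "lin G b ` Fr G (?B \<union> J) \<subseteq> ?H + (N + W)"
    proof (rule span_least[OF HD])
      fix i assume "i \<in> ?B \<union> J"
      then show "b i \<in> ?H + (N + W)"
      proof
        assume "i \<in> ?B"
        then have "b i = b (s + (i - s))" "i - s < m" by auto
        then have "b i \<in> ?H" using H' by fastforce
        then show ?thesis using i1 by auto
      next
        assume "i \<in> J"
        then have "b i \<in> W" unfolding W_def using J bI by (intro span_gen[where I = I]) auto
        then show ?thesis using i2 i3 by auto
      qed
    qed
    moreover have "N \<subseteq> ?H + (N + W)" using i2 i4 by auto
    ultimately show "Fr G I \<subseteq> ?H + (N + W)"
      by (intro order_trans[OF bgen] submodules.sub_plus_least[OF HD])
    show "\<pi> i \<in> Fr G I" if "i < m" for i using pI that .
    let ?P = "submodules.gen I (N \<union> \<pi> ` {..<m})"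
    have P: "submodule_of G I ?P" using pI by (rule gen)
    have P': "N \<union> \<pi> ` {..<m} \<subseteq> ?P" by (rule submodules.gen_superset)
    have "lin G \<pi> ` Fr G {..<m} + N \<subseteq> ?P"
      using P' by (intro submodules.sub_plus_least[OF P] span_least[OF P]) auto
    then show "Fr G I \<subseteq> ?P" using pgen by auto
  qed
  then obtain t where t: "\<And>i. i < m \<Longrightarrow> t i \<in> Fr G I" "\<And>i. i < m \<Longrightarrow> t i - b (s + i) \<in> N + W"
    "Fr G I \<subseteq> submodules.gen I (N \<union> t ` {..<m})" by blast
  have "\<forall>i<m. \<exists>w\<in>W. t i - b (s + i) - w \<in> N"
    using t(2) set_plus_diffE(2)[of "t _ - b (s + _)" N W] by blast
  then obtain w where w: "\<And>i. i < m \<Longrightarrow> w i \<in> W" "\<And>i. i < m \<Longrightarrow> t i - b (s + i) - w i \<in> N" by metis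
  define b' where "b' i = (if i \<in> ?B then b i + w (i - s) else b i)" for i
  have "is_basis G I b'"
  proof (rule basis_change[OF b])
    show "I - ?B \<subseteq> I" by auto
    fix i
    show "i \<in> I - ?B \<Longrightarrow> b' i = b i" by (auto simp: b'_def)
    assume "i \<in> I - (I - ?B)"
    then have "i \<in> ?B" by auto
    then have "b' i - b i \<in> W" using w by (auto simp: b'_def)
    then show "b' i - b i \<in> lin G b ` Fr G (I - ?B)"
      using span_mono[of J "I - ?B" b] J unfolding W_def by auto
  qed
  moreover have "\<forall>i\<in>I - ?B. b' i = b i" unfolding b'_def by auto
  moreover have "Fr G I \<subseteq> lin G b' ` Fr G ?B + N"
  proof -
    have b'I: "i \<in> ?B \<Longrightarrow> b' i \<in> Fr G I" for i using \<open>is_basis G I b'\<close> B by (auto simp: is_basis_def)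
    have S: "submodule_of G I (lin G b' ` Fr G ?B)" using b'I by (rule submodule_span)
    have SN: "submodule_of G I (lin G b' ` Fr G ?B + N)" using S N by (rule submodules.sub_plus)
    have "t i \<in> lin G b' ` Fr G ?B + N" if "i < m" for i
    proof -
      have "b' (s + i) \<in> lin G b' ` Fr G ?B" using that b'I by (intro span_gen[where I = I]) auto
      moreover have "t i = b' (s + i) + (t i - b (s + i) - w i)" using that by (simp add: b'_def)
      ultimately show ?thesis using w(2)[OF that] set_plus_intro by metis
    qed
    then have "submodules.gen I (N \<union> t ` {..<m}) \<subseteq> lin G b' ` Fr G ?B + N"
      using submodules.sub_plus_right[OF S, of N] by (intro submodules.gen_least[OF SN]) auto
    then show ?thesis using t(3) by auto
  qed
  ultimately show ?thesis by blast
qed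

text \<open>
  The three blocks of \<open>m\<close> basis vectors have three tasks. The first cuts the quotient by \<open>N\<close> down
  to a finite one, the second generates what is left, and the third is thereby set free to
  become the prescribed generators.
\<close>

theorem adapted_basis:
  fixes n :: nat and \<pi> :: "nat \<Rightarrow> (nat \<times> 'g \<Rightarrow>\<^sub>0 int)"
  defines "I \<equiv> {..<n}"
  assumes N: "submodule_of G I N" and n: "3 * m \<le> n"
    and pI: "\<And>i. i < m \<Longrightarrow> \<pi> i \<in> Fr G I" and pgen: "Fr G I \<subseteq> lin G \<pi> ` Fr G {..<m} + N"
  shows "\<exists>b. is_basis G I b \<and> (\<forall>i<n - m. b i \<in> N) \<and> (\<forall>i<m. b (n - m + i) - \<pi> i \<in> N)"
proof -
  have V: "submodule_of G I (Fr G I)" by (rule submodule_Fr) simp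
  have NV: "N \<subseteq> Fr G I" using N by (simp add: submodule_of_def)
  have finI: "finite I" by (simp add: I_def)
  have plus_mono: "A + B \<subseteq> A' + B'" if "A \<subseteq> A'" "B \<subseteq> B'" for A B A' B' :: "(nat \<times> 'g \<Rightarrow>\<^sub>0 int) set"
    using that by (auto elim!: set_plus_elim intro!: set_plus_intro)
  \<comment> \<open>First block: a set that generates modulo 2 spans a subgroup of odd index.\<close>
  define V2 where "V2 = (\<lambda>v. v + v) ` Fr G I"
  have V2: "submodule_of G I V2"
    unfolding submodule_of_def V2_def
  proof (intro conjI ballI)
    show "(\<lambda>v. v + v) ` Fr G I \<subseteq> Fr G I" by (auto intro: Fr_add)
    show "0 \<in> (\<lambda>v. v + v) ` Fr G I" by (rule image_eqI[where x = 0]) auto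
  next
    fix a b assume "a \<in> (\<lambda>v. v + v) ` Fr G I" "b \<in> (\<lambda>v. v + v) ` Fr G I"
    then obtain u v where "u \<in> Fr G I" "v \<in> Fr G I" "a = u + u" "b = v + v" by auto
    then show "a - b \<in> (\<lambda>v. v + v) ` Fr G I"
      by (intro image_eqI[where x = "u - v"]) (auto intro: Fr_diff)
  next
    fix a g assume "a \<in> (\<lambda>v. v + v) ` Fr G I" "g \<in> carrier G"
    then show "tr G g a \<in> (\<lambda>v. v + v) ` Fr G I" by (auto simp: tr_add intro: tr_in)
  qed
  have NV2: "submodule_of G I (N + V2)" using N V2 by (rule submodules.sub_plus)
  have "Fr G I \<subseteq> lin G \<pi> ` Fr G {..<m} + (N + V2)"
    by (rule order_trans[OF pgen plus_mono[OF order_refl submodules.sub_plus_left[OF V2]]])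
  moreover have "{0..<0 + m} \<union> {m..<n} = I" using n by (auto simp: I_def)
  moreover have "finite ((\<lambda>v. (+) v ` (N + V2)) ` Fr G I)"
  proof (rule finite_index[OF finI NV2, of 2])
    fix v assume "v \<in> Fr G I"
    then have "frag_cmul 2 v \<in> V2" by (auto simp: V2_def frag_cmul_distrib[of 1 1, simplified])
    then show "frag_cmul 2 v \<in> N + V2" using submodules.sub_plus_right[OF N, of V2] by auto
  qed simp
  moreover have "Fr G I \<subseteq> Fr G I + (N + V2)" by (rule submodules.sub_plus_left[OF NV2])
  ultimately obtain b1 where b1: "is_basis G I b1" "Fr G I \<subseteq> lin G b1 ` Fr G {..<m} + (N + V2)"
    using concentrate_generators[of n "\<lambda>i. frag_of (i, \<one>)" 0 m "{m..<n}" "N + V2" \<pi>]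
      is_basis_units[of I] basis_span[OF is_basis_units[of I]] pI NV2 n
    unfolding I_def by (auto simp: lessThan_atLeast0)
  have b1I: "i \<in> I \<Longrightarrow> b1 i \<in> Fr G I" for i using b1 by (simp add: is_basis_def)
  define N1 where "N1 = lin G b1 ` Fr G {..<m} + N"
  have S1: "submodule_of G I (lin G b1 ` Fr G {..<m})"
    using b1I n by (intro submodule_span) (auto simp: I_def)
  have N1: "submodule_of G I N1" unfolding N1_def using S1 N by (rule submodules.sub_plus)
  have NN1: "N \<subseteq> N1" unfolding N1_def by (rule submodules.sub_plus_right[OF S1])
  have "\<exists>k::int. odd k \<and> (\<forall>v\<in>frags (I \<times> carrier G). frag_cmul k v \<in> N1)"
  proof (rule odd_multiple)
    show "finite (I \<times> carrier G)" using finI fin_carrier by simp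
    show "0 \<in> N1" using N1 by (simp add: submodule_of_def)
    show "a - b \<in> N1" if "a \<in> N1" "b \<in> N1" for a b using N1 that by (simp add: submodule_of_def)
    fix v assume "v \<in> frags (I \<times> carrier G)"
    then have "v \<in> lin G b1 ` Fr G {..<m} + (N + V2)" using b1(2) by (auto simp: Fr_def)
    then have "v \<in> N1 + V2" by (simp add: N1_def add.assoc)
    then obtain a u where "a \<in> N1" "u \<in> Fr G I" "v = a + (u + u)"
      by (auto elim!: set_plus_elim simp: V2_def)
    then show "\<exists>u\<in>frags (I \<times> carrier G). v - (u + u) \<in> N1"
      by (intro bexI[where x = u]) (auto simp: Fr_def)
  qed
  then obtain k :: int where "odd k" "\<And>v. v \<in> Fr G I \<Longrightarrow> frag_cmul k v \<in> N1" by (auto simp: Fr_def)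
  then have fin1: "finite ((\<lambda>v. (+) v ` N1) ` Fr G I)"
    by (intro finite_index[OF finI N1, of k]) auto
  have "Fr G I \<subseteq> lin G \<pi> ` Fr G {..<m} + N1"
    by (rule order_trans[OF pgen plus_mono[OF order_refl NN1]])
  moreover have "Fr G I \<subseteq> lin G b1 ` Fr G ({m..<m + m} \<union> {2 * m..<n}) + N1"
  proof -
    have S2: "submodule_of G I (lin G b1 ` Fr G {m..<n})"
      using b1I by (intro submodule_span) (auto simp: I_def)
    have SS: "submodule_of G I (lin G b1 ` Fr G {m..<n} + N1)" using S2 N1 by (rule submodules.sub_plus)
    have "lin G b1 ` Fr G I \<subseteq> lin G b1 ` Fr G {m..<n} + N1"
    proof (rule span_least[OF SS])
      fix i assume i: "i \<in> I"
      show "b1 i \<in> lin G b1 ` Fr G {m..<n} + N1"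
      proof (cases "i < m")
        case True
        then have "b1 i \<in> lin G b1 ` Fr G {..<m}" using b1I i by (intro span_gen) auto
        then have "b1 i \<in> N1"
          unfolding N1_def by (rule subsetD[OF submodules.sub_plus_left[OF N]])
        then show ?thesis by (rule subsetD[OF submodules.sub_plus_right[OF S2]])
      next
        case False
        then have "b1 i \<in> lin G b1 ` Fr G {m..<n}" using b1I i by (intro span_gen) (auto simp: I_def)
        then show ?thesis by (rule subsetD[OF submodules.sub_plus_left[OF N1]])
      qed
    qed
    moreover have "{m..<m + m} \<union> {2 * m..<n} = {m..<n}" using n by auto
    ultimately show ?thesis using basis_span[OF b1(1)] by simp
  qed
  ultimately have "\<exists>b'. is_basis G I b' \<and> (\<forall>i\<in>I - {m..<m + m}. b' i = b1 i) \<and>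
      Fr G I \<subseteq> lin G b' ` Fr G {m..<m + m} + N1"
    using b1(1) N1 fin1 pI n unfolding I_def
    by (intro concentrate_generators[where J = "{2 * m..<n}" and \<pi> = \<pi>]) auto
  then obtain b2 where b2: "is_basis G I b2" "\<And>i. i \<in> I - {m..<m + m} \<Longrightarrow> b2 i = b1 i"
    "Fr G I \<subseteq> lin G b2 ` Fr G {m..<m + m} + N1" by blast
  have b2I: "i \<in> I \<Longrightarrow> b2 i \<in> Fr G I" for i using b2 by (simp add: is_basis_def)
  let ?L = "{..<n - m}" and ?R = "{n - m..<n}"
  have gen2: "Fr G I \<subseteq> lin G b2 ` Fr G ?L + N"
  proof -
    have S: "submodule_of G I (lin G b2 ` Fr G ?L)"
      using b2I by (intro submodule_span) (auto simp: I_def)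
    have "lin G b2 ` Fr G {m..<m + m} \<subseteq> lin G b2 ` Fr G ?L" using n by (intro span_mono) auto
    moreover have "lin G b1 ` Fr G {..<m} \<subseteq> lin G b2 ` Fr G ?L"
    proof (rule span_least[OF S])
      fix i assume i: "i \<in> {..<m}"
      then have "b2 i \<in> lin G b2 ` Fr G ?L"
        using n by (intro span_gen[where I = I] b2I) (auto simp: I_def)
      then show "b1 i \<in> lin G b2 ` Fr G ?L" using b2(2)[of i] i n by (auto simp: I_def)
    qed
    ultimately have "lin G b2 ` Fr G {m..<m + m} + N1 \<subseteq> lin G b2 ` Fr G ?L + N"
      unfolding N1_def
      by (intro submodules.sub_plus_least[OF submodules.sub_plus[OF S N]]
            order_trans[OF _ submodules.sub_plus_left[OF N]] submodules.sub_plus_right[OF S])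
    then show ?thesis using b2(3) by auto
  qed
  have "\<forall>i\<in>?R. \<exists>w\<in>lin G b2 ` Fr G ?L. \<pi> (i - (n - m)) - b2 i - w \<in> N"
  proof
    fix i assume i: "i \<in> ?R"
    then have "\<pi> (i - (n - m)) - b2 i \<in> Fr G I"
      using n by (intro Fr_diff pI b2I) (auto simp: I_def)
    then show "\<exists>w\<in>lin G b2 ` Fr G ?L. \<pi> (i - (n - m)) - b2 i - w \<in> N"
      using set_plus_diffE(1)[OF subsetD[OF gen2]] by blast
  qed
  then obtain w where w: "\<And>i. i \<in> ?R \<Longrightarrow> w i \<in> lin G b2 ` Fr G ?L"
    "\<And>i. i \<in> ?R \<Longrightarrow> \<pi> (i - (n - m)) - b2 i - w i \<in> N" by metis
  \<comment> \<open>The last block becomes a lift of \<open>\<pi>\<close>.\<close>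
  define b3 where "b3 i = (if i \<in> ?R then b2 i + w i else b2 i)" for i
  have b3: "is_basis G I b3"
  proof (rule basis_change[OF b2(1), of ?L])
    show "?L \<subseteq> I" by (auto simp: I_def)
    show "b3 i = b2 i" if "i \<in> ?L" for i using that by (auto simp: b3_def)
    show "b3 i - b2 i \<in> lin G b2 ` Fr G ?L" if "i \<in> I - ?L" for i
      using w that by (auto simp: b3_def I_def)
  qed
  have b3I: "i \<in> I \<Longrightarrow> b3 i \<in> Fr G I" for i using b3 by (simp add: is_basis_def)
  have b3p: "\<pi> i - b3 (n - m + i) \<in> N" if "i < m" for i
    using w(2)[of "n - m + i"] that n by (auto simp: b3_def algebra_simps)
  have gen3: "Fr G I \<subseteq> lin G b3 ` Fr G ?R + N"
  proof -
    have S: "submodule_of G I (lin G b3 ` Fr G ?R)"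
      using b3I by (intro submodule_span) (auto simp: I_def)
    have SN: "submodule_of G I (lin G b3 ` Fr G ?R + N)" using S N by (rule submodules.sub_plus)
    have "\<pi> i \<in> lin G b3 ` Fr G ?R + N" if "i < m" for i
    proof -
      have "b3 (n - m + i) \<in> lin G b3 ` Fr G ?R" 
        using that n by (intro span_gen[where I = I] b3I) (auto simp: I_def)
      then show ?thesis using b3p[OF that] set_plus_intro[of "b3 (n - m + i)" _ "\<pi> i - b3 (n - m + i)"] by simp
    qed
    then have "lin G \<pi> ` Fr G {..<m} \<subseteq> lin G b3 ` Fr G ?R + N" by (intro span_least[OF SN]) auto
    moreover have "N \<subseteq> lin G b3 ` Fr G ?R + N" by (rule submodules.sub_plus_right[OF S])
    ultimately show ?thesis
      by (intro order_trans[OF pgen] submodules.sub_plus_least[OF SN])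
  qed
  have "\<forall>i\<in>?L. \<exists>w\<in>lin G b3 ` Fr G ?R. b3 i - w \<in> N"
  proof
    fix i assume "i \<in> ?L"
    then have "b3 i \<in> Fr G I" by (intro b3I) (auto simp: I_def)
    then show "\<exists>w\<in>lin G b3 ` Fr G ?R. b3 i - w \<in> N"
      using set_plus_diffE(1)[OF subsetD[OF gen3]] by blast
  qed
  then obtain y where y: "\<And>i. i \<in> ?L \<Longrightarrow> y i \<in> lin G b3 ` Fr G ?R"
    "\<And>i. i \<in> ?L \<Longrightarrow> b3 i - y i \<in> N" by metis
  \<comment> \<open>All other basis vectors are moved into \<open>N\<close>.\<close>
  define b4 where "b4 i = (if i \<in> ?L then b3 i - y i else b3 i)" for i
  have "is_basis G I b4"
  proof (rule basis_change[OF b3, of ?R])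
    show "?R \<subseteq> I" by (auto simp: I_def)
    show "b4 i = b3 i" if "i \<in> ?R" for i using that by (auto simp: b4_def)
    show "b4 i - b3 i \<in> lin G b3 ` Fr G ?R" if "i \<in> I - ?R" for i
    proof -
      have S: "submodule_of G I (lin G b3 ` Fr G ?R)"
        using b3I by (intro submodule_span) (auto simp: I_def)
      have "i \<in> ?L" using that by (auto simp: I_def)
      then show ?thesis using submodules.sub_uminus[OF S y(1)] by (simp add: b4_def)
    qed
  qed
  moreover have "\<forall>i<n - m. b4 i \<in> N" using y by (simp add: b4_def)
  moreover have "\<forall>i<m. b4 (n - m + i) - \<pi> i \<in> N"
    using submodules.sub_uminus[OF N b3p] by (simp add: b4_def)
  ultimately show ?thesis by blast
qed

text \<open>
  In an adapted basis, membership in \<open>N\<close> only constrains the last \<open>m\<close> coordinates, and it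
  constrains them exactly as a relation between the \<open>\<pi>\<^sub>i\<close> modulo \<open>N\<close>.
\<close>

theorem submodule_split:
  fixes n m :: nat and N :: "(nat \<times> 'g \<Rightarrow>\<^sub>0 int) set"
    and \<pi> :: "nat \<Rightarrow> (nat \<times> 'g \<Rightarrow>\<^sub>0 int)"
  defines "M \<equiv> {\<mu> \<in> Fr G {..<m}. lin G \<pi> \<mu> \<in> N}"
  assumes N: "submodule_of G {..<n} N" and n: "3 * m \<le> n"
    and pI: "\<And>i. i < m \<Longrightarrow> \<pi> i \<in> Fr G {..<n}"
    and pgen: "Fr G {..<n} \<subseteq> lin G \<pi> ` Fr G {..<m} + N"
  shows "\<exists>\<theta>. split_iso G M {..<n - m} N \<theta>"
proof -
  let ?I = "{..<n}" and ?L = "{..<n - m}"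
  obtain b where b: "is_basis G ?I b" "\<And>i. i < n - m \<Longrightarrow> b i \<in> N"
    "\<And>i. i < m \<Longrightarrow> b (n - m + i) - \<pi> i \<in> N"
    using adapted_basis[OF N n pI pgen] by auto
  have bI: "i < n \<Longrightarrow> b i \<in> Fr G ?I" for i using b(1) by (simp add: is_basis_def)
  have bij: "bij_betw (lin G b) (Fr G ?I) (Fr G ?I)" using b(1) by (simp add: is_basis_def)
  have NI: "N \<subseteq> Fr G ?I" using N by (simp add: submodule_of_def)
  define re where "re = lin G (\<lambda>i. frag_of (n - m + i, \<one>))"
  have reI: "re \<mu> \<in> Fr G ?I" if "\<mu> \<in> Fr G {..<m}" for \<mu>
    unfolding re_def using that n by (intro lin_in) auto
  have LI: "l \<in> Fr G ?I" if "l \<in> Fr G ?L" for l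
    using that Fr_mono[of ?L ?I G] n by auto
  have lin_re: "lin G b (re \<mu>) = lin G \<pi> \<mu> + lin G (\<lambda>i. b (n - m + i) - \<pi> i) \<mu>"
    if "\<mu> \<in> Fr G {..<m}" for \<mu>
  proof -
    have "lin G b (re \<mu>) = lin G (\<lambda>i. lin G b (frag_of (n - m + i, \<one>))) \<mu>"
      unfolding re_def using that n by (intro lin_lin[where B = ?I and I = ?I]) (auto intro: bI)
    also have "\<dots> = lin G (\<lambda>i. \<pi> i + (b (n - m + i) - \<pi> i)) \<mu>"
      using that n by (intro lin_cong) (auto simp: tr_one[OF bI])
    finally show ?thesis by (simp only: lin_add_fun)
  qed
  have in_N: "lin G b (re \<mu> + l) \<in> N \<longleftrightarrow> lin G \<pi> \<mu> \<in> N"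
    if "\<mu> \<in> Fr G {..<m}" "l \<in> Fr G ?L" for \<mu> l
  proof -
    have 1: "lin G (\<lambda>i. b (n - m + i) - \<pi> i) \<mu> \<in> N"
      using b(3) by (intro lin_submodule[OF N that(1)]) auto
    have 2: "lin G b l \<in> N" using b(2) by (intro lin_submodule[OF N that(2)]) auto
    have "lin G b (re \<mu> + l) = lin G \<pi> \<mu> + (lin G (\<lambda>i. b (n - m + i) - \<pi> i) \<mu> + lin G b l)"
      using that by (simp add: lin_add lin_re)
    then show ?thesis
      using submodules.sub_add[OF N _ submodules.sub_add[OF N 1 2], of "lin G \<pi> \<mu>"]
        submodules.sub_diff[OF N _ submodules.sub_add[OF N 1 2], of "lin G b (re \<mu> + l)"] by auto
  qed
  have cf_re: "cf (re \<mu>) (i, g) = (if n - m \<le> i then cf \<mu> (i - (n - m), g) else 0)"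
    if "\<mu> \<in> Fr G {..<m}" for \<mu> i g
    using that
  proof (induction rule: Fr_induct)
    case (one j h)
    then show ?case unfolding re_def by (auto simp: lookup_single when_def)
  qed (auto simp: re_def lin_diff lookup_minus)
  have re_zero: "\<mu> = 0 \<and> l = 0" if "\<mu> \<in> Fr G {..<m}" "l \<in> Fr G ?L" "re \<mu> + l = 0" for \<mu> l
  proof -
    have "cf \<mu> (i, g) = 0" for i g
    proof -
      have "cf (re \<mu> + l) (n - m + i, g) = 0" using that by simp
      moreover have "cf l (n - m + i, g) = 0"
        using that(2) unfolding Fr_def by (rule frags_lookup) auto
      ultimately show ?thesis using cf_re[OF that(1)] by (simp add: lookup_add)
    qed
    then have "\<mu> = 0" by (intro poly_mapping_eqI) auto
    then show ?thesis using that by (simp add: re_def)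
  qed
  have split: "\<exists>\<mu>\<in>Fr G {..<m}. \<exists>l\<in>Fr G ?L. v = re \<mu> + l" if "v \<in> Fr G ?I" for v
    using that
  proof (induction rule: Fr_induct)
    case zero
    then show ?case by (intro bexI[of _ 0]) (auto simp: re_def)
  next
    case (one i g)
    show ?case
    proof (cases "i < n - m")
      case True
      then show ?thesis
        using one by (intro bexI[of _ 0] bexI[of _ "frag_of (i, g)"]) (auto simp: re_def)
    next
      case False
      then show ?thesis
        using one n by (intro bexI[of _ "frag_of (i - (n - m), g)"] bexI[of _ 0]) (auto simp: re_def)
    qed
  next
    case (diff u v)
    then obtain \<mu> l \<mu>' l' where *: "\<mu> \<in> Fr G {..<m}" "\<mu>' \<in> Fr G {..<m}" "l \<in> Fr G ?L" "l' \<in> Fr G ?L"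
      "u = re \<mu> + l" "v = re \<mu>' + l'" by blast
    show ?case
      by (rule bexI[of _ "\<mu> - \<mu>'"], rule bexI[of _ "l - l'"])
         (use * in \<open>auto simp: re_def lin_diff Fr_diff\<close>)
  qed
  define \<theta> where "\<theta> \<mu> l = lin G b (re \<mu> + l)" for \<mu> l
  have MI: "\<mu> \<in> Fr G {..<m}" if "\<mu> \<in> M" for \<mu> using that by (simp add: M_def)
  have "inj_on (case_prod \<theta>) (M \<times> Fr G ?L)"
  proof (rule inj_onI, clarify)
    fix \<mu> l \<mu>' l' assume *: "\<mu> \<in> M" "\<mu>' \<in> M" "l \<in> Fr G ?L" "l' \<in> Fr G ?L" "\<theta> \<mu> l = \<theta> \<mu>' l'"
    then have "re \<mu> + l = re \<mu>' + l'"
      using bij unfolding \<theta>_def bij_betw_def by (elim conjE inj_onD) (auto intro: Fr_add reI MI LI)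
    then have "re (\<mu> - \<mu>') + (l - l') = 0" by (simp add: re_def lin_diff algebra_simps)
    then show "\<mu> = \<mu>' \<and> l = l'" using re_zero[of "\<mu> - \<mu>'" "l - l'"] * by (auto simp: MI Fr_diff)
  qed
  moreover have "case_prod \<theta> ` (M \<times> Fr G ?L) = N"
  proof (intro equalityI subsetI)
    fix v assume "v \<in> case_prod \<theta> ` (M \<times> Fr G ?L)"
    then show "v \<in> N" using in_N by (auto simp: \<theta>_def M_def)
  next
    fix v assume v: "v \<in> N"
    then have "v \<in> lin G b ` Fr G ?I" using NI basis_span[OF b(1)] by auto
    then obtain u where "u \<in> Fr G ?I" "v = lin G b u" by auto
    then obtain \<mu> l where *: "\<mu> \<in> Fr G {..<m}" "l \<in> Fr G ?L" "v = \<theta> \<mu> l"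
      using split[of u] by (auto simp: \<theta>_def)
    then have "\<mu> \<in> M" using v in_N by (simp add: M_def \<theta>_def)
    then show "v \<in> case_prod \<theta> ` (M \<times> Fr G ?L)" using * by force
  qed
  moreover have "\<theta> (\<mu> + \<mu>') (l + l') = \<theta> \<mu> l + \<theta> \<mu>' l'" for \<mu> \<mu>' l l'
    by (simp add: \<theta>_def lin_add re_def algebra_simps)
  moreover have "\<theta> (tr G g \<mu>) (tr G g l) = tr G g (\<theta> \<mu> l)"
    if "\<mu> \<in> M" "l \<in> Fr G ?L" "g \<in> carrier G" for \<mu> l g
  proof -
    have "re (tr G g \<mu>) = tr G g (re \<mu>)"
      unfolding re_def using that n by (intro lin_tr[where I = ?I and A = "{..<m}"]) (auto simp: MI)
    then have "\<theta> (tr G g \<mu>) (tr G g l) = lin G b (tr G g (re \<mu> + l))" by (simp add: \<theta>_def tr_add)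
    also have "\<dots> = tr G g (\<theta> \<mu> l)"
      unfolding \<theta>_def using that by (intro lin_tr[where I = ?I and A = ?I]) (auto intro: Fr_add reI LI MI bI)
    finally show ?thesis .
  qed
  ultimately have "split_iso G M ?L N \<theta>" unfolding split_iso_def by (auto simp: bij_betw_def)
  then show ?thesis by (intro exI[of _ \<theta>])
qed

end

section \<open>Groups given by generators and relations\<close>

lemma pres_eq_context: "pres_eq Rels u v \<Longrightarrow> pres_eq Rels (a @ u @ b) (a @ v @ b)"
proof (induction rule: pres_eq.induct)
  case (pres_cancel u s c v)
  show ?case using pres_eq.pres_cancel[of Rels "a @ u" s c "v @ b"] by simp
next
  case (pres_rel l r u v)
  show ?case using pres_eq.pres_rel[OF pres_rel, of "a @ u" "v @ b"] by simp
qed (auto intro: pres_eq.intros(3-))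

lemma pres_eq_append:
  assumes "pres_eq Rels u u'" "pres_eq Rels v v'"
  shows "pres_eq Rels (u @ v) (u' @ v')"
  using pres_eq_context[OF assms(1), of "[]" v] pres_eq_context[OF assms(2), of u' "[]"]
  by (auto intro: pres_eq.pres_trans)

lemma pres_class_eq_iff: "pres_class Rels u = pres_class Rels v \<longleftrightarrow> pres_eq Rels u v"
  unfolding pres_class_def by (auto intro: pres_eq.intros(3-))

lemma presented_group_mult:
  "pres_class Rels u \<otimes>\<^bsub>presented_group Rels\<^esub> pres_class Rels v = pres_class Rels (u @ v)"
proof -
  have "pres_class Rels (a @ b) = pres_class Rels (u @ v)"
    if "a \<in> pres_class Rels u" "b \<in> pres_class Rels v" for a b
    unfolding pres_class_eq_iff
    using that by (intro pres_eq.pres_sym[OF pres_eq_append]) (simp_all add: pres_class_def)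
  moreover have "u \<in> pres_class Rels u" "v \<in> pres_class Rels v"
    by (simp_all add: pres_class_def pres_eq.pres_refl)
  ultimately have "(\<Union>a\<in>pres_class Rels u. \<Union>b\<in>pres_class Rels v. pres_class Rels (a @ b))
      = (\<Union>a\<in>pres_class Rels u. \<Union>b\<in>pres_class Rels v. pres_class Rels (u @ v))"
    by (intro SUP_cong refl)
  also have "\<dots> = pres_class Rels (u @ v)"
    using \<open>u \<in> pres_class Rels u\<close> \<open>v \<in> pres_class Rels v\<close> by blast
  finally show ?thesis by (simp add: presented_group_def)
qed

lemma presented_group_one: "\<one>\<^bsub>presented_group Rels\<^esub> = pres_class Rels []"
  by (simp add: presented_group_def)

lemma presented_group_carrier: "carrier (presented_group Rels) = range (pres_class Rels)"
  by (simp add: presented_group_def)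

lemma pres_eq_inverse: "pres_eq Rels (rev (map (\<lambda>(s, b). (s, \<not> b)) w) @ w) []"
proof (induction w)
  case (Cons l w)
  obtain s b where l: "l = (s, b)" by force
  let ?r = "rev (map (\<lambda>(s, b). (s, \<not> b)) w)"
  have "pres_eq Rels (?r @ [(s, \<not> b), (s, \<not> \<not> b)] @ w) (?r @ w)" by (rule pres_eq.pres_cancel)
  then show ?case using Cons l by (auto intro: pres_eq.pres_trans)
qed (simp add: pres_eq.pres_refl)

lemma group_presented_group: "group (presented_group Rels)"
proof (rule groupI)
  fix A assume "A \<in> carrier (presented_group Rels)"
  then obtain w where w: "A = pres_class Rels w" by (auto simp: presented_group_carrier)
  then have "pres_class Rels (rev (map (\<lambda>(s, b). (s, \<not> b)) w)) \<otimes>\<^bsub>presented_group Rels\<^esub> A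
      = \<one>\<^bsub>presented_group Rels\<^esub>"
    by (simp only: presented_group_mult presented_group_one pres_class_eq_iff pres_eq_inverse)
  then show "\<exists>B\<in>carrier (presented_group Rels). B \<otimes>\<^bsub>presented_group Rels\<^esub> A = \<one>\<^bsub>presented_group Rels\<^esub>"
    by (auto simp: presented_group_carrier)
qed (auto simp: presented_group_carrier presented_group_mult presented_group_one)

section \<open>The metacyclic group\<close>

locale metacyclic =
  fixes p d \<alpha> :: nat
  assumes prime_p: "prime p" and p_eq: "p = 3 * d + 1"
    and \<alpha>_range: "\<alpha> \<in> {2..p - 2}" and ord_\<alpha>: "ord p \<alpha> = 3"
begin

abbreviation "G \<equiv> G3 p \<alpha>"
abbreviation "x \<equiv> gen_x p \<alpha>"
abbreviation "y \<equiv> gen_y p \<alpha>"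

abbreviation mult_G (infixl "\<cdot>" 70) where "g \<cdot> h \<equiv> g \<otimes>\<^bsub>G3 p \<alpha>\<^esub> h"
abbreviation pow_G (infixr "\<up>" 75) where "g \<up> n \<equiv> g [^]\<^bsub>G3 p \<alpha>\<^esub> (n::nat)"

sublocale G: group "G3 p \<alpha>"
  unfolding G3_def by (rule group_presented_group)

text \<open>The exponent with \<open>x y = y x\<^sup>\<beta>\<close>.\<close>

definition \<beta> :: nat where "\<beta> = \<alpha>^2 mod p"

lemma p_gt: "p \<ge> 4" "p > 0" "p > 1" "d \<ge> 1"
proof -
  have "p \<ge> 4" using \<alpha>_range by auto
  then show "p \<ge> 4" "p > 0" "p > 1" "d \<ge> 1" using p_eq by auto
qed

lemma \<alpha>3: "[\<alpha>^3 = 1] (mod p)"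
  using ord[of \<alpha> p] ord_\<alpha> by simp

lemma \<alpha>\<beta>: "[\<alpha> * \<beta> = 1] (mod p)"
  using \<alpha>3 by (simp add: \<beta>_def cong_def mod_mult_right_eq power3_eq_cube power2_eq_square mult.assoc)

lemma \<alpha>\<beta>_cancel: "a < p \<Longrightarrow> (a * \<beta> mod p) * \<alpha> mod p = a" "a < p \<Longrightarrow> (a * \<alpha> mod p) * \<beta> mod p = a"
proof -
  have *: "(a * (\<alpha> * \<beta>)) mod p = a" if "a < p"
    using cong_mult[OF cong_refl \<alpha>\<beta>, of a] that by (simp add: cong_def)
  show "a < p \<Longrightarrow> (a * \<beta> mod p) * \<alpha> mod p = a" "a < p \<Longrightarrow> (a * \<alpha> mod p) * \<beta> mod p = a"
    using * by (simp_all add: mod_mult_left_eq mult.assoc mult.commute[of \<beta> \<alpha>])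
qed

lemma \<beta>3: "[\<beta>^3 = 1] (mod p)"
proof -
  have "[\<beta>^3 = (\<alpha>^2)^3] (mod p)" unfolding \<beta>_def by (rule cong_pow) (simp add: cong_def)
  also have "(\<alpha>^2)^3 = (\<alpha>^3)^2" by (simp flip: power_mult)
  also have "[(\<alpha>^3)^2 = 1^2] (mod p)" by (rule cong_pow[OF \<alpha>3])
  finally show ?thesis by simp
qed

lemma \<beta>_neq_1: "\<not> [\<beta> = 1] (mod p)"
proof
  assume "[\<beta> = 1] (mod p)"
  then have "[\<alpha> * \<beta> = \<alpha> * 1] (mod p)" by (rule cong_scalar_left)
  then have "[\<alpha> = 1] (mod p)" using \<alpha>\<beta> by (simp add: cong_def)
  then have "\<alpha> = 1" using \<alpha>_range p_gt by (intro cong_less_modulus_unique_nat[of \<alpha> 1 p]) auto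
  then show False using \<alpha>_range by simp
qed

lemma \<beta>_sum: "p dvd 1 + \<beta> + \<beta>^2"
proof -
  have \<beta>0: "\<beta> > 0" using \<alpha>\<beta> p_gt by (cases \<beta>) (auto simp: cong_def)
  have "p dvd \<beta>^3 - 1" using \<beta>3 \<beta>0 by (simp add: cong_altdef_nat cong_sym)
  moreover have "\<beta>^3 - 1 = (\<beta> - 1) * (1 + \<beta> + \<beta>^2)"
    using \<beta>0 by (cases \<beta>) (auto simp: algebra_simps power2_eq_square power3_eq_cube)
  ultimately have "p dvd \<beta> - 1 \<or> p dvd 1 + \<beta> + \<beta>^2"
    using prime_p by (metis prime_dvd_mult_iff)
  moreover have "\<not> p dvd \<beta> - 1" using \<beta>_neq_1 \<beta>0 by (simp add: cong_altdef_nat cong_sym)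
  ultimately show ?thesis by blast
qed

abbreviation "cls \<equiv> pres_class (rels3 p \<alpha>)"

lemma cls_append: "cls (u @ v) = cls u \<cdot> cls v"
  by (simp add: G3_def presented_group_mult)

lemma cls_Nil: "cls [] = \<one>\<^bsub>G\<^esub>"
  by (simp add: G3_def presented_group_one)

lemma cls_in: "cls w \<in> carrier G"
  by (simp add: G3_def presented_group_carrier)

lemma x_in [simp]: "x \<in> carrier G" and y_in [simp]: "y \<in> carrier G"
  by (simp_all add: gen_x_def gen_y_def cls_in)

lemma cls_replicate: "cls (replicate n l) = cls [l] \<up> n"
proof (induction n)
  case (Suc n)
  have "cls (replicate (Suc n) l) = cls (replicate n l @ [l])" by (simp add: replicate_append_same)
  then show ?case using Suc by (simp add: cls_append)
qed (simp add: cls_Nil)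

lemma cls_rel: "(l, r) \<in> rels3 p \<alpha> \<Longrightarrow> cls l = cls r"
  using pres_eq.pres_rel[of l r "rels3 p \<alpha>" "[]" "[]"] by (simp add: pres_class_eq_iff)

lemma cls_inverse: "cls [(s, False)] = inv\<^bsub>G\<^esub> (cls [(s, True)])"
proof (rule G.inv_equality[symmetric])
  show "cls [(s, False)] \<cdot> cls [(s, True)] = \<one>\<^bsub>G\<^esub>"
    using pres_eq.pres_cancel[of "rels3 p \<alpha>" "[]" s False "[]"]
    by (simp add: pres_class_eq_iff flip: cls_append cls_Nil)
qed (simp_all add: cls_in)

lemma x_pow_p: "x \<up> p = \<one>\<^bsub>G\<^esub>"
proof -
  have "cls (replicate p (gx, True)) = cls []" by (rule cls_rel) (simp add: rels3_def)
  then show ?thesis by (simp add: cls_replicate cls_Nil gen_x_def)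
qed

lemma y_pow_3: "y \<up> (3::nat) = \<one>\<^bsub>G\<^esub>"
proof -
  have "cls (replicate 3 (gy, True)) = cls []" by (rule cls_rel) (simp add: rels3_def)
  then show ?thesis by (simp only: cls_replicate cls_Nil gen_y_def)
qed

lemma y_x: "y \<cdot> x \<cdot> inv\<^bsub>G\<^esub> y = x \<up> \<alpha>"
proof -
  have "cls ([(gy, True)] @ [(gx, True)] @ [(gy, False)]) = cls (replicate \<alpha> (gx, True))"
    by (rule cls_rel) (simp add: rels3_def)
  then show ?thesis by (simp add: cls_append cls_replicate cls_inverse gen_x_def gen_y_def G.m_assoc cls_in del: append.simps)
qed

lemma x_pow_mod: "x \<up> (n mod p) = x \<up> n"
proof -
  have "x \<up> (p * (n div p) + n mod p) = (x \<up> p) \<up> (n div p) \<cdot> x \<up> (n mod p)"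
    by (simp only: G.nat_pow_mult[symmetric] G.nat_pow_pow x_in G.nat_pow_closed)
  then show ?thesis by (simp add: x_pow_p)
qed

lemma y_pow_mod: "y \<up> (n mod 3) = y \<up> (n::nat)"
proof -
  have "y \<up> (3 * (n div 3) + n mod 3) = (y \<up> (3::nat)) \<up> (n div 3) \<cdot> y \<up> (n mod 3)"
    by (simp only: G.nat_pow_mult[symmetric] G.nat_pow_pow y_in G.nat_pow_closed)
  then show ?thesis by (simp add: y_pow_3)
qed

lemma x_y: "x \<up> (a::nat) \<cdot> y = y \<cdot> x \<up> (a * \<beta>)"
proof -
  have pow: "y \<cdot> x \<up> (n::nat) = x \<up> (n * \<alpha>) \<cdot> y" for n
  proof (induction n)
    case (Suc n)
    have coset_coords: "y \<cdot> x = x \<up> \<alpha> \<cdot> y"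
      using y_x by (metis G.inv_closed G.inv_solve_right' G.m_closed G.nat_pow_closed x_in y_in G.inv_inv)
    have "y \<cdot> x \<up> Suc n = (y \<cdot> x \<up> n) \<cdot> x" by (simp add: G.m_assoc)
    also have "\<dots> = x \<up> (n * \<alpha>) \<cdot> (y \<cdot> x)" by (simp add: Suc G.m_assoc)
    also have "\<dots> = (x \<up> (n * \<alpha>) \<cdot> x \<up> \<alpha>) \<cdot> y" by (simp add: coset_coords G.m_assoc)
    finally show ?case by (simp add: G.nat_pow_mult add.commute)
  qed simp
  have "y \<cdot> x \<up> (a * \<beta>) = x \<up> (a * \<beta> * \<alpha> mod p) \<cdot> y"
    by (simp add: pow x_pow_mod)
  also have "a * \<beta> * \<alpha> mod p = a mod p"
    using cong_mult[OF cong_refl \<alpha>\<beta>, of a] by (simp add: cong_def mult_ac)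
  finally show ?thesis by (simp add: x_pow_mod)
qed

text \<open>
  The normal form \<open>y\<^sup>j x\<^sup>a\<close> is the convenient one for right modules: right multiplication by \<open>x\<close>
  or \<open>y\<close> acts on the exponents by a simple rule.
\<close>

definition el :: "nat \<Rightarrow> nat \<Rightarrow> xy word set" where
  "el j a = y \<up> j \<cdot> x \<up> a"

lemma el_in [simp]: "el j a \<in> carrier G" by (simp add: el_def)

lemma el_mod: "el (j mod 3) a = el j a" "el j (a mod p) = el j a"
  by (simp_all add: el_def x_pow_mod y_pow_mod)

lemma el_00: "el 0 0 = \<one>\<^bsub>G\<^esub>" by (simp add: el_def)

lemma el_x: "el j a \<cdot> x = el j (a + 1)"
  by (simp add: el_def G.m_assoc)

lemma el_y: "el j a \<cdot> y = el (j + 1) (a * \<beta>)"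
  by (simp add: el_def G.m_assoc x_y)

lemma el_x_pow: "el j a \<cdot> x \<up> (n::nat) = el j (a + n)"
  by (simp add: el_def G.m_assoc G.nat_pow_mult)

lemma el_y_pow: "el j a \<cdot> y \<up> (n::nat) = el (j + n) (a * \<beta>^n)"
  by (induction n) (simp_all add: el_y mult_ac flip: G.m_assoc)

lemma x_inv: "inv\<^bsub>G\<^esub> x = x \<up> (p - 1)"
proof (rule G.inv_equality)
  have "x \<up> (p - 1) \<cdot> x = x \<up> Suc (p - 1)" by simp
  then show "x \<up> (p - 1) \<cdot> x = \<one>\<^bsub>G\<^esub>" using p_gt x_pow_p by simp
qed simp_all

lemma y_inv: "inv\<^bsub>G\<^esub> y = y \<up> (2::nat)"
proof (rule G.inv_equality)
  have "y \<up> (2::nat) \<cdot> y = y \<up> Suc 2" by (simp only: G.nat_pow_Suc)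
  also have "Suc 2 = 3" by simp
  finally show "y \<up> (2::nat) \<cdot> y = \<one>\<^bsub>G\<^esub>" by (simp only: y_pow_3)
qed simp_all

lemma G_induct [consumes 1, case_names one x y]:
  assumes "g \<in> carrier G" "P \<one>\<^bsub>G\<^esub>"
    and Px: "\<And>g. g \<in> carrier G \<Longrightarrow> P g \<Longrightarrow> P (g \<cdot> x)" and Py: "\<And>g. g \<in> carrier G \<Longrightarrow> P g \<Longrightarrow> P (g \<cdot> y)"
  shows "P g"
proof -
  have Pxn: "P (g \<cdot> x \<up> (n::nat))" if "g \<in> carrier G" "P g" for g n
    by (induction n) (use that Px in \<open>auto simp flip: G.m_assoc\<close>)
  have Pyn: "P (g \<cdot> y \<up> (n::nat))" if "g \<in> carrier G" "P g" for g n
    by (induction n) (use that Py in \<open>auto simp flip: G.m_assoc\<close>)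
  obtain w where w: "g = cls w" using assms(1) by (auto simp: G3_def presented_group_carrier)
  have "P (cls w)" for w
  proof (induction w rule: rev_induct)
    case Nil
    then show ?case using assms(2) by (simp add: cls_Nil)
  next
    case (snoc l w)
    obtain s b where l: "l = (s, b)" by force
    show ?case
      using Px[OF _ snoc] Py[OF _ snoc] Pxn[OF _ snoc] Pyn[OF _ snoc]
      by (cases s; cases b) (auto simp: l cls_append cls_in cls_inverse x_inv y_inv simp flip: gen_x_def gen_y_def)
  qed
  then show ?thesis using w by simp
qed

lemma carrier_el: "carrier G = (\<lambda>(j, a). el j a) ` ({..<3} \<times> {..<p})"
proof (intro equalityI subsetI)
  fix g assume "g \<in> carrier G"
  then have "\<exists>j a. g = el j a"
  proof (induction rule: G_induct)
    case one
    show ?case using el_00 by metis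
  qed (metis el_x el_y)+
  then obtain j a where "g = el j a" by blast
  then have "g = el (j mod 3) (a mod p)" by (simp add: el_mod)
  moreover have "j mod 3 < 3" "a mod p < p" using p_gt by auto
  ultimately show "g \<in> (\<lambda>(j, a). el j a) ` ({..<3} \<times> {..<p})" by blast
qed auto

text \<open>
  That the normal forms are distinct is seen on a model: words act on pairs of exponents as
  right multiplication would act on normal forms, and the relations act trivially.
\<close>

fun step :: "xy \<times> bool \<Rightarrow> nat \<times> nat \<Rightarrow> nat \<times> nat" where
  "step (gx, True) (j, a) = (j, (a + 1) mod p)"
| "step (gx, False) (j, a) = (j, (a + (p - 1)) mod p)"
| "step (gy, True) (j, a) = ((j + 1) mod 3, a * \<beta> mod p)"
| "step (gy, False) (j, a) = ((j + 2) mod 3, a * \<alpha> mod p)"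

definition run :: "xy word \<Rightarrow> nat \<times> nat \<Rightarrow> nat \<times> nat" where
  "run w = fold step w"

abbreviation "S \<equiv> {..<3::nat} \<times> {..<p}"

lemma step_in: "s \<in> S \<Longrightarrow> step l s \<in> S"
  using p_gt by (cases l; cases s; cases "fst l"; cases "snd l") auto

lemma run_append: "run (u @ v) s = run v (run u s)" by (simp add: run_def)

lemma run_in: "s \<in> S \<Longrightarrow> run w s \<in> S"
  unfolding run_def by (induction w arbitrary: s) (simp_all add: step_in del: step.simps mem_Sigma_iff)

lemma step_step: "s \<in> S \<Longrightarrow> step (l, \<not> b) (step (l, b) s) = s"
proof -
  assume "s \<in> S"
  then obtain j a where s: "s = (j, a)" "j < 3" "a < p" by auto
  have "((j + 1) mod 3 + 2) mod 3 = j" "((j + 2) mod 3 + 1) mod 3 = j" using s by presburger+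
  moreover have "((a + 1) mod p + (p - 1)) mod p = a" "((a + (p - 1)) mod p + 1) mod p = a"
    using s p_gt by (simp_all only: mod_add_left_eq) simp_all
  ultimately show ?thesis
    by (cases l; cases b) (simp_all only: s(1) step.simps \<alpha>\<beta>_cancel[OF s(3)] not_True_eq_False not_False_eq_True)
qed

lemma run_replicate_x: "a < p \<Longrightarrow> run (replicate n (gx, True)) (j, a) = (j, (a + n) mod p)"
proof (induction n arbitrary: a)
  case (Suc n)
  have "run (replicate (Suc n) (gx, True)) (j, a) = run (replicate n (gx, True)) (j, (a + 1) mod p)"
    by (simp add: run_def)
  also have "\<dots> = (j, ((a + 1) mod p + n) mod p)" using Suc.IH[of "(a + 1) mod p"] p_gt by simp
  also have "((a + 1) mod p + n) mod p = (a + Suc n) mod p" by (simp add: mod_add_left_eq)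
  finally show ?case .
qed (simp add: run_def)

lemma run_pres_eq: "pres_eq (rels3 p \<alpha>) u v \<Longrightarrow> s \<in> S \<Longrightarrow> run u s = run v s"
proof (induction arbitrary: s rule: pres_eq.induct)
  case (pres_cancel u l b v)
  have "run [(l, b), (l, \<not> b)] (run u s) = run u s"
    using step_step[OF run_in[OF pres_cancel]] by (simp add: run_def)
  then show ?case by (simp add: run_append del: append.simps)
next
  case (pres_rel l r u v)
  have "run l t = run r t" if t: "t \<in> S" for t
  proof -
    obtain j a where ja: "t = (j, a)" "j < 3" "a < p" using t by auto
    consider "l = replicate p (gx, True)" "r = []" | "l = replicate 3 (gy, True)" "r = []"
      | "l = [(gy, True), (gx, True), (gy, False)]" "r = replicate \<alpha> (gx, True)"
      using pres_rel(1) by (auto simp: rels3_def)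
    then show ?thesis
    proof cases
      case 1
      then show ?thesis using ja by (simp add: run_replicate_x) (simp add: run_def)
    next
      case 2
      have "a * \<beta>^3 mod p = a" using cong_mult[OF cong_refl \<beta>3, of a] ja by (simp add: cong_def)
      then have "a * \<beta> * \<beta> * \<beta> mod p = a" by (simp add: power3_eq_cube mult_ac)
      then have "(a * \<beta> mod p * \<beta> mod p) * \<beta> mod p = a" by (simp add: mod_simps)
      moreover have "(((j + 1) mod 3 + 1) mod 3 + 1) mod 3 = j" using ja by presburger
      moreover have "l = [(gy, True), (gy, True), (gy, True)]" using 2 by (simp add: eval_nat_numeral)
      ultimately show ?thesis using 2(2) ja(1) by (simp add: run_def)
    next
      case 3
      have "((a * \<beta> mod p + 1) mod p) * \<alpha> mod p = ((a * \<beta> mod p) * \<alpha> mod p + \<alpha>) mod p"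
        by (simp add: mod_simps algebra_simps)
      also have "\<dots> = (a + \<alpha>) mod p" using \<alpha>\<beta>_cancel ja by simp
      moreover have "((j + 1) mod 3 + 2) mod 3 = j" using ja by presburger
      ultimately show ?thesis using 3 ja by (simp add: run_replicate_x) (simp add: run_def)
    qed
  qed
  then show ?case using run_in[OF pres_rel(2)] by (simp add: run_append)
qed auto

lemma el_word: "el j a = cls (replicate j (gy, True) @ replicate a (gx, True))"
  by (simp add: el_def cls_append cls_replicate gen_x_def gen_y_def)

lemma run_el: "j < 3 \<Longrightarrow> a < p \<Longrightarrow> run (replicate j (gy, True) @ replicate a (gx, True)) (0, 0) = (j, a)"
proof -
  assume "j < 3" "a < p"
  moreover have "run (replicate n (gy, True)) (0, 0) = (n mod 3, 0)" for n
  proof (induction n)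
    case (Suc n)
    have "run (replicate (Suc n) (gy, True)) (0, 0) = run [(gy, True)] (run (replicate n (gy, True)) (0, 0))"
      by (simp only: run_append[symmetric] replicate_append_same replicate_Suc)
    then show ?case using Suc by (simp add: run_def mod_Suc_eq)
  qed (simp add: run_def)
  ultimately show ?thesis using p_gt by (simp add: run_append run_replicate_x)
qed

lemma inj_el: "inj_on (\<lambda>(j, a). el j a) S"
proof (rule inj_onI)
  fix s t assume "s \<in> S" "t \<in> S" "(case s of (j, a) \<Rightarrow> el j a) = (case t of (j, a) \<Rightarrow> el j a)"
  then show "s = t"
    using run_pres_eq[of _ _ "(0, 0)"] run_el p_gt
    by (cases s; cases t) (auto simp: el_word pres_class_eq_iff, (metis prod.inject)+)
qed

lemma bij_el: "bij_betw (\<lambda>(j, a). el j a) S (carrier G)"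
  using inj_el carrier_el by (simp add: bij_betw_def)

definition exponents :: "xy word set \<Rightarrow> nat \<times> nat" where
  "exponents = the_inv_into S (\<lambda>(j, a). el j a)"

lemma exponents_el: "exponents (el j a) = (j mod 3, a mod p)"
proof -
  have "exponents ((\<lambda>(j, a). el j a) (j mod 3, a mod p)) = (j mod 3, a mod p)"
    unfolding exponents_def by (rule the_inv_into_f_f[OF inj_el]) (use p_gt in auto)
  then show ?thesis by (simp add: el_mod)
qed

lemma el_eq_iff: "el j a = el k b \<longleftrightarrow> j mod 3 = k mod 3 \<and> a mod p = b mod p"
  by (metis exponents_el el_mod prod.inject)

sublocale G: finite_group "G3 p \<alpha>"
  by unfold_locales (simp add: carrier_el)

end

section \<open>A generator of a prime ideal of the Eisenstein integers\<close>

text \<open>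
  Thue's argument: by the pigeonhole principle \<open>a + b \<omega> \<equiv> 0\<close> has a nonzero solution with
  \<open>|a|, |b| < \<surd>p\<close>. The norm \<open>a\<^sup>2 - ab + b\<^sup>2\<close> is then a multiple of \<open>p\<close> between \<open>0\<close> and \<open>3p\<close>, and it
  is not \<open>2p\<close> because the form takes even values only at pairs of even numbers.
\<close>

lemma norm_form:
  fixes p \<omega> :: int
  assumes p: "prime p" "odd p" and \<omega>: "p dvd 1 + \<omega> + \<omega>^2"
  shows "\<exists>a b. a^2 - a * b + b^2 = p \<and> p dvd a + b * \<omega>"
proof -
  have p0: "p > 1" using p by (simp add: prime_gt_1_int)
  define s where "s = nat \<lfloor>sqrt p\<rfloor>"
  have s1: "int s ^ 2 \<le> p"
  proof -
    have "real s \<le> sqrt p" using p0 by (simp add: s_def)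
    then have "real s ^ 2 \<le> sqrt p ^ 2" by (intro power_mono) auto
    then have "real s ^ 2 \<le> real_of_int p" using p0 by simp
    then have "real_of_int (int s ^ 2) \<le> real_of_int p" by simp
    then show ?thesis by (simp only: of_int_le_iff)
  qed
  have s2: "p < (int s + 1)^2"
  proof -
    have "sqrt p < real s + 1" using p0 by (simp add: s_def)
    then have "sqrt p ^ 2 < (real s + 1)^2" using p0 by (intro power_strict_mono) auto
    then have "real_of_int p < (real s + 1)^2" using p0 by simp
    then have "real_of_int p < real_of_int ((int s + 1) ^ 2)" by simp
    then show ?thesis by (simp only: of_int_less_iff)
  qed
  have s3: "int s ^ 2 < p"
  proof -
    have "int s ^ 2 \<noteq> p"
    proof
      assume sp: "int s ^ 2 = p"
      then have "int s dvd p" by (auto simp: power2_eq_square)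
      then have "int s = 1 \<or> int s = p" using p(1) unfolding prime_int_iff by (metis of_nat_0_le_iff)
      then show False using sp p0 by (auto simp: power2_eq_square)
    qed
    with s1 show ?thesis by simp
  qed
  let ?f = "\<lambda>(i, j). (int i + int j * \<omega>) mod p"
  have "\<not> inj_on ?f ({..s} \<times> {..s})"
  proof
    assume "inj_on ?f ({..s} \<times> {..s})"
    then have "card ({..s} \<times> {..s}) \<le> card {0..<p}"
      using p0 by (intro card_inj_on_le) auto
    then have "(s + 1) * (s + 1) \<le> nat p" by (simp add: card_cartesian_product)
    then have "int ((s + 1) * (s + 1)) \<le> p" using p0 by linarith
    with s2 show False by (simp add: power2_eq_square algebra_simps)
  qed
  then obtain i j i' j' where ij: "i \<le> s" "j \<le> s" "i' \<le> s" "j' \<le> s" "(i, j) \<noteq> (i', j')"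
    "(int i + int j * \<omega>) mod p = (int i' + int j' * \<omega>) mod p" by (auto simp: inj_on_def)
  define a b where "a = int i - int i'" and "b = int j - int j'"
  have dvd: "p dvd a + b * \<omega>"
    using ij(6) by (simp add: a_def b_def mod_eq_dvd_iff algebra_simps)
  have nz: "a \<noteq> 0 \<or> b \<noteq> 0" using ij(5) by (auto simp: a_def b_def)
  have ab: "\<bar>a\<bar> \<le> int s" "\<bar>b\<bar> \<le> int s" using ij by (auto simp: a_def b_def)
  define q where "q = a^2 - a * b + b^2"
  have "p dvd q"
  proof -
    have "q = (a + b * \<omega>) * (a - b - b * \<omega>) + b^2 * (1 + \<omega> + \<omega>^2)"
      by (simp add: q_def power2_eq_square algebra_simps)
    then show ?thesis using dvd \<omega> by (metis dvd_add dvd_mult dvd_mult2)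
  qed
  have "q > 0"
  proof -
    have "4 * q = (2 * a - b)^2 + 3 * b^2" by (simp add: q_def power2_eq_square algebra_simps)
    moreover have "(2 * a - b)^2 + 3 * b^2 > 0"
    proof (cases "b = 0")
      case True then show ?thesis using nz by simp
    next
      case False then show ?thesis by (simp add: add_nonneg_pos)
    qed
    ultimately show ?thesis by linarith
  qed
  have "a^2 \<le> int s ^ 2" "b^2 \<le> int s ^ 2"
    using ab by (metis abs_le_square_iff abs_of_nat)+
  moreover have "- (a * b) \<le> int s ^ 2"
  proof -
    have "\<bar>a\<bar> * \<bar>b\<bar> \<le> int s * int s" using ab by (intro mult_mono) auto
    then show ?thesis by (simp add: power2_eq_square flip: abs_mult)
  qed
  ultimately have "q < 3 * p" using s3 by (simp add: q_def)
  obtain k where k: "q = p * k" using \<open>p dvd q\<close> by auto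
  have "k > 0" using k \<open>q > 0\<close> p0 by (simp add: zero_less_mult_iff)
  moreover have "k < 3" using k \<open>q < 3 * p\<close> p0 by simp
  moreover have "k \<noteq> 2"
  proof
    assume "k = 2"
    then have "even q" using k by simp
    then have "even a \<and> even b" by (auto simp: q_def)
    then obtain a' b' where "a = 2 * a'" "b = 2 * b'" by (auto elim!: evenE)
    then have "2 * (2 * (a'^2 - a' * b' + b'^2)) = 2 * p"
      using k \<open>k = 2\<close> by (simp add: q_def power2_eq_square algebra_simps)
    then show False using p(2) by (metis even_mult_iff mult_cancel_left dvd_triv_left zero_neq_numeral)
  qed
  ultimately have "k = 1" by simp
  then show ?thesis using k dvd unfolding q_def by auto
qed

section \<open>The cyclic group of order 3\<close>

lemma less_3_cases: "j < 3 \<Longrightarrow> (j = 0 \<Longrightarrow> P) \<Longrightarrow> (j = Suc 0 \<Longrightarrow> P) \<Longrightarrow> (j = 2 \<Longrightarrow> P) \<Longrightarrow> P" for j :: nat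
  by fastforce

definition Z3 :: "nat monoid" where
  "Z3 = \<lparr>carrier = {..<3}, monoid.mult = (\<lambda>i j. (i + j) mod 3), one = 0\<rparr>"

lemma Z3_simps [simp]: "carrier Z3 = {..<3}" "i \<otimes>\<^bsub>Z3\<^esub> j = (i + j) mod 3" "\<one>\<^bsub>Z3\<^esub> = 0"
  by (simp_all add: Z3_def)

interpretation Z3: finite_group Z3
proof unfold_locales
  show "carrier Z3 \<subseteq> Units Z3"
  proof
    fix i assume "i \<in> carrier Z3"
    then have "(3 - i) mod 3 \<in> carrier Z3" "((3 - i) mod 3 + i) mod 3 = 0" "(i + (3 - i) mod 3) mod 3 = 0"
      by (auto elim!: less_3_cases)
    then show "i \<in> Units Z3"
      using \<open>i \<in> carrier Z3\<close> unfolding Units_def by (auto intro!: bexI[of _ "(3 - i) mod 3"])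
  qed
qed (auto simp: mod_simps add.assoc)

lemma tr_Z3_Suc: "v \<in> Fr Z3 I \<Longrightarrow> j < 3 \<Longrightarrow> tr Z3 1 (tr Z3 j v) = tr Z3 ((j + 1) mod 3) v"
  using Z3.tr_tr[of v I j 1] by simp

lemma lessThan_3: "{..<3::nat} = {0, Suc 0, 2}" by auto

lemma free_orbits:
  assumes "finite \<Omega>" "\<And>w. w \<in> \<Omega> \<Longrightarrow> s w \<in> \<Omega> \<and> s w \<noteq> w \<and> s (s (s w)) = w"
  shows "\<exists>k t. bij_betw (\<lambda>(i, j). (s ^^ j) (t i)) ({..<k::nat} \<times> {..<3}) \<Omega>"
  using assms
proof (induction "card \<Omega>" arbitrary: \<Omega> rule: less_induct)
  case less
  show ?case
  proof (cases "\<Omega> = {}")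
    case True
    then show ?thesis by (intro exI[of _ 0]) (simp add: bij_betw_def)
  next
    case False
    then obtain w where w: "w \<in> \<Omega>" by auto
    let ?o = "{w, s w, s (s w)}"
    have sw: "s w \<in> \<Omega>" "s (s w) \<in> \<Omega>" "s (s (s w)) = w" using less.prems w by auto
    have ne: "s w \<noteq> w" "s (s w) \<noteq> s w" "s (s w) \<noteq> w"
      using less.prems(2)[OF w] less.prems(2)[OF sw(1)] less.prems(2)[OF sw(2)] sw by auto
    have "card (\<Omega> - ?o) < card \<Omega>"
      using w less.prems(1) by (intro psubset_card_mono) auto
    moreover have "s v \<in> \<Omega> - ?o \<and> s v \<noteq> v \<and> s (s (s v)) = v" if v: "v \<in> \<Omega> - ?o" for v
    proof -
      have v': "s v \<in> \<Omega>" "s v \<noteq> v" "s (s (s v)) = v" using less.prems(2)[of v] v by auto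
      moreover have "s v \<notin> ?o"
      proof
        assume "s v \<in> ?o"
        then have "s (s (s v)) \<in> ?o" using sw by auto
        then show False using v v' by auto
      qed
      ultimately show ?thesis by auto
    qed
    ultimately obtain k t where kt: "bij_betw (\<lambda>(i, j). (s ^^ j) (t i)) ({..<k::nat} \<times> {..<3}) (\<Omega> - ?o)"
      using less.hyps[of "\<Omega> - ?o"] less.prems(1) by auto
    define t' where "t' = t(k := w)"
    have "bij_betw (\<lambda>(i, j). (s ^^ j) (t' i)) ({..<k} \<times> {..<3}) (\<Omega> - ?o)"
      by (rule iffD1[OF bij_betw_cong kt]) (auto simp: t'_def)
    moreover have "bij_betw (\<lambda>(i, j). (s ^^ j) (t' i)) ({k} \<times> {..<3}) ?o"
      using ne by (simp add: bij_betw_def inj_on_def t'_def lessThan_3 numeral_2_eq_2)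
    ultimately have "bij_betw (\<lambda>(i, j). (s ^^ j) (t' i)) ({..<k} \<times> {..<3} \<union> {k} \<times> {..<3}) ((\<Omega> - ?o) \<union> ?o)"
      by (rule bij_betw_combine) auto
    moreover have "{..<k} \<times> {..<3} \<union> {k} \<times> {..<3} = {..<Suc k} \<times> {..<3::nat}" by auto
    moreover have "(\<Omega> - ?o) \<union> ?o = \<Omega>" using w sw by auto
    ultimately show ?thesis by (intro exI[of _ "Suc k"] exI[of _ t']) simp
  qed
qed

section \<open>Additive maps into modules\<close>

definition additive_on :: "'a::ab_group_add set \<Rightarrow> ('b, 'c) ring_scheme \<Rightarrow> ('a \<Rightarrow> 'b) \<Rightarrow> bool" where
  "additive_on S M h \<longleftrightarrow> h \<in> S \<rightarrow> carrier M \<and> (\<forall>u\<in>S. \<forall>v\<in>S. h (u + v) = h u \<oplus>\<^bsub>M\<^esub> h v)"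

lemma (in abelian_group) additive_on_zero:
  assumes "additive_on S G h" "0 \<in> S"
  shows "h 0 = \<zero>"
proof -
  have h: "h 0 \<in> carrier G" "h (0 + 0) = h 0 \<oplus> h 0" using assms unfolding additive_on_def by blast+
  then have "h 0 \<oplus> h 0 = h 0" by simp
  then show ?thesis using add.l_cancel_one[OF h(1,1)] by blast
qed

lemma (in abelian_group) additive_on_eq:
  assumes h: "additive_on (frags A) G h" and k: "additive_on (frags A) G k"
    and eq: "\<And>x. x \<in> A \<Longrightarrow> h (frag_of x) = k (frag_of x)" and c: "c \<in> frags A"
  shows "h c = k c"
  using c
proof (induction rule: frags_induct)
  case zero
  then show ?case using additive_on_zero[OF h] additive_on_zero[OF k] by simp
next
  case (diff a b)
  have ab: "a - b \<in> frags A" using diff by (intro frags_diff)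
  have "h (a - b) \<oplus> h b = k (a - b) \<oplus> k b"
    using h k diff ab unfolding additive_on_def by (metis diff_add_cancel)
  moreover have "h (a - b) \<in> carrier G" "k (a - b) \<in> carrier G" "k b \<in> carrier G"
    using h k diff ab unfolding additive_on_def by auto
  ultimately show ?case using diff by simp
qed (rule eq)

lemma (in abelian_group) additive_on_diff_zero:
  assumes h: "additive_on S G h" and ab: "a \<in> S" "b \<in> S" "a - b \<in> S"
  shows "h (a - b) = \<zero> \<longleftrightarrow> h a = h b"
proof -
  have c: "h (a - b) \<in> carrier G" "h b \<in> carrier G" "h a = h (a - b) \<oplus> h b"
    using h ab unfolding additive_on_def by (blast, blast, metis diff_add_cancel)
  then show ?thesis using add.r_cancel_one[OF c(2,1)] by auto
qed

section \<open>Group rings\<close>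

definition rmul :: "('g, 'z) monoid_scheme \<Rightarrow> 'g \<Rightarrow> ('g \<Rightarrow>\<^sub>0 int) \<Rightarrow> ('g \<Rightarrow>\<^sub>0 int)" where
  "rmul H h = frag_extend (\<lambda>g. frag_of (g \<otimes>\<^bsub>H\<^esub> h))"

lemma group_ring_carrier: "carrier (group_ring H) = frags (carrier H)"
  by (simp add: group_ring_def frags_def)

lemma group_ring_add [simp]: "a \<oplus>\<^bsub>group_ring H\<^esub> b = a + b" "\<zero>\<^bsub>group_ring H\<^esub> = 0"
  by (simp_all add: group_ring_def)

lemma group_ring_mult:
  "a \<otimes>\<^bsub>group_ring H\<^esub> b = frag_extend (\<lambda>g. frag_extend (\<lambda>h. frag_of (g \<otimes>\<^bsub>H\<^esub> h)) b) a"
  by (simp add: group_ring_def)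

lemma group_ring_mult_of: "a \<otimes>\<^bsub>group_ring H\<^esub> frag_of h = rmul H h a"
  by (simp add: group_ring_mult rmul_def)

lemma group_ring_of_mult: "frag_of g \<otimes>\<^bsub>group_ring H\<^esub> b = frag_extend (\<lambda>h. frag_of (g \<otimes>\<^bsub>H\<^esub> h)) b"
  by (simp add: group_ring_mult)

lemma group_ring_diff_left: "(a - a') \<otimes>\<^bsub>group_ring H\<^esub> b = a \<otimes>\<^bsub>group_ring H\<^esub> b - a' \<otimes>\<^bsub>group_ring H\<^esub> b"
  by (simp add: group_ring_mult frag_extend_diff)

lemma group_ring_add_right: "a \<otimes>\<^bsub>group_ring H\<^esub> (b + b') = a \<otimes>\<^bsub>group_ring H\<^esub> b + a \<otimes>\<^bsub>group_ring H\<^esub> b'"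
  by (simp add: group_ring_mult frag_extend_add frag_extend_plus_fun)

lemma group_ring_cmul_right: "a \<otimes>\<^bsub>group_ring H\<^esub> frag_cmul k b = frag_cmul k (a \<otimes>\<^bsub>group_ring H\<^esub> b)"
  by (simp add: group_ring_mult frag_extend_cmul) (simp add: frag_extend_def frag_cmul_sum mult.left_commute)

lemma rmul_diff: "rmul H h (a - b) = rmul H h a - rmul H h b" by (simp add: rmul_def frag_extend_diff)
lemma rmul_zero [simp]: "rmul H h 0 = 0" by (simp add: rmul_def)
lemma rmul_of [simp]: "rmul H h (frag_of g) = frag_of (g \<otimes>\<^bsub>H\<^esub> h)" by (simp add: rmul_def)

lemma augmentation_eq:
  assumes "finite A" "c \<in> frags A"
  shows "augmentation c = (\<Sum>g\<in>A. cf c g)"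
  unfolding augmentation_def
  using assms by (intro sum.mono_neutral_left) (auto simp: frags_def in_keys_iff)

lemma bij_frag_extend:
  assumes "bij_betw f A B"
  shows "bij_betw (frag_extend (\<lambda>x. frag_of (f x))) (frags A) (frags B)"
proof (rule bij_betw_byWitness[where f' = "frag_extend (\<lambda>y. frag_of (the_inv_into A f y))"])
  have f: "inj_on f A" "f ` A = B" using assms by (auto simp: bij_betw_def)
  note inv = the_inv_into_f_f[OF f(1)] f_the_inv_into_f[OF f(1)] the_inv_into_into[OF f(1)]
  show "\<forall>a\<in>frags A. frag_extend (\<lambda>y. frag_of (the_inv_into A f y)) (frag_extend (\<lambda>x. frag_of (f x)) a) = a"
    by (auto simp: frag_extend_frag_extend inv intro: frag_extend_id)
  show "\<forall>a'\<in>frags B. frag_extend (\<lambda>x. frag_of (f x)) (frag_extend (\<lambda>y. frag_of (the_inv_into A f y)) a') = a'"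
    using f inv by (auto simp: frag_extend_frag_extend intro!: frag_extend_id)
  show "frag_extend (\<lambda>x. frag_of (f x)) ` frags A \<subseteq> frags B"
    using f by (auto intro!: frag_extend_in_frags)
  show "frag_extend (\<lambda>y. frag_of (the_inv_into A f y)) ` frags B \<subseteq> frags A"
    using f inv by (auto intro!: frag_extend_in_frags)
qed

context metacyclic begin

lemma carrier_Lam: "carrier (Lam p \<alpha>) = frags (carrier G)"
  by (simp add: Lam_def group_ring_carrier)

section \<open>The lattices R(i)\<close>

text \<open>
  The group ring of \<open>\<langle>x\<rangle>\<close> is handled through the exponents: \<open>PL\<close> below is \<open>\<int>[H\G]\<close>, free
  abelian on the residues \<open>a < p\<close>, with \<open>x\<close> acting by \<open>a \<mapsto> a + 1\<close> and \<open>y\<close> by \<open>a \<mapsto> \<beta> a\<close>;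
  \<open>embed\<close> identifies it with the group ring, the conjugation by \<open>y\<close> being the second action.
\<close>

definition pred_mod :: "nat \<Rightarrow> nat" where "pred_mod a = (if a = 0 then p - 1 else a - 1)"

lemma pred_mod_suc: "pred_mod ((a + 1) mod p) = a" and suc_pred_mod: "(pred_mod a + 1) mod p = a"
  and pred_mod_lt: "pred_mod a < p" if "a < p"
proof -
  show "pred_mod ((a + 1) mod p) = a"
    by (cases "a + 1 = p") (use that in \<open>auto simp: pred_mod_def\<close>)
  show "(pred_mod a + 1) mod p = a" "pred_mod a < p"
    by (cases "a = 0"; use that p_gt in \<open>auto simp: pred_mod_def\<close>)+
qed

lemma suc_lt: "(a + 1) mod p < p" using p_gt by simp

definition shift_x :: "(nat \<Rightarrow>\<^sub>0 int) \<Rightarrow> (nat \<Rightarrow>\<^sub>0 int)" where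
  "shift_x = frag_extend (\<lambda>a. frag_of ((a + 1) mod p))"

definition shift_y :: "(nat \<Rightarrow>\<^sub>0 int) \<Rightarrow> (nat \<Rightarrow>\<^sub>0 int)" where
  "shift_y = frag_extend (\<lambda>a. frag_of (a * \<beta> mod p))"

definition coeff_sum :: "(nat \<Rightarrow>\<^sub>0 int) \<Rightarrow> int" where
  "coeff_sum c = (\<Sum>a<p. cf c a)"

definition weight :: "(nat \<Rightarrow>\<^sub>0 int) \<Rightarrow> int" where
  "weight c = (\<Sum>a<p. int a * cf c a)"

definition norm_elt :: "nat \<Rightarrow>\<^sub>0 int" where "norm_elt = (\<Sum>a<p. frag_of a)"

definition embed :: "(nat \<Rightarrow>\<^sub>0 int) \<Rightarrow> lam" where
  "embed = frag_extend (\<lambda>a. frag_of (el 0 a))"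

abbreviation "PL \<equiv> frags {..<p}"

lemma additive_maps:
  "shift_x (u - v) = shift_x u - shift_x v" "shift_y (u - v) = shift_y u - shift_y v" "embed (u - v) = embed u - embed v"
  "shift_x (u + v) = shift_x u + shift_x v" "shift_y (u + v) = shift_y u + shift_y v" "embed (u + v) = embed u + embed v"
  "shift_x (frag_cmul k u) = frag_cmul k (shift_x u)" "shift_y (frag_cmul k u) = frag_cmul k (shift_y u)"
  "embed (frag_cmul k u) = frag_cmul k (embed u)"
  by (simp_all add: shift_x_def shift_y_def embed_def frag_extend_diff frag_extend_add frag_extend_cmul)

lemma coeff_sum_maps: "coeff_sum (u - v) = coeff_sum u - coeff_sum v" "coeff_sum (u + v) = coeff_sum u + coeff_sum v"
  "coeff_sum (frag_cmul k u) = k * coeff_sum u" "coeff_sum 0 = 0"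
  by (simp_all add: coeff_sum_def lookup_minus lookup_add sum_subtractf sum.distrib sum_distrib_left)

lemma weight_maps: "weight (u - v) = weight u - weight v" "weight (u + v) = weight u + weight v"
  "weight (frag_cmul k u) = k * weight u" "weight 0 = 0"
  by (simp_all add: weight_def lookup_minus lookup_add sum_subtractf sum.distrib sum_distrib_left algebra_simps)

lemma coeff_sum_of [simp]: "a < p \<Longrightarrow> coeff_sum (frag_of a) = 1"
  by (simp add: coeff_sum_def lookup_single when_def)

lemma weight_of [simp]: "a < p \<Longrightarrow> weight (frag_of a) = int a"
  by (simp add: weight_def lookup_single when_def if_distrib cong: if_cong)

lemma maps_of [simp]: "shift_x (frag_of a) = frag_of ((a + 1) mod p)" "shift_y (frag_of a) = frag_of (a * \<beta> mod p)"
  "embed (frag_of a) = frag_of (el 0 a)" "shift_x 0 = 0" "shift_y 0 = 0" "embed 0 = 0"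
  by (simp_all add: shift_x_def shift_y_def embed_def)

lemma shift_x_in: "c \<in> PL \<Longrightarrow> shift_x c \<in> PL" and shift_y_in: "c \<in> PL \<Longrightarrow> shift_y c \<in> PL"
  unfolding shift_x_def shift_y_def using p_gt by (auto intro!: frag_extend_in_frags)

lemma coeff_sum_shift_x: "c \<in> PL \<Longrightarrow> coeff_sum (shift_x c) = coeff_sum c"
  by (induction rule: frags_induct) (use p_gt in \<open>auto simp: additive_maps coeff_sum_maps\<close>)

lemma coeff_sum_shift_y: "c \<in> PL \<Longrightarrow> coeff_sum (shift_y c) = coeff_sum c"
  by (induction rule: frags_induct) (use p_gt in \<open>auto simp: additive_maps coeff_sum_maps\<close>)

lemma weight_shift_x: "c \<in> PL \<Longrightarrow> [weight (shift_x c) = weight c + coeff_sum c] (mod int p)"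
proof (induction rule: frags_induct)
  case (one a)
  then have "a < p" by simp
  moreover have "int ((a + 1) mod p) = (int a + 1) mod int p" by (simp add: zmod_int add.commute)
  ultimately show ?case using p_gt by (simp add: cong_def)
next
  case (diff a b)
  then show ?case using cong_diff[OF diff.IH] by (simp add: additive_maps weight_maps coeff_sum_maps algebra_simps)
qed (auto simp: weight_maps coeff_sum_maps)

lemma norm_elt_in: "norm_elt \<in> PL"
proof -
  have "(\<Sum>a\<in>A. frag_of a) \<in> PL" if "A \<subseteq> {..<p}" "finite A" for A
    using that(2,1) by (induction A) (auto intro: frags_add)
  then show ?thesis by (simp add: norm_elt_def)
qed

lemma cf_norm_elt: "cf norm_elt a = (if a < p then 1 else 0)"
  by (simp add: norm_elt_def lookup_sum lookup_single when_def)

lemma shift_x_norm_elt: "shift_x norm_elt = norm_elt"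
proof -
  have "shift_x norm_elt = (\<Sum>a<p. frag_of ((a + 1) mod p))"
    by (simp add: norm_elt_def shift_x_def frag_extend_sum o_def)
  also have "\<dots> = (\<Sum>a<p. frag_of a)"
    by (rule sum.reindex_bij_witness[where i = pred_mod and j = "\<lambda>a. (a + 1) mod p"])
       (simp_all only: pred_mod_suc suc_pred_mod pred_mod_lt suc_lt lessThan_iff)
  finally show ?thesis by (simp add: norm_elt_def)
qed

lemma shift_y_norm_elt: "shift_y norm_elt = norm_elt"
proof -
  have "shift_y norm_elt = (\<Sum>a<p. frag_of (a * \<beta> mod p))"
    by (simp add: norm_elt_def shift_y_def frag_extend_sum o_def)
  also have "\<dots> = (\<Sum>a<p. frag_of a)"
    by (rule sum.reindex_bij_witness[where i = "\<lambda>a. a * \<alpha> mod p" and j = "\<lambda>a. a * \<beta> mod p"])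
       (use p_gt \<alpha>\<beta>_cancel in auto)
  finally show ?thesis by (simp add: norm_elt_def)
qed

lemma x_pow_el: "x \<up> (n::nat) = el 0 n" by (simp add: el_def)

lemma carrier_Cp: "carrier (Cp p \<alpha>) = el 0 ` {..<p}"
proof -
  have el: "el 0 n \<in> el 0 ` {..<p}" for n
    by (rule image_eqI[where x = "n mod p"]) (use p_gt in \<open>simp_all add: el_mod\<close>)
  have "g \<in> el 0 ` {..<p}" if "g \<in> generate G {x}" for g
    using that
  proof (induction rule: generate.induct)
    case one
    show ?case using el[of 0] by (simp add: el_00)
  next
    case (incl h)
    then show ?case using el[of 1] x_pow_el[of 1] by simp
  next
    case (inv h)
    then show ?case using el[of "p - 1"] x_pow_el[of "p - 1"] by (simp add: x_inv)
  next
    case (eng h1 h2)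
    then obtain a b where "h1 = el 0 a" "h2 = el 0 b" by auto
    then have "h1 \<cdot> h2 = el 0 (a + b)" using el_x_pow[of 0 a b] by (simp only: x_pow_el)
    then show ?case using el by simp
  qed
  moreover have "el 0 n \<in> generate G {x}" for n
  proof (induction n)
    case 0
    then show ?case by (simp add: el_00 generate.one)
  next
    case (Suc n)
    then show ?case using generate.eng[OF Suc generate.incl[of x "{x}" G]] by (simp add: el_x)
  qed
  ultimately show ?thesis by (auto simp: Cp_def)
qed

lemma Cp_mult [simp]: "g \<otimes>\<^bsub>Cp p \<alpha>\<^esub> h = g \<cdot> h" "\<one>\<^bsub>Cp p \<alpha>\<^esub> = \<one>\<^bsub>G\<^esub>" by (simp_all add: Cp_def)

lemma bij_embed: "bij_betw embed PL (carrier (Lam0 p \<alpha>))"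
proof -
  have "bij_betw (el 0) {..<p} (carrier (Cp p \<alpha>))"
    unfolding bij_betw_def carrier_Cp by (auto simp: inj_on_def el_eq_iff)
  then show ?thesis unfolding Lam0_def group_ring_carrier embed_def by (rule bij_frag_extend)
qed

lemma embed_in: "c \<in> PL \<Longrightarrow> embed c \<in> carrier (Lam0 p \<alpha>)"
  using bij_embed by (auto simp: bij_betw_def)

lemma embed_inj: "u \<in> PL \<Longrightarrow> v \<in> PL \<Longrightarrow> embed u = embed v \<longleftrightarrow> u = v"
  using bij_embed by (auto simp: bij_betw_def inj_on_def)

lemma embed_shift_x: "c \<in> PL \<Longrightarrow> embed (shift_x c) = rmul G x (embed c)"
  by (induction rule: frags_induct) (auto simp: additive_maps rmul_diff el_x el_mod)

lemma conj_y_eq: "conj_y p \<alpha> m = frag_extend (\<lambda>g. frag_of (inv\<^bsub>G\<^esub> y \<cdot> g \<cdot> y)) m"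
  by (simp add: conj_y_def Lam_def group_ring_mult frag_extend_frag_extend)

lemma embed_shift_y: "c \<in> PL \<Longrightarrow> embed (shift_y c) = conj_y p \<alpha> (embed c)"
proof (induction rule: frags_induct)
  case (one a)
  have "inv\<^bsub>G\<^esub> y \<cdot> el 0 a \<cdot> y = inv\<^bsub>G\<^esub> y \<cdot> (x \<up> a \<cdot> y)"
    by (simp add: G.m_assoc flip: x_pow_el)
  also have "\<dots> = (inv\<^bsub>G\<^esub> y \<cdot> y) \<cdot> x \<up> (a * \<beta>)"
    by (simp only: x_y G.m_assoc y_in G.inv_closed G.nat_pow_closed x_in)
  also have "\<dots> = el 0 (a * \<beta>)" by (simp add: x_pow_el)
  finally show ?case by (simp add: conj_y_eq el_mod)
qed (auto simp: additive_maps conj_y_eq frag_extend_diff)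

lemma augmentation_embed: "c \<in> PL \<Longrightarrow> augmentation (embed c) = coeff_sum c"
proof -
  have fin: "finite (carrier (Cp p \<alpha>))" by (simp add: carrier_Cp)
  assume "c \<in> PL"
  then show ?thesis
  proof (induction rule: frags_induct)
    case zero
    then show ?case by (simp add: coeff_sum_maps augmentation_def)
  next
    case (one a)
    then show ?case by (simp add: augmentation_def)
  next
    case (diff a b)
    have "embed a \<in> frags (carrier (Cp p \<alpha>))" "embed b \<in> frags (carrier (Cp p \<alpha>))"
      using diff embed_in by (auto simp: Lam0_def group_ring_carrier)
    then have "augmentation (embed a - embed b) = augmentation (embed a) - augmentation (embed b)"
      by (simp add: augmentation_eq[OF fin] frags_diff lookup_minus sum_subtractf)
    then show ?case using diff by (simp add: additive_maps coeff_sum_maps)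
  qed
qed

lemma I_C_eq: "I_C p \<alpha> = embed ` {c \<in> PL. coeff_sum c = 0}"
proof -
  have "I_C p \<alpha> = {c \<in> embed ` PL. augmentation c = 0}"
    using bij_embed by (simp add: I_C_def augmentation_ideal_def bij_betw_def Lam0_def)
  then show ?thesis using augmentation_embed by auto
qed

lemma shift_x_minus_image:
  "(\<lambda>c. shift_x c - c) ` {c \<in> PL. coeff_sum c = 0} = {c \<in> PL. coeff_sum c = 0 \<and> int p dvd weight c}"
proof (intro equalityI subsetI)
  fix e assume "e \<in> (\<lambda>c. shift_x c - c) ` {c \<in> PL. coeff_sum c = 0}"
  then obtain c where c: "c \<in> PL" "coeff_sum c = 0" "e = shift_x c - c" by auto
  then have "[weight (shift_x c) = weight c] (mod int p)" using weight_shift_x[OF c(1)] by simp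
  then show "e \<in> {c \<in> PL. coeff_sum c = 0 \<and> int p dvd weight c}"
    using c by (simp add: frags_diff shift_x_in coeff_sum_maps coeff_sum_shift_x weight_maps cong_iff_dvd_diff)
next
  fix e assume "e \<in> {c \<in> PL. coeff_sum c = 0 \<and> int p dvd weight c}"
  then have e: "e \<in> PL" "coeff_sum e = 0" "int p dvd weight e" by auto
  then obtain N where N: "weight e = int p * N" by auto
  \<comment> \<open>Telescoping determines \<open>c\<close> up to a constant, and \<open>- N\<close> is the one that makes its sum zero.\<close>
  define f where "f a = - N - (\<Sum>b\<le>a. cf e b)" for a
  define c where "c = (\<Sum>a<p. frag_cmul (f a) (frag_of a))"
  have cfc: "cf c a = (if a < p then f a else 0)" for a
    by (simp add: c_def lookup_sum lookup_single when_def if_distrib cong: if_cong)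
  have c: "c \<in> PL"
    by (auto simp: frags_def in_keys_iff cfc split: if_splits)
  have last: "f (p - 1) = - N"
  proof -
    have "{..p - 1} = {..<p}" using p_gt by auto
    then show ?thesis using e(2) by (simp add: f_def coeff_sum_def)
  qed
  have "coeff_sum c = (\<Sum>a<p. - N) - (\<Sum>a<p. \<Sum>b\<le>a. cf e b)"
    by (simp add: coeff_sum_def cfc f_def sum_subtractf sum_negf)
  also have "(\<Sum>a<p. \<Sum>b\<le>a. cf e b) = (\<Sum>a<p. \<Sum>b<p. if b \<le> a then cf e b else 0)"
  proof (rule sum.cong[OF refl])
    fix a assume "a \<in> {..<p}"
    then have "{..a} = {b \<in> {..<p}. b \<le> a}" by auto
    then show "(\<Sum>b\<le>a. cf e b) = (\<Sum>b<p. if b \<le> a then cf e b else 0)"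
      by (simp only: sum.inter_filter finite_lessThan)
  qed
  also have "\<dots> = (\<Sum>b<p. \<Sum>a<p. if b \<le> a then cf e b else 0)" by (rule sum.swap)
  also have "\<dots> = (\<Sum>b<p. (int p - int b) * cf e b)"
  proof (rule sum.cong[OF refl])
    fix b assume "b \<in> {..<p}"
    then have "{a \<in> {..<p}. b \<le> a} = {b..<p}" "b < p" by auto
    moreover have "(\<Sum>a<p. if b \<le> a then cf e b else 0) = (\<Sum>a\<in>{a \<in> {..<p}. b \<le> a}. cf e b)"
      by (simp only: sum.inter_filter finite_lessThan)
    ultimately show "(\<Sum>a<p. if b \<le> a then cf e b else 0) = (int p - int b) * cf e b"
      by (simp add: of_nat_diff)
  qed
  also have "\<dots> = int p * coeff_sum e - weight e"
    by (simp add: coeff_sum_def weight_def sum_subtractf left_diff_distrib sum_distrib_left)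
  finally have coeff_sum_c: "coeff_sum c = 0" using e N by simp
  have cfp: "cf (shift_x v) a = (if a < p then cf v (pred_mod a) else 0)" if "v \<in> PL" for v a
    using that
  proof (induction rule: frags_induct)
    case (one b)
    then have "b < p" by simp
    then have "(b + 1) mod p = a \<longleftrightarrow> a < p \<and> b = pred_mod a"
      using pred_mod_suc suc_pred_mod suc_lt by metis
    then show ?case by (simp only: maps_of) (auto simp: lookup_single when_def)
  qed (auto simp: additive_maps lookup_minus)
  have "shift_x c - c = e"
  proof (rule poly_mapping_eqI)
    fix a
    show "cf (shift_x c - c) a = cf e a"
    proof (cases "a < p")
      case False
      then show ?thesis using e(1) by (simp add: lookup_minus cfp c cfc frags_lookup)
    next
      case True
      show ?thesis
      proof (cases a)
        case 0
        then show ?thesis using True p_gt last by (simp add: lookup_minus cfp c cfc pred_mod_def) (simp add: f_def)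
      next
        case (Suc b)
        then have "pred_mod a = b" by (simp add: pred_mod_def)
        then show ?thesis using True Suc by (simp add: lookup_minus cfp c cfc) (simp add: f_def)
      qed
    qed
  qed
  then show "e \<in> (\<lambda>c. shift_x c - c) ` {c \<in> PL. coeff_sum c = 0}" using c coeff_sum_c by force
qed

lemma xm1_I_C_eq: "xm1_I_C p \<alpha> = embed ` {c \<in> PL. coeff_sum c = 0 \<and> int p dvd weight c}"
proof -
  have "(frag_of x - frag_of \<one>\<^bsub>Cp p \<alpha>\<^esub>) \<otimes>\<^bsub>Lam0 p \<alpha>\<^esub> embed c = embed (shift_x c - c)" if "c \<in> PL" for c
  proof -
    have "frag_of x \<otimes>\<^bsub>Lam0 p \<alpha>\<^esub> embed c = embed (shift_x c)"
      unfolding Lam0_def group_ring_of_mult using that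
    proof (induction rule: frags_induct)
      case (one a)
      have "x \<cdot> el 0 a = el 0 a \<cdot> x"
        using G.nat_pow_comm[of x 1 a] by (simp flip: x_pow_el)
      then show ?case by (simp add: el_x el_mod)
    qed (auto simp: additive_maps frag_extend_diff)
    moreover have "frag_of \<one>\<^bsub>Cp p \<alpha>\<^esub> \<otimes>\<^bsub>Lam0 p \<alpha>\<^esub> embed c = embed c"
    proof -
      have "embed c \<in> frags (carrier G)"
        unfolding embed_def using that by (rule frag_extend_in_frags) simp
      then show ?thesis unfolding Lam0_def group_ring_of_mult by (rule frag_extend_id) simp
    qed
    ultimately show ?thesis by (simp add: Lam0_def group_ring_diff_left additive_maps)
  qed
  then have "(\<lambda>c. (frag_of x - frag_of \<one>\<^bsub>Cp p \<alpha>\<^esub>) \<otimes>\<^bsub>Lam0 p \<alpha>\<^esub> embed c) ` {c \<in> PL. coeff_sum c = 0}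
      = embed ` (\<lambda>c. shift_x c - c) ` {c \<in> PL. coeff_sum c = 0}"
    unfolding image_image by (intro image_cong) auto
  moreover have "xm1_I_C p \<alpha> =
      (\<lambda>c. (frag_of x - frag_of \<one>\<^bsub>Cp p \<alpha>\<^esub>) \<otimes>\<^bsub>Lam0 p \<alpha>\<^esub> embed c) ` {c \<in> PL. coeff_sum c = 0}"
    unfolding xm1_I_C_def I_C_eq by blast
  ultimately have "xm1_I_C p \<alpha> = embed ` (\<lambda>c. shift_x c - c) ` {c \<in> PL. coeff_sum c = 0}" by simp
  then show ?thesis by (simp only: shift_x_minus_image)
qed

end

text \<open>
  Keeps the basis element at the residue \<open>0\<close> from being rewritten into the unit \<open>1\<close> of the
  convolution product.
\<close>

declare single_one [simp del]

text \<open>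
  In \<open>equivariant_iso f A s B pl t\<close>, the target is a subset \<open>B\<close> of any type with addition \<open>pl\<close>,
  so that it can be the carrier of a module; \<open>s\<close> and \<open>t\<close> are the actions of a generator.
\<close>

definition equivariant_iso where
  "equivariant_iso f A s B pl t \<longleftrightarrow> bij_betw f A B \<and>
     (\<forall>u\<in>A. \<forall>v\<in>A. f (u + v) = pl (f u) (f v)) \<and> (\<forall>u\<in>A. f (s u) = t (f u))"

lemma equivariant_iso_comp:
  assumes "equivariant_iso f A s B (+) t" "equivariant_iso g B t C pl t'"
  shows "equivariant_iso (g \<circ> f) A s C pl t'"
proof -
  have "f u \<in> B" if "u \<in> A" for u using assms(1) that by (auto simp: equivariant_iso_def bij_betw_def)
  then show ?thesis
    using assms unfolding equivariant_iso_def by (auto intro: bij_betw_trans)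
qed

text \<open>
  Multiplication by \<open>u\<^sub>0 + u\<^sub>1 y + u\<^sub>2 y\<^sup>2\<close> on \<open>\<int>[H]\<close>, in coordinates. Its matrix is circulant with
  determinant \<open>u\<^sub>0\<^sup>3 + u\<^sub>1\<^sup>3 + u\<^sub>2\<^sup>3 - 3 u\<^sub>0 u\<^sub>1 u\<^sub>2\<close>, and the adjugate is the circulant of the
  \<open>c\<^sub>i\<close> in the proof.
\<close>

lemma circulant_injective:
  fixes u0 u1 u2 a0 a1 a2 :: int
  assumes "a0 * u0 + a1 * u2 + a2 * u1 = 0" "a0 * u1 + a1 * u0 + a2 * u2 = 0"
    "a0 * u2 + a1 * u1 + a2 * u0 = 0"
    and det: "u0^3 + u1^3 + u2^3 - 3 * u0 * u1 * u2 \<noteq> 0"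
  shows "a0 = 0 \<and> a1 = 0 \<and> a2 = 0"
proof -
  let ?D = "u0^3 + u1^3 + u2^3 - 3 * u0 * u1 * u2"
  let ?c0 = "u0^2 - u1 * u2" and ?c1 = "u2^2 - u0 * u1" and ?c2 = "u1^2 - u0 * u2"
  let ?E0 = "a0 * u0 + a1 * u2 + a2 * u1" and ?E1 = "a0 * u1 + a1 * u0 + a2 * u2" and ?E2 = "a0 * u2 + a1 * u1 + a2 * u0"
  have "?D * a0 = ?c0 * ?E0 + ?c1 * ?E2 + ?c2 * ?E1" "?D * a1 = ?c0 * ?E1 + ?c1 * ?E0 + ?c2 * ?E2"
    "?D * a2 = ?c0 * ?E2 + ?c1 * ?E1 + ?c2 * ?E0" by (simp_all add: power2_eq_square power3_eq_cube algebra_simps)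
  then have "?D * a0 = 0" "?D * a1 = 0" "?D * a2 = 0"
    by (simp_all only: assms(1-3) mult_zero_right add_0_right)
  then show ?thesis using det by simp
qed

text \<open>
  An element \<open>u\<close> of \<open>\<int>[H]\<close> of norm \<open>\<plusminus>p\<close> that vanishes at \<open>y = \<omega>\<close> modulo \<open>p\<close> generates the ideal
  of all such elements. Multiply \<open>v\<close> by the adjugate of \<open>u\<close>: modulo \<open>p\<close> the coefficients of
  the adjugate are \<open>c\<^sub>0, \<omega>\<^sup>2 c\<^sub>0, \<omega> c\<^sub>0\<close>, so each coefficient of the product is a multiple of the
  value of \<open>v\<close> at \<open>\<omega>\<close>, and the product can be divided by \<open>p\<close>.
\<close>

lemma circulant_solve:
  fixes p \<omega> e u0 u1 u2 v0 v1 v2 :: int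
  assumes \<omega>: "p dvd 1 + \<omega> + \<omega>^2" and u: "p dvd u0 + u1 * \<omega> + u2 * \<omega>^2"
    and v: "p dvd v0 + v1 * \<omega> + v2 * \<omega>^2"
    and det: "u0^3 + u1^3 + u2^3 - 3 * u0 * u1 * u2 = e * p" and e: "e * e = 1" and p: "p \<noteq> 0"
  shows "\<exists>a0 a1 a2. a0 * u0 + a1 * u2 + a2 * u1 = v0 \<and> a0 * u1 + a1 * u0 + a2 * u2 = v1 \<and>
    a0 * u2 + a1 * u1 + a2 * u0 = v2"
proof -
  let ?c0 = "u0^2 - u1 * u2" and ?c1 = "u2^2 - u0 * u1" and ?c2 = "u1^2 - u0 * u2"
  let ?q = "u0 + u1 * \<omega> + u2 * \<omega>^2" and ?r = "v0 + v1 * \<omega> + v2 * \<omega>^2"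
  let ?D = "u0^3 + u1^3 + u2^3 - 3 * u0 * u1 * u2"
  have "?c2 - \<omega> * ?c0 = (1 + \<omega> + \<omega>^2) * ((1 - \<omega>) * (u1 + u2 * \<omega>)^2)
      - ?q * (u2 + \<omega> * (u0 - u1 * \<omega> - u2 * \<omega>^2))" by (simp add: power2_eq_square power3_eq_cube algebra_simps)
  then have X: "p dvd ?c2 - \<omega> * ?c0" using \<omega> u by (metis dvd_diff dvd_mult2)
  have "?c1 - \<omega>^2 * ?c0 = (1 + \<omega> + \<omega>^2) * ((1 - \<omega>) * (u2^2 * (1 + \<omega>^3) + u1^2 * \<omega> + 2 * u1 * u2 * \<omega>^2))
      - ?q * (u1 + \<omega>^2 * (u0 - u1 * \<omega> - u2 * \<omega>^2))" by (simp add: power2_eq_square power3_eq_cube algebra_simps)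
  then have Y: "p dvd ?c1 - \<omega>^2 * ?c0" using \<omega> u by (metis dvd_diff dvd_mult2)
  let ?w0 = "v0 * ?c0 + v1 * ?c2 + v2 * ?c1" and ?w1 = "v0 * ?c1 + v1 * ?c0 + v2 * ?c2"
    and ?w2 = "v0 * ?c2 + v1 * ?c1 + v2 * ?c0"
  have "?w0 = ?r * ?c0 + (?c2 - \<omega> * ?c0) * v1 + (?c1 - \<omega>^2 * ?c0) * v2" by (simp add: power2_eq_square power3_eq_cube algebra_simps)
  then have "p dvd ?w0" using v X Y by (metis dvd_add dvd_mult2)
  then obtain w0 where w0: "?w0 = p * w0" by auto
  have "?w1 = (?c1 - \<omega>^2 * ?c0) * v0 + (?c2 - \<omega> * ?c0) * v2 + ?r * (\<omega>^2 * ?c0)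
      + (1 + \<omega> + \<omega>^2) * ((1 - \<omega>) * (v1 + v2 * \<omega>) * ?c0)" by (simp add: power2_eq_square power3_eq_cube algebra_simps)
  then have "p dvd ?w1" using v X Y \<omega> by (metis dvd_add dvd_mult2)
  then obtain w1 where w1: "?w1 = p * w1" by auto
  have "?w2 = (?c2 - \<omega> * ?c0) * v0 + (?c1 - \<omega>^2 * ?c0) * v1 + ?r * (\<omega> * ?c0)
      + (1 + \<omega> + \<omega>^2) * ((1 - \<omega>) * v2 * ?c0)" by (simp add: power2_eq_square power3_eq_cube algebra_simps)
  then have "p dvd ?w2" using v X Y \<omega> by (metis dvd_add dvd_mult2)
  then obtain w2 where w2: "?w2 = p * w2" by auto
  have "p * (w0 * u0 + w1 * u2 + w2 * u1) = ?w0 * u0 + ?w1 * u2 + ?w2 * u1"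
    "p * (w0 * u1 + w1 * u0 + w2 * u2) = ?w0 * u1 + ?w1 * u0 + ?w2 * u2"
    "p * (w0 * u2 + w1 * u1 + w2 * u0) = ?w0 * u2 + ?w1 * u1 + ?w2 * u0"
    unfolding w0 w1 w2 by (simp_all add: algebra_simps)
  moreover have "?w0 * u0 + ?w1 * u2 + ?w2 * u1 = ?D * v0" "?w0 * u1 + ?w1 * u0 + ?w2 * u2 = ?D * v1"
    "?w0 * u2 + ?w1 * u1 + ?w2 * u0 = ?D * v2"
    by (simp_all add: power2_eq_square power3_eq_cube algebra_simps)
  ultimately have "p * (w0 * u0 + w1 * u2 + w2 * u1) = ?D * v0" "p * (w0 * u1 + w1 * u0 + w2 * u2) = ?D * v1"
    "p * (w0 * u2 + w1 * u1 + w2 * u0) = ?D * v2" by simp_all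
  then have "w0 * u0 + w1 * u2 + w2 * u1 = e * v0" "w0 * u1 + w1 * u0 + w2 * u2 = e * v1"
    "w0 * u2 + w1 * u1 + w2 * u0 = e * v2"
    using p unfolding det by (simp_all add: mult.assoc mult.left_commute[of e p])
  then have "e * w0 * u0 + e * w1 * u2 + e * w2 * u1 = v0" "e * w0 * u1 + e * w1 * u0 + e * w2 * u2 = v1"
    "e * w0 * u2 + e * w1 * u1 + e * w2 * u0 = v2"
    using e by (simp_all add: mult.assoc flip: distrib_left)
  then show ?thesis by blast
qed

context metacyclic begin

text \<open>
  \<open>M\<close>, restricted to \<open>\<langle>y\<rangle>\<close>, is free of rank \<open>k\<close>: \<open>\<epsilon>\<close> is an isomorphism from the standard free
  module over the group ring of the cyclic group of order 3.
\<close>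

definition c3_free :: "(lam, 'm) rmod \<Rightarrow> nat \<Rightarrow> ((nat \<times> nat \<Rightarrow>\<^sub>0 int) \<Rightarrow> 'm) \<Rightarrow> bool" where
  "c3_free M k \<epsilon> \<longleftrightarrow>
     equivariant_iso \<epsilon> (Fr Z3 {..<k}) (tr Z3 1) (carrier M) (ring.add M) (\<lambda>m. m \<star>\<^bsub>M\<^esub> frag_of y)"

abbreviation "\<Omega> \<equiv> {1..<p}"

lemma \<beta>_coprime: "coprime \<beta> p"
proof -
  have "\<not> p dvd \<beta>"
  proof
    assume "p dvd \<beta>"
    then have "\<alpha> * \<beta> mod p = 0" by simp
    then have "1 mod p = 0" using \<alpha>\<beta> by (simp add: cong_def)
    then show False using p_gt by simp
  qed
  then show ?thesis using prime_p by (simp add: prime_imp_coprime coprime_commute)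
qed

lemma orbits:
  obtains t where "bij_betw (\<lambda>(i, j). t i * \<beta>^j mod p) ({..<d} \<times> {..<3}) \<Omega>"
proof -
  let ?s = "\<lambda>w. w * \<beta> mod p"
  have s: "?s w \<in> \<Omega> \<and> ?s w \<noteq> w \<and> ?s (?s (?s w)) = w" if w: "w \<in> \<Omega>" for w
  proof (intro conjI)
    have nd: "\<not> p dvd w" using w by (auto dest: dvd_imp_le)
    then have "\<not> p dvd w * \<beta>" using \<beta>_coprime by (simp add: coprime_commute coprime_dvd_mult_left_iff)
    then have "0 < ?s w" by (simp add: mod_greater_zero_iff_not_dvd)
    then show "?s w \<in> \<Omega>" using p_gt by simp
    show "?s w \<noteq> w"
    proof
      assume "?s w = w"
      then have "[w * \<beta> = w * 1] (mod p)" using w by (simp add: cong_def)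
      moreover have "coprime w p" using nd prime_p by (simp add: prime_imp_coprime coprime_commute)
      ultimately have "[\<beta> = 1] (mod p)" using cong_mult_lcancel_nat by blast
      then show False using \<beta>_neq_1 by simp
    qed
    have "?s (?s (?s w)) = w * \<beta>^3 mod p" by (simp add: mod_simps power3_eq_cube mult.assoc)
    also have "\<dots> = w" using cong_mult[OF cong_refl \<beta>3, of w] w by (simp add: cong_def)
    finally show "?s (?s (?s w)) = w" .
  qed
  then obtain k t where kt: "bij_betw (\<lambda>(i, j). (?s ^^ j) (t i)) ({..<k::nat} \<times> {..<3}) \<Omega>"
    using free_orbits[of \<Omega> ?s] by auto
  have "card ({..<k} \<times> {..<3::nat}) = card \<Omega>" using kt by (rule bij_betw_same_card)
  then have k: "k = d" using p_eq by simp
  have "t i \<in> \<Omega>" if "i < d" for i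
    using bij_betw_apply[OF kt, of "(i, 0)"] that k by simp
  then have "(?s ^^ j) (t i) = t i * \<beta>^j mod p" if "i < d" for i j
    by (induction j) (use that in \<open>auto simp: mod_simps mult_ac\<close>)
  then have "bij_betw (\<lambda>(i, j). t i * \<beta>^j mod p) ({..<d} \<times> {..<3}) \<Omega>"
    using kt k by (subst bij_betw_cong[of _ _ "\<lambda>(i, j). (?s ^^ j) (t i)"]) auto
  then show ?thesis by (rule that)
qed

text \<open>
  \<open>orb i j\<close> is the \<open>j\<close>-th point of the \<open>i\<close>-th orbit of multiplication by \<open>\<beta>\<close> on the nonzero
  residues.
\<close>

definition orbit_reps :: "(nat \<Rightarrow> nat) \<Rightarrow> bool" where
  "orbit_reps t \<longleftrightarrow> bij_betw (\<lambda>(i, j). t i * \<beta>^j mod p) ({..<d} \<times> {..<3}) \<Omega>"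

definition orb_rep :: "nat \<Rightarrow> nat" where "orb_rep = (SOME t. orbit_reps t)"

definition orb :: "nat \<Rightarrow> nat \<Rightarrow> nat" where "orb i j = orb_rep i * \<beta>^j mod p"

lemma bij_orb: "bij_betw (\<lambda>(i, j). orb i j) ({..<d} \<times> {..<3}) \<Omega>"
proof -
  obtain t where "bij_betw (\<lambda>(i, j). t i * \<beta>^j mod p) ({..<d} \<times> {..<3}) \<Omega>" by (rule orbits)
  then have "orbit_reps t" by (simp only: orbit_reps_def)
  then have "orbit_reps orb_rep" unfolding orb_rep_def by (rule someI[of orbit_reps])
  then show ?thesis by (simp only: orbit_reps_def orb_def)
qed

lemma orb_in: "i < d \<Longrightarrow> j < 3 \<Longrightarrow> orb i j \<in> \<Omega>"
  using bij_betw_apply[OF bij_orb, of "(i, j)"] by simp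

lemma orb_Suc: "orb i ((j + 1) mod 3) = orb i j * \<beta> mod p" if "j < 3"
proof -
  have A: "orb_rep i * \<beta>^3 mod p = orb_rep i mod p"
    using cong_mult[OF cong_refl \<beta>3, of "orb_rep i"] by (simp add: cong_def)
  have B: "orb i j * \<beta> mod p = orb_rep i * \<beta>^(j + 1) mod p"
    by (simp add: orb_def mod_mult_right_eq mult_ac)
  show ?thesis
  proof (cases "j + 1 = 3")
    case True
    show ?thesis unfolding B True A by (simp add: orb_def)
  next
    case False
    then have "(j + 1) mod 3 = j + 1" using that by simp
    then show ?thesis unfolding B by (simp only: orb_def)
  qed
qed

definition orbit_map :: "(nat \<times> nat \<Rightarrow>\<^sub>0 int) \<Rightarrow> (nat \<Rightarrow>\<^sub>0 int)" where
  "orbit_map = frag_extend (\<lambda>ij. frag_of (case ij of (i, j) \<Rightarrow> orb i j))"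

lemma orbit_map_iso: "equivariant_iso orbit_map (Fr Z3 {..<d}) (tr Z3 1) (frags \<Omega>) (+) shift_y"
  unfolding equivariant_iso_def
proof (intro conjI ballI)
  show "bij_betw orbit_map (Fr Z3 {..<d}) (frags \<Omega>)"
    unfolding orbit_map_def Fr_def using bij_orb by (intro bij_frag_extend) simp
  show "orbit_map (u + v) = orbit_map u + orbit_map v" for u v by (simp add: orbit_map_def frag_extend_add)
  fix u assume "u \<in> Fr Z3 {..<d}"
  then show "orbit_map (tr Z3 1 u) = shift_y (orbit_map u)"
  proof (induction rule: Fr_induct)
    case (one i j)
    then show ?case using orb_Suc[of j i] by (simp add: orbit_map_def)
  qed (auto simp: orbit_map_def tr_diff frag_extend_diff additive_maps)
qed

lemma \<Omega>_PL: "frags \<Omega> \<subseteq> PL" by (rule frags_mono) auto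

text \<open>
  An element of augmentation 0 is determined by its coefficients at the nonzero residues;
  \<open>augment_zero\<close> restores the coefficient at \<open>0\<close>.
\<close>

definition augment_zero :: "(nat \<Rightarrow>\<^sub>0 int) \<Rightarrow> (nat \<Rightarrow>\<^sub>0 int)" where
  "augment_zero u = u - frag_cmul (coeff_sum u) (frag_of 0)"

lemma augment_zero_iso:
  assumes "\<And>u. Q (augment_zero u) \<longleftrightarrow> Q u"
  shows "equivariant_iso augment_zero {u \<in> frags \<Omega>. Q u} shift_y {u \<in> PL. coeff_sum u = 0 \<and> Q u} (+) shift_y"
  unfolding equivariant_iso_def
proof (intro conjI ballI)
  have inv1: "augment_zero u - frag_cmul (cf (augment_zero u) 0) (frag_of 0) = u" if "u \<in> frags \<Omega>" for u
  proof -
    have "cf u 0 = 0" using that by (auto intro: frags_lookup)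
    then show ?thesis by (simp add: augment_zero_def lookup_minus flip: frag_cmul_distrib)
  qed
  have inv2: "augment_zero (u - frag_cmul (cf u 0) (frag_of 0)) = u" if "coeff_sum u = 0" for u
    using that p_gt by (simp add: augment_zero_def coeff_sum_maps flip: frag_cmul_distrib)
  have "coeff_sum (augment_zero u) = 0" for u using p_gt by (simp add: augment_zero_def coeff_sum_maps)
  moreover have "augment_zero u \<in> PL" if "u \<in> frags \<Omega>" for u
    unfolding augment_zero_def using that \<Omega>_PL p_gt by (intro frags_diff frags_cmul) auto
  moreover have "u - frag_cmul (cf u 0) (frag_of 0) \<in> frags \<Omega>" if "u \<in> PL" for u
  proof -
    have "u - frag_cmul (cf u 0) (frag_of 0) \<in> PL"
      using that p_gt by (intro frags_diff frags_cmul) auto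
    moreover have "cf (u - frag_cmul (cf u 0) (frag_of 0)) 0 = 0" by (simp add: lookup_minus)
    ultimately show ?thesis unfolding frags_def
      by (auto simp: in_keys_iff subset_iff) (metis One_nat_def Suc_leI gr0I)
  qed
  moreover have "Q (u - frag_cmul (cf u 0) (frag_of 0)) \<longleftrightarrow> Q u" if "coeff_sum u = 0" for u
    using assms[of "u - frag_cmul (cf u 0) (frag_of 0)"] inv2[OF that] by simp
  ultimately show "bij_betw augment_zero {u \<in> frags \<Omega>. Q u} {u \<in> PL. coeff_sum u = 0 \<and> Q u}"
    using inv1 inv2 assms
    by (intro bij_betw_byWitness[where f' = "\<lambda>u. u - frag_cmul (cf u 0) (frag_of 0)"]) auto
  show "augment_zero (u + v) = augment_zero u + augment_zero v" for u v by (simp add: augment_zero_def coeff_sum_maps frag_cmul_distrib)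
  fix u assume "u \<in> {u \<in> frags \<Omega>. Q u}"
  then have "u \<in> PL" using \<Omega>_PL by auto
  then show "augment_zero (shift_y u) = shift_y (augment_zero u)" by (simp add: augment_zero_def additive_maps coeff_sum_shift_y)
qed

lemma frag_of_Lam: "g \<in> carrier G \<Longrightarrow> frag_of g \<in> carrier (Lam p \<alpha>)"
  by (simp add: carrier_Lam)

lemma bar_ideal:
  assumes bar: "is_bar p \<alpha> (ideal_rmod (Lam0 p \<alpha>) (embed ` L)) (conj_y p \<alpha>) M"
    and L: "L \<subseteq> PL" "\<And>u v. u \<in> L \<Longrightarrow> v \<in> L \<Longrightarrow> u + v \<in> L" "\<And>u. u \<in> L \<Longrightarrow> shift_y u \<in> L"
  shows "\<exists>\<psi>. equivariant_iso \<psi> L shift_y (carrier M) (ring.add M) (\<lambda>m. m \<star>\<^bsub>M\<^esub> frag_of y)"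
proof -
  let ?J = "ideal_rmod (Lam0 p \<alpha>) (embed ` L)"
  have J: "carrier ?J = embed ` L" "a \<oplus>\<^bsub>?J\<^esub> b = a + b" for a b
    by (simp_all add: ideal_rmod_def regular_rmod_def Lam0_def)
  obtain \<phi> where M: "right_module (Lam p \<alpha>) M" and hom: "\<phi> \<in> rmod_hom (Lam0 p \<alpha>) M ?J"
    and bij: "bij_betw \<phi> (carrier M) (embed ` L)"
    and y: "\<And>m. m \<in> carrier M \<Longrightarrow> \<phi> (m \<star>\<^bsub>M\<^esub> frag_of y) = conj_y p \<alpha> (\<phi> m)"
    using bar unfolding is_bar_def J by blast
  interpret M: right_module "Lam p \<alpha>" M by (rule M)
  have add: "\<phi> (m \<oplus>\<^bsub>M\<^esub> n) = \<phi> m + \<phi> n" if "m \<in> carrier M" "n \<in> carrier M" for m n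
    using hom that unfolding rmod_hom_def J by blast
  have "inj_on embed L" using L(1) embed_inj by (auto simp: inj_on_def subset_iff)
  then have bije: "bij_betw embed L (embed ` L)" by (simp add: bij_betw_def)
  define \<psi> where "\<psi> = the_inv_into (carrier M) \<phi> \<circ> embed"
  have bij\<psi>: "bij_betw \<psi> L (carrier M)"
    unfolding \<psi>_def by (rule bij_betw_trans[OF bije bij_betw_the_inv_into[OF bij]])
  have inj: "inj_on \<phi> (carrier M)" using bij by (simp add: bij_betw_def)
  have \<phi>\<psi>: "\<phi> (\<psi> u) = embed u" if "u \<in> L" for u
    using that bij by (auto simp: \<psi>_def bij_betw_def intro: f_the_inv_into_f)
  have \<psi>_in: "\<psi> u \<in> carrier M" if "u \<in> L" for u using bij\<psi> that by (auto simp: bij_betw_def)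
  have "\<psi> (u + v) = \<psi> u \<oplus>\<^bsub>M\<^esub> \<psi> v" if "u \<in> L" "v \<in> L" for u v
    using that by (intro inj_onD[OF inj]) (simp_all add: add \<phi>\<psi> \<psi>_in L additive_maps)
  moreover have "\<psi> (shift_y u) = \<psi> u \<star>\<^bsub>M\<^esub> frag_of y" if "u \<in> L" for u
    using that L(1) by (intro inj_onD[OF inj])
      (auto simp: y \<phi>\<psi> \<psi>_in L(3) embed_shift_y intro!: M.ract_closed frag_of_Lam)
  ultimately show ?thesis using bij\<psi> unfolding equivariant_iso_def by blast
qed

lemma c3_free_R1: assumes "is_R p \<alpha> 1 M" shows "\<exists>\<epsilon>. c3_free M d \<epsilon>"
proof -
  have "is_bar p \<alpha> (ideal_rmod (Lam0 p \<alpha>) (embed ` {c \<in> PL. coeff_sum c = 0 \<and> True})) (conj_y p \<alpha>) M"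
    using assms by (simp add: is_R_def I_C_eq)
  then obtain \<psi> where \<psi>: "equivariant_iso \<psi> {c \<in> PL. coeff_sum c = 0 \<and> True} shift_y (carrier M) (ring.add M) (\<lambda>m. m \<star>\<^bsub>M\<^esub> frag_of y)"
    using bar_ideal[of "{c \<in> PL. coeff_sum c = 0 \<and> True}" M] by (auto simp: frags_add coeff_sum_maps coeff_sum_shift_y shift_y_in)
  have "equivariant_iso augment_zero {u \<in> frags \<Omega>. True} shift_y {c \<in> PL. coeff_sum c = 0 \<and> True} (+) shift_y" by (rule augment_zero_iso) simp
  then have "equivariant_iso augment_zero (frags \<Omega>) shift_y {c \<in> PL. coeff_sum c = 0 \<and> True} (+) shift_y" by simp
  from equivariant_iso_comp[OF equivariant_iso_comp[OF orbit_map_iso this] \<psi>] show ?thesis unfolding c3_free_def by blast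
qed

lemma weight_shift_y: "c \<in> PL \<Longrightarrow> [weight (shift_y c) = int \<beta> * weight c] (mod int p)"
proof (induction rule: frags_induct)
  case (one a)
  then have "a < p" by simp
  moreover have "a * \<beta> mod p < p" using p_gt by simp
  ultimately show ?case by (simp add: zmod_int cong_def mult.commute)
next
  case (diff a b)
  then show ?case using cong_diff[OF diff.IH] by (simp add: additive_maps weight_maps algebra_simps)
qed (auto simp: weight_maps)

text \<open>
  Lattice coordinates identify \<open>R(2)\<close> with the combinations of orbit points of total weight
  divisible by \<open>p\<close>. After an elementary transformation that makes every orbit but the first
  weightless, the condition only concerns the first orbit, where it says that
  \<open>v\<^sub>0 + v\<^sub>1 y + v\<^sub>2 y\<^sup>2\<close> vanishes at \<open>y = \<beta>\<close> modulo \<open>p\<close>.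
\<close>

definition block_weight :: "(nat \<times> nat \<Rightarrow>\<^sub>0 int) \<Rightarrow> int" where
  "block_weight v = cf v (0, 0) + cf v (0, Suc 0) * int \<beta> + cf v (0, 2) * int \<beta>^2"

text \<open>
  The first step of the reduction: the multiplier \<open>sc i\<close> is chosen so that the \<open>i\<close>-th orbit minus
  \<open>sc i\<close> times the first one has weight 0 modulo \<open>p\<close>.
\<close>

lemma weight_block:
  "\<exists>f. equivariant_iso f {v \<in> Fr Z3 {..<d}. int p dvd block_weight v} (tr Z3 1)
      {v \<in> Fr Z3 {..<d}. int p dvd weight (orbit_map v)} (+) (tr Z3 1)"
proof -
  have d0: "0 < d" using p_gt by simp
  have "\<not> p dvd orb 0 0" using orb_in[OF d0, of 0] by (auto dest: dvd_imp_le)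
  then have "coprime (orb 0 0) p" using prime_p by (simp add: prime_imp_coprime coprime_commute)
  then obtain z where z: "[orb 0 0 * z = 1] (mod p)" using cong_solve_coprime_nat by auto
  define sc where "sc i = int (orb i 0 * z)" for i
  define e where "e i = (frag_of (i, 0) :: nat \<times> nat \<Rightarrow>\<^sub>0 int)" for i :: nat
  define b where "b i = (if i = 0 then e i else e i + frag_cmul (- sc i) (e 0))" for i
  have eI: "e i \<in> Fr Z3 {..<d}" if "i < d" for i using that by (simp add: e_def)
  have basis: "is_basis Z3 {..<d} b"
  proof (rule Z3.basis_change[where J = "{0}"])
    show "is_basis Z3 {..<d} e"
      using Z3.is_basis_units[of "{..<d}"] by (simp add: e_def[abs_def])
    show "{0} \<subseteq> {..<d}" using d0 by simp
    show "b i = e i" if "i \<in> {0}" for i using that by (simp add: b_def)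
    show "b i - e i \<in> lin Z3 e ` Fr Z3 {0}" if "i \<in> {..<d} - {0}" for i
    proof (rule image_eqI[where x = "frag_cmul (- sc i) (e 0)"])
      have 0: "e 0 \<in> Fr Z3 {0}" by (simp add: e_def)
      then have "frag_cmul (- sc i) (e 0) \<in> Fr Z3 {0}" by (simp add: Fr_def frags_cmul)
      then show "b i - e i = lin Z3 e (frag_cmul (- sc i) (e 0))" "frag_cmul (- sc i) (e 0) \<in> Fr Z3 {0}"
        using that Z3.lin_units[of _ "{0::nat}"] by (auto simp: b_def e_def[abs_def])
    qed
  qed
  have bI: "b i \<in> Fr Z3 {..<d}" if "i < d" for i using basis that by (simp add: is_basis_def)
  have orbit_map_PL: "orbit_map v \<in> PL" if "v \<in> Fr Z3 {..<d}" for v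
    using orbit_map_iso that \<Omega>_PL unfolding equivariant_iso_def bij_betw_def by blast
  have shift: "[weight (orbit_map (tr Z3 j v)) = int \<beta>^j * weight (orbit_map v)] (mod int p)"
    if v: "v \<in> Fr Z3 {..<d}" and j: "j < 3" for j v
  proof -
    have step: "[weight (orbit_map (tr Z3 1 v)) = int \<beta> * weight (orbit_map v)] (mod int p)" if "v \<in> Fr Z3 {..<d}" for v
      using orbit_map_iso that weight_shift_y[OF orbit_map_PL[OF that]] unfolding equivariant_iso_def by auto
    have t1: "tr Z3 1 v \<in> Fr Z3 {..<d}" using v by (intro Z3.tr_in) auto
    have t2: "tr Z3 1 (tr Z3 1 v) = tr Z3 2 v" using tr_Z3_Suc[OF v, of 1] by (simp add: numeral_2_eq_2)
    have "[weight (orbit_map (tr Z3 2 v)) = int \<beta> * (int \<beta> * weight (orbit_map v))] (mod int p)"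
      using step[OF t1] cong_scalar_left[OF step[OF v], of "int \<beta>"] unfolding t2 by (rule cong_trans)
    then show ?thesis
      using j step[OF v] Z3.tr_one[OF v] by (elim less_3_cases) (auto simp: power2_eq_square mult.assoc)
  qed
  have orbit_map_of: "orbit_map (e i) = frag_of (orb i 0)" for i by (simp add: orbit_map_def e_def)
  have wb: "[weight (orbit_map (b i)) = (if i = 0 then int (orb 0 0) else 0)] (mod int p)" if "i < d" for i
  proof (cases "i = 0")
    case True
    then show ?thesis using orb_in[OF d0, of 0] by (simp add: b_def orbit_map_of)
  next
    case False
    have "weight (orbit_map (b i)) = int (orb i 0) - sc i * int (orb 0 0)"
      using False orb_in[OF that, of 0] orb_in[OF d0, of 0]
      by (simp add: b_def e_def orbit_map_def frag_extend_add frag_extend_cmul weight_maps)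
    also have "\<dots> = int (orb i 0) * (1 - int (orb 0 0 * z))" by (simp add: sc_def algebra_simps)
    finally have "int p dvd weight (orbit_map (b i))"
      using z by (metis cong_iff_dvd_diff cong_int_iff cong_sym dvd_mult of_nat_1)
    then show ?thesis using False by (simp add: cong_0_iff)
  qed
  have weight: "[weight (orbit_map (lin Z3 b v)) = int (orb 0 0) * block_weight v] (mod int p)" if "v \<in> Fr Z3 {..<d}" for v
    using that
  proof (induction rule: Fr_induct)
    case zero
    then show ?case by (simp add: orbit_map_def block_weight_def weight_maps)
  next
    case (one i j)
    have "block_weight (frag_of (i, j)) = (if i = 0 then int \<beta>^j else 0)"
      using one by (auto simp: block_weight_def lookup_single when_def elim!: less_3_cases)
    moreover have "[weight (orbit_map (tr Z3 j (b i))) = int \<beta>^j * (if i = 0 then int (orb 0 0) else 0)] (mod int p)"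
      using one by (intro cong_trans[OF shift[OF bI] cong_scalar_left[OF wb]]) auto
    ultimately show ?case by (auto simp: mult.commute)
  next
    case (diff u v)
    then show ?case using cong_diff[OF diff.IH]
      by (simp add: lin_diff orbit_map_def frag_extend_diff weight_maps block_weight_def lookup_minus algebra_simps)
  qed
  have dvd: "int p dvd weight (orbit_map (lin Z3 b v)) \<longleftrightarrow> int p dvd block_weight v" if "v \<in> Fr Z3 {..<d}" for v
  proof -
    have "coprime (int p) (int (orb 0 0))" using \<open>coprime (orb 0 0) p\<close> by (simp add: coprime_commute)
    then show ?thesis
      using cong_dvd_iff[OF weight[OF that]] by (simp add: coprime_dvd_mult_right_iff)
  qed
  have "equivariant_iso (lin Z3 b) {v \<in> Fr Z3 {..<d}. int p dvd block_weight v} (tr Z3 1)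
      {v \<in> Fr Z3 {..<d}. int p dvd weight (orbit_map v)} (+) (tr Z3 1)"
    unfolding equivariant_iso_def
  proof (intro conjI ballI)
    have bij: "bij_betw (lin Z3 b) (Fr Z3 {..<d}) (Fr Z3 {..<d})" using basis by (simp add: is_basis_def)
    show "bij_betw (lin Z3 b) {v \<in> Fr Z3 {..<d}. int p dvd block_weight v} {v \<in> Fr Z3 {..<d}. int p dvd weight (orbit_map v)}"
      unfolding bij_betw_def
    proof
      show "inj_on (lin Z3 b) {v \<in> Fr Z3 {..<d}. int p dvd block_weight v}"
        using bij by (auto simp: bij_betw_def intro: inj_on_subset)
      show "lin Z3 b ` {v \<in> Fr Z3 {..<d}. int p dvd block_weight v} = {v \<in> Fr Z3 {..<d}. int p dvd weight (orbit_map v)}"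
      proof (intro equalityI subsetI)
        fix w assume w: "w \<in> {v \<in> Fr Z3 {..<d}. int p dvd weight (orbit_map v)}"
        then obtain v where "v \<in> Fr Z3 {..<d}" "w = lin Z3 b v"
          using Z3.basis_span[OF basis] by auto
        then show "w \<in> lin Z3 b ` {v \<in> Fr Z3 {..<d}. int p dvd block_weight v}" using w dvd by auto
      qed (use bI dvd in \<open>auto intro: Z3.lin_in\<close>)
    qed
    show "lin Z3 b (u + v) = lin Z3 b u + lin Z3 b v" for u v by (rule lin_add)
    show "lin Z3 b (tr Z3 1 u) = tr Z3 1 (lin Z3 b u)" if "u \<in> {v \<in> Fr Z3 {..<d}. int p dvd block_weight v}" for u
      using that bI by (intro Z3.lin_tr[where A = "{..<d}" and I = "{..<d}"]) auto
  qed
  then show ?thesis by blast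
qed

text \<open>
  The second step: the ideal of the elements that vanish at \<open>\<beta>\<close> modulo \<open>p\<close> is principal. A
  solution of \<open>a\<^sup>2 - ab + b\<^sup>2 = p\<close> gives an element \<open>a + b y\<close> whose image in \<open>\<int>[\<omega>]\<close> has norm \<open>p\<close>;
  adding a multiple of \<open>1 + y + y\<^sup>2\<close>, which does not change that image, makes the augmentation
  \<open>\<plusminus>1\<close> and the norm in \<open>\<int>[H]\<close> equal to \<open>\<plusminus>p\<close>.
\<close>

lemma principal_block:
  "\<exists>f. equivariant_iso f (Fr Z3 {..<d}) (tr Z3 1) {v \<in> Fr Z3 {..<d}. int p dvd block_weight v} (+) (tr Z3 1)"
proof -
  have d0: "0 < d" using p_gt by simp
  have \<omega>: "int p dvd 1 + int \<beta> + (int \<beta>)^2"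
    using \<beta>_sum by (metis int_dvd_int_iff of_nat_1 of_nat_add of_nat_power)
  have "prime (int p)" "odd (int p)" using prime_p p_gt prime_odd_nat[of p] by auto
  then obtain a b where ab: "a^2 - a * b + b^2 = int p" "int p dvd a + b * int \<beta>"
    using norm_form[OF _ _ \<omega>] by blast
  have "\<exists>c e. a + b + 3 * c = e \<and> e * e = 1"
  proof -
    have "(a + b)^2 = int p + 3 * (a * b)" using ab(1) by (simp add: power2_eq_square algebra_simps)
    then have "(a + b)^2 mod 3 = 1" by (simp add: p_eq)
    moreover have "(a + b) mod 3 = 0 \<or> (a + b) mod 3 = 1 \<or> (a + b) mod 3 = 2" by presburger
    ultimately have "(a + b) mod 3 = 1 \<or> (a + b) mod 3 = 2"
      by (auto simp: power2_eq_square mod_mult_eq[symmetric, of "a + b"])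
    then show ?thesis
    proof
      assume "(a + b) mod 3 = 1"
      then show ?thesis by (intro exI[of _ "- ((a + b) div 3)"] exI[of _ 1]) presburger
    next
      assume "(a + b) mod 3 = 2"
      then show ?thesis by (intro exI[of _ "- ((a + b) div 3) - 1"] exI[of _ "-1"]) presburger
    qed
  qed
  then obtain c e where ce: "a + b + 3 * c = e" "e * e = 1" by blast
  define u0 u1 u2 where "u0 = a + c" and "u1 = b + c" and "u2 = c"
  have det: "u0^3 + u1^3 + u2^3 - 3 * u0 * u1 * u2 = e * int p"
    unfolding ab(1)[symmetric] ce(1)[symmetric] u0_def u1_def u2_def
    by (simp add: power2_eq_square power3_eq_cube algebra_simps)
  have uw: "int p dvd u0 + u1 * int \<beta> + u2 * int \<beta>^2"
  proof -
    have "u0 + u1 * int \<beta> + u2 * int \<beta>^2 = (a + b * int \<beta>) + c * (1 + int \<beta> + (int \<beta>)^2)"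
      by (simp add: u0_def u1_def u2_def algebra_simps)
    then show ?thesis using ab(2) \<omega> by (metis dvd_add dvd_mult)
  qed
  define u :: "nat \<times> nat \<Rightarrow>\<^sub>0 int" where
    "u = frag_cmul u0 (frag_of (0, 0)) + frag_cmul u1 (frag_of (0, Suc 0)) + frag_cmul u2 (frag_of (0, 2))"
  define t where "t i = (if i = 0 then u else frag_of (i, 0))" for i :: nat
  have tI: "t i \<in> Fr Z3 {..<d}" if "i < d" for i
    using that by (auto simp: t_def u_def Fr_def intro!: frags_add frags_cmul)
  define f where "f = lin Z3 t"
  have f_in: "f v \<in> Fr Z3 {..<d}" if "v \<in> Fr Z3 {..<d}" for v
    unfolding f_def using that tI by (intro Z3.lin_in) auto
  have cf_f: "(\<forall>i j. i \<noteq> 0 \<longrightarrow> cf (f v) (i, j) = cf v (i, j)) \<and>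
      cf (f v) (0, 0) = cf v (0, 0) * u0 + cf v (0, Suc 0) * u2 + cf v (0, 2) * u1 \<and>
      cf (f v) (0, Suc 0) = cf v (0, 0) * u1 + cf v (0, Suc 0) * u0 + cf v (0, 2) * u2 \<and>
      cf (f v) (0, 2) = cf v (0, 0) * u2 + cf v (0, Suc 0) * u1 + cf v (0, 2) * u0"
    if "v \<in> Fr Z3 {..<d}" for v
    using that
  proof (induction rule: Fr_induct)
    case (one i j)
    then have "j < 3" by simp
    then show ?case
      by (elim less_3_cases; cases "i = 0")
         (simp_all add: f_def t_def u_def tr_add lookup_add lookup_single when_def
            frag_extend_cmul[of "\<lambda>(i, g). frag_of (i, g \<otimes>\<^bsub>Z3\<^esub> _)", folded tr_def])
  qed (auto simp: f_def lin_diff lookup_minus algebra_simps)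
  have zero: "v = 0" if v: "v \<in> Fr Z3 {..<d}" "f v = 0" for v
  proof -
    have "cf v (0, 0) = 0 \<and> cf v (0, Suc 0) = 0 \<and> cf v (0, 2) = 0"
      using cf_f[OF v(1)] det ce(2) p_gt v(2) by (intro circulant_injective[of _ u0 _ u2 _ u1]) auto
    then have "cf v (0, j) = 0" if "j < 3" for j using that by (elim less_3_cases) simp_all
    moreover have "cf v (i, j) = 0" if "i \<noteq> 0" for i j using cf_f[OF v(1)] v(2) that by auto
    moreover have "cf v (i, j) = 0" if "\<not> j < 3" for i j
      using v(1) that unfolding Fr_def by (intro frags_lookup) auto
    ultimately show ?thesis by (intro poly_mapping_eqI) (metis surj_pair lookup_zero)
  qed
  have "equivariant_iso f (Fr Z3 {..<d}) (tr Z3 1) {v \<in> Fr Z3 {..<d}. int p dvd block_weight v} (+) (tr Z3 1)"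
    unfolding equivariant_iso_def
  proof (intro conjI ballI)
    show "f (v + w) = f v + f w" for v w by (simp add: f_def lin_add)
    show "f (tr Z3 1 v) = tr Z3 1 (f v)" if "v \<in> Fr Z3 {..<d}" for v
      unfolding f_def using that tI by (intro Z3.lin_tr[where A = "{..<d}" and I = "{..<d}"]) auto
    have inj: "inj_on f (Fr Z3 {..<d})"
    proof (rule inj_onI)
      fix v w assume *: "v \<in> Fr Z3 {..<d}" "w \<in> Fr Z3 {..<d}" "f v = f w"
      then have "v - w = 0" using zero[of "v - w"] by (auto simp: Fr_diff f_def lin_diff)
      then show "v = w" by simp
    qed
    have "int p dvd block_weight (f v)" if "v \<in> Fr Z3 {..<d}" for v
    proof -
      have \<beta>3': "int p dvd int \<beta>^3 - 1"
        using \<beta>3 by (metis cong_iff_dvd_diff cong_int_iff of_nat_1 of_nat_power)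
      have "block_weight (f v) = (u0 + u1 * int \<beta> + u2 * int \<beta>^2) * (cf v (0, 0) + cf v (0, Suc 0) * int \<beta> + cf v (0, 2) * int \<beta>^2)
         - (int \<beta>^3 - 1) * (cf v (0, Suc 0) * u2 + cf v (0, 2) * u1 + cf v (0, 2) * u2 * int \<beta>)"
        using cf_f[OF that] unfolding block_weight_def
        by (simp add: power2_eq_square power3_eq_cube algebra_simps)
      then show ?thesis using uw \<beta>3' by (metis dvd_diff dvd_mult2)
    qed
    moreover have "\<exists>w\<in>Fr Z3 {..<d}. f w = v" if v: "v \<in> Fr Z3 {..<d}" "int p dvd block_weight v" for v
    proof -
      obtain a0 a1 a2 where a: "a0 * u0 + a1 * u2 + a2 * u1 = cf v (0, 0)"
        "a0 * u1 + a1 * u0 + a2 * u2 = cf v (0, Suc 0)" "a0 * u2 + a1 * u1 + a2 * u0 = cf v (0, 2)"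
        using circulant_solve[OF \<omega> uw _ det ce(2), of "cf v (0, 0)" "cf v (0, Suc 0)" "cf v (0, 2)"] v(2) p_gt
        unfolding block_weight_def by auto
      let ?e = "\<lambda>j. frag_of (0::nat, j) :: nat \<times> nat \<Rightarrow>\<^sub>0 int"
      define w where "w = v + frag_cmul (a0 - cf v (0, 0)) (?e 0)
        + frag_cmul (a1 - cf v (0, Suc 0)) (?e (Suc 0)) + frag_cmul (a2 - cf v (0, 2)) (?e 2)"
      have w: "w \<in> Fr Z3 {..<d}"
        using v(1) d0 by (auto simp: w_def Fr_def intro!: frags_add frags_cmul)
      have cw: "cf w (0, 0) = a0" "cf w (0, Suc 0) = a1" "cf w (0, 2) = a2" "i \<noteq> 0 \<Longrightarrow> cf w (i, j) = cf v (i, j)" for i j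
        by (simp_all add: w_def lookup_add lookup_single)
      have "f w = v"
      proof (rule poly_mapping_eqI)
        fix ij :: "nat \<times> nat"
        obtain i j where ij: "ij = (i, j)" by force
        show "cf (f w) ij = cf v ij"
        proof (cases "i = 0 \<and> j < 3")
          case True
          have "cf (f w) (0, 0) = cf v (0, 0)" "cf (f w) (0, Suc 0) = cf v (0, Suc 0)" "cf (f w) (0, 2) = cf v (0, 2)"
            using cf_f[OF w] by (simp_all only: cw(1-3) a)
          moreover have "j < 3" "i = 0" using True by auto
          ultimately show ?thesis unfolding ij by (elim less_3_cases) (simp_all only:)
        next
          case False
          then consider "i \<noteq> 0" | "\<not> j < 3" by auto
          then show ?thesis
          proof cases
            case 1 then show ?thesis using cf_f[OF w] cw ij by simp
          next
            case 2
            then have "(i, j) \<notin> {..<d} \<times> carrier Z3" by simp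
            then show ?thesis using f_in[OF w] v(1) unfolding Fr_def ij by (metis frags_lookup)
          qed
        qed
      qed
      with w show ?thesis by blast
    qed
    ultimately show "bij_betw f (Fr Z3 {..<d}) {v \<in> Fr Z3 {..<d}. int p dvd block_weight v}"
      unfolding bij_betw_def using inj f_in by blast
  qed
  then show ?thesis by blast
qed

lemma c3_free_R2: assumes "is_R p \<alpha> 2 M" shows "\<exists>\<epsilon>. c3_free M d \<epsilon>"
proof -
  let ?L = "{c \<in> PL. coeff_sum c = 0 \<and> int p dvd weight c}"
  have "is_bar p \<alpha> (ideal_rmod (Lam0 p \<alpha>) (embed ` ?L)) (conj_y p \<alpha>) M"
    using assms by (simp add: is_R_def xm1_I_C_eq)
  moreover have "int p dvd weight (shift_y c)" if "c \<in> PL" "int p dvd weight c" for c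
    using weight_shift_y[OF that(1)] that(2) by (metis cong_0_iff cong_scalar_left cong_trans mult_zero_right)
  ultimately obtain \<psi> where \<psi>: "equivariant_iso \<psi> ?L shift_y (carrier M) (ring.add M) (\<lambda>m. m \<star>\<^bsub>M\<^esub> frag_of y)"
    using bar_ideal[of ?L M] by (auto simp: frags_add coeff_sum_maps coeff_sum_shift_y shift_y_in weight_maps)
  have augment_zero: "equivariant_iso augment_zero {u \<in> frags \<Omega>. int p dvd weight u} shift_y ?L (+) shift_y"
    by (rule augment_zero_iso) (use p_gt in \<open>simp add: augment_zero_def weight_maps\<close>)
  have O: "equivariant_iso orbit_map {v \<in> Fr Z3 {..<d}. int p dvd weight (orbit_map v)} (tr Z3 1) {u \<in> frags \<Omega>. int p dvd weight u} (+) shift_y"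
    using orbit_map_iso unfolding equivariant_iso_def
    by (auto simp: bij_betw_def image_iff intro: inj_on_subset)
  obtain f g where f: "equivariant_iso f (Fr Z3 {..<d}) (tr Z3 1) {v \<in> Fr Z3 {..<d}. int p dvd block_weight v} (+) (tr Z3 1)"
    and g: "equivariant_iso g {v \<in> Fr Z3 {..<d}. int p dvd block_weight v} (tr Z3 1)
      {v \<in> Fr Z3 {..<d}. int p dvd weight (orbit_map v)} (+) (tr Z3 1)"
    using principal_block weight_block by blast
  from equivariant_iso_comp[OF equivariant_iso_comp[OF equivariant_iso_comp[OF equivariant_iso_comp[OF f g] O] augment_zero] \<psi>]
  show ?thesis unfolding c3_free_def by blast
qed

lemma embed_norm_elt: "embed norm_elt = Sigma_x p \<alpha>"
  by (simp add: Sigma_x_def norm_elt_def embed_def frag_extend_sum o_def x_pow_el)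

lemma of_mult_norm_elt: "frag_of (el 0 n) \<otimes>\<^bsub>Lam0 p \<alpha>\<^esub> embed norm_elt = embed norm_elt"
proof -
  have step: "frag_of (el 0 (Suc n)) \<otimes>\<^bsub>Lam0 p \<alpha>\<^esub> embed c = frag_of (el 0 n) \<otimes>\<^bsub>Lam0 p \<alpha>\<^esub> embed (shift_x c)" if "c \<in> PL" for c n
    unfolding Lam0_def group_ring_of_mult using that
  proof (induction rule: frags_induct)
    case (one a)
    have "el 0 (Suc n) \<cdot> el 0 a = el 0 n \<cdot> el 0 (Suc a)"
      using el_x_pow[of 0 "Suc n" a] el_x_pow[of 0 n "Suc a"] by (simp only: x_pow_el add_Suc add_Suc_right)
    then show ?case by (simp add: el_mod)
  qed (auto simp: additive_maps frag_extend_diff)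
  show ?thesis
  proof (induction n)
    case 0
    have "embed norm_elt \<in> frags (carrier G)"
      unfolding embed_def using norm_elt_in by (rule frag_extend_in_frags) simp
    then show ?case unfolding Lam0_def group_ring_of_mult by (intro frag_extend_id) (auto simp: el_00)
  next
    case (Suc n)
    then show ?case using step[OF norm_elt_in, of n] by (simp add: shift_x_norm_elt)
  qed
qed

lemma mult_norm_elt: "c \<in> PL \<Longrightarrow> embed c \<otimes>\<^bsub>Lam0 p \<alpha>\<^esub> embed norm_elt = frag_cmul (coeff_sum c) (embed norm_elt)"
proof (induction rule: frags_induct)
  case zero
  then show ?case by (simp add: Lam0_def group_ring_mult coeff_sum_maps)
next
  case (one a)
  then show ?case by (simp add: of_mult_norm_elt)
next
  case (diff a b)
  then show ?case
    by (simp add: additive_maps coeff_sum_maps frag_cmul_diff_distrib Lam0_def group_ring_diff_left)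
qed

text \<open>
  The coset of \<open>u\<close> modulo the ideal generated by \<open>\<Sigma>\<^sub>x\<close>, which is \<open>\<int> \<Sigma>\<^sub>x\<close>.
\<close>

definition dual_coset :: "(nat \<Rightarrow>\<^sub>0 int) \<Rightarrow> lam set" where
  "dual_coset u = range (\<lambda>k. embed (u + frag_cmul k norm_elt))"

lemma PIdl_Sigma: "PIdl\<^bsub>Lam0 p \<alpha>\<^esub> (Sigma_x p \<alpha>) = dual_coset 0"
proof -
  have "PIdl\<^bsub>Lam0 p \<alpha>\<^esub> (Sigma_x p \<alpha>) = (\<lambda>c. embed c \<otimes>\<^bsub>Lam0 p \<alpha>\<^esub> embed norm_elt) ` PL"
  proof -
    have "carrier (Lam0 p \<alpha>) = embed ` PL" using bij_embed by (simp add: bij_betw_def)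
    then show ?thesis by (auto simp: cgenideal_def embed_norm_elt)
  qed
  also have "\<dots> = (\<lambda>c. frag_cmul (coeff_sum c) (embed norm_elt)) ` PL" by (intro image_cong mult_norm_elt refl)
  also have "\<dots> = range (\<lambda>k. frag_cmul k (embed norm_elt))"
  proof (intro equalityI subsetI)
    fix z assume "z \<in> range (\<lambda>k. frag_cmul k (embed norm_elt))"
    then obtain k where "z = frag_cmul k (embed norm_elt)" by auto
    then show "z \<in> (\<lambda>c. frag_cmul (coeff_sum c) (embed norm_elt)) ` PL"
      using p_gt by (intro image_eqI[where x = "frag_cmul k (frag_of 0)"]) (auto simp: coeff_sum_maps frags_cmul)
  qed auto
  finally show ?thesis by (simp add: dual_coset_def additive_maps)
qed

lemma coset_dual_coset: "dual_coset 0 +>\<^bsub>Lam0 p \<alpha>\<^esub> embed u = dual_coset u"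
  by (auto simp: a_r_coset_def r_coset_def dual_coset_def Lam0_def additive_maps image_iff add.commute)

lemma dual_coset_eq_iff:
  assumes "u \<in> PL" "v \<in> PL"
  shows "dual_coset u = dual_coset v \<longleftrightarrow> (\<exists>k. u - v = frag_cmul k norm_elt)"
proof
  assume "dual_coset u = dual_coset v"
  moreover have "embed u \<in> dual_coset u" unfolding dual_coset_def by (rule range_eqI[of _ _ 0]) simp
  ultimately obtain k where "embed u = embed (v + frag_cmul k norm_elt)" by (auto simp: dual_coset_def)
  then have "u = v + frag_cmul k norm_elt" using assms norm_elt_in by (simp add: embed_inj frags_add frags_cmul)
  then show "\<exists>k. u - v = frag_cmul k norm_elt" by auto
next
  assume "\<exists>k. u - v = frag_cmul k norm_elt"
  then obtain k where "u = v + frag_cmul k norm_elt" by (auto simp: algebra_simps)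
  then have "dual_coset u = range (\<lambda>l. embed (v + frag_cmul (k + l) norm_elt))"
    by (simp add: dual_coset_def frag_cmul_distrib add.assoc)
  also have "\<dots> = dual_coset v"
    unfolding dual_coset_def
  proof (intro equalityI subsetI)
    fix z assume "z \<in> range (\<lambda>l. embed (v + frag_cmul l norm_elt))"
    then obtain l where "z = embed (v + frag_cmul (k + (l - k)) norm_elt)" by auto
    then show "z \<in> range (\<lambda>l. embed (v + frag_cmul (k + l) norm_elt))" by blast
  qed auto
  finally show "dual_coset u = dual_coset v" .
qed

lemma dual_carrier: "carrier (I_C_dual p \<alpha>) = dual_coset ` PL"
proof -
  have "a_rcosets\<^bsub>Lam0 p \<alpha>\<^esub> dual_coset 0 = (\<lambda>a. dual_coset 0 +>\<^bsub>Lam0 p \<alpha>\<^esub> a) ` carrier (Lam0 p \<alpha>)"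
    by (auto simp: A_RCOSETS_def RCOSETS_def a_r_coset_def)
  also have "carrier (Lam0 p \<alpha>) = embed ` PL" using bij_embed by (simp add: bij_betw_def)
  finally show ?thesis
    by (simp add: I_C_dual_def quot_rmod_def FactRing_def PIdl_Sigma image_image coset_dual_coset)
qed

lemma dual_add: "dual_coset u \<oplus>\<^bsub>I_C_dual p \<alpha>\<^esub> dual_coset v = dual_coset (u + v)"
proof -
  have "dual_coset u \<oplus>\<^bsub>I_C_dual p \<alpha>\<^esub> dual_coset v = {a + b | a b. a \<in> dual_coset u \<and> b \<in> dual_coset v}"
    by (auto simp: I_C_dual_def quot_rmod_def FactRing_def set_add_def set_mult_def Lam0_def)
  also have "\<dots> = dual_coset (u + v)"
  proof (intro equalityI subsetI)
    fix z assume "z \<in> {a + b | a b. a \<in> dual_coset u \<and> b \<in> dual_coset v}"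
    then obtain k l where "z = embed (u + frag_cmul k norm_elt) + embed (v + frag_cmul l norm_elt)" by (auto simp: dual_coset_def)
    then have "z = embed (u + v + frag_cmul (k + l) norm_elt)" by (simp add: additive_maps frag_cmul_distrib)
    then show "z \<in> dual_coset (u + v)" by (auto simp: dual_coset_def)
  next
    fix z assume "z \<in> dual_coset (u + v)"
    then obtain k where "z = embed (u + v + frag_cmul k norm_elt)" by (auto simp: dual_coset_def)
    then have "z = embed (u + frag_cmul k norm_elt) + embed (v + frag_cmul 0 norm_elt)" by (simp add: additive_maps)
    then show "z \<in> {a + b | a b. a \<in> dual_coset u \<and> b \<in> dual_coset v}" unfolding dual_coset_def by blast
  qed
  finally show ?thesis .
qed

lemma dual_x: assumes u: "u \<in> PL" shows "dual_coset u \<star>\<^bsub>I_C_dual p \<alpha>\<^esub> frag_of x = dual_coset (shift_x u)"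
proof -
  have one: "1 < p" using p_gt by simp
  have x: "frag_of x = embed (frag_of 1)" using x_pow_el[of 1] by simp
  have prod: "dual_coset 0 +>\<^bsub>Lam0 p \<alpha>\<^esub> (a \<otimes>\<^bsub>Lam0 p \<alpha>\<^esub> b) = dual_coset (shift_x u)"
    if ab0: "a \<in> dual_coset u" "b \<in> dual_coset (frag_of 1)" for a b
  proof -
    obtain k l where "a = embed (u + frag_cmul k norm_elt)" "b = embed (frag_of 1 + frag_cmul l norm_elt)"
      using ab0 by (auto simp: dual_coset_def)
    then have ab: "a = embed (u + frag_cmul k norm_elt)" "b = frag_of x + frag_cmul l (embed norm_elt)"
      unfolding x by (simp_all only: additive_maps)
    have uk: "u + frag_cmul k norm_elt \<in> PL" using u norm_elt_in by (intro frags_add frags_cmul)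
    have "a \<otimes>\<^bsub>Lam0 p \<alpha>\<^esub> b = rmul G x a + frag_cmul l (a \<otimes>\<^bsub>Lam0 p \<alpha>\<^esub> embed norm_elt)"
      unfolding ab(2) by (simp add: Lam0_def group_ring_add_right group_ring_cmul_right group_ring_mult_of rmul_def)
    also have "rmul G x a = embed (shift_x (u + frag_cmul k norm_elt))" unfolding ab(1) using embed_shift_x[OF uk] by simp
    also have "a \<otimes>\<^bsub>Lam0 p \<alpha>\<^esub> embed norm_elt = frag_cmul (coeff_sum (u + frag_cmul k norm_elt)) (embed norm_elt)"
      unfolding ab(1) by (rule mult_norm_elt[OF uk])
    finally have "a \<otimes>\<^bsub>Lam0 p \<alpha>\<^esub> b = embed (shift_x u + frag_cmul (k + l * coeff_sum (u + frag_cmul k norm_elt)) norm_elt)"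
      by (simp add: additive_maps shift_x_norm_elt frag_cmul_distrib)
    then have "dual_coset 0 +>\<^bsub>Lam0 p \<alpha>\<^esub> (a \<otimes>\<^bsub>Lam0 p \<alpha>\<^esub> b) = dual_coset (shift_x u + frag_cmul (k + l * coeff_sum (u + frag_cmul k norm_elt)) norm_elt)"
      by (simp add: coset_dual_coset)
    also have "\<dots> = dual_coset (shift_x u)"
      using u norm_elt_in by (subst dual_coset_eq_iff) (auto intro!: frags_add frags_cmul shift_x_in)
    finally show ?thesis .
  qed
  have "dual_coset u \<star>\<^bsub>I_C_dual p \<alpha>\<^esub> frag_of x = (\<Union>a\<in>dual_coset u. \<Union>b\<in>dual_coset (frag_of 1). dual_coset 0 +>\<^bsub>Lam0 p \<alpha>\<^esub> (a \<otimes>\<^bsub>Lam0 p \<alpha>\<^esub> b))"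
  proof -
    have "dual_coset 0 +>\<^bsub>Lam0 p \<alpha>\<^esub> frag_of x = dual_coset (frag_of 1)" unfolding x by (rule coset_dual_coset)
    then show ?thesis
      by (simp only: I_C_dual_def quot_rmod_def FactRing_def rcoset_mult_def PIdl_Sigma rmod.simps ring.simps monoid.simps)
  qed
  also have "\<dots> = (\<Union>a\<in>dual_coset u. \<Union>b\<in>dual_coset (frag_of 1). dual_coset (shift_x u))"
    by (intro SUP_cong refl prod)
  also have "\<dots> = dual_coset (shift_x u)" by (auto simp: dual_coset_def)
  finally show ?thesis .
qed

lemma dual_y: assumes u: "u \<in> PL" shows "conj_y p \<alpha> ` dual_coset u = dual_coset (shift_y u)"
proof -
  have "conj_y p \<alpha> (embed (u + frag_cmul k norm_elt)) = embed (shift_y u + frag_cmul k norm_elt)" for k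
    using embed_shift_y[of "u + frag_cmul k norm_elt"] u norm_elt_in
    by (simp add: frags_add frags_cmul additive_maps shift_y_norm_elt)
  then show ?thesis by (simp add: dual_coset_def image_image)
qed

text \<open>
  \<open>M\<close> is the quotient of \<open>\<int>[H\G]\<close> by the invariants \<open>\<int> \<Sigma>\<^sub>x\<close>.
\<close>

definition P_quotient :: "(lam, 'm) rmod \<Rightarrow> ((nat \<Rightarrow>\<^sub>0 int) \<Rightarrow> 'm) \<Rightarrow> bool" where
  "P_quotient M \<psi> \<longleftrightarrow> \<psi> ` PL = carrier M \<and>
    (\<forall>u\<in>PL. \<forall>v\<in>PL. \<psi> (u + v) = \<psi> u \<oplus>\<^bsub>M\<^esub> \<psi> v) \<and>
    (\<forall>u\<in>PL. \<forall>v\<in>PL. \<psi> u = \<psi> v \<longleftrightarrow> (\<exists>k. u - v = frag_cmul k norm_elt)) \<and>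
    (\<forall>u\<in>PL. \<psi> (shift_x u) = \<psi> u \<star>\<^bsub>M\<^esub> frag_of x) \<and> (\<forall>u\<in>PL. \<psi> (shift_y u) = \<psi> u \<star>\<^bsub>M\<^esub> frag_of y)"

lemma P_quotientD:
  assumes "P_quotient M \<psi>"
  shows "\<psi> ` PL = carrier M"
    "\<And>u v. u \<in> PL \<Longrightarrow> v \<in> PL \<Longrightarrow> \<psi> (u + v) = \<psi> u \<oplus>\<^bsub>M\<^esub> \<psi> v"
    "\<And>u v. u \<in> PL \<Longrightarrow> v \<in> PL \<Longrightarrow> \<psi> u = \<psi> v \<longleftrightarrow> (\<exists>k. u - v = frag_cmul k norm_elt)"
    "\<And>u. u \<in> PL \<Longrightarrow> \<psi> (shift_x u) = \<psi> u \<star>\<^bsub>M\<^esub> frag_of x"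
    "\<And>u. u \<in> PL \<Longrightarrow> \<psi> (shift_y u) = \<psi> u \<star>\<^bsub>M\<^esub> frag_of y"
  using assms unfolding P_quotient_def by simp_all

lemma R3_quotient:
  assumes "is_R p \<alpha> 3 M"
  shows "\<exists>\<psi>. P_quotient M \<psi>"
proof -
  obtain \<phi> where M: "right_module (Lam p \<alpha>) M" and hom: "\<phi> \<in> rmod_hom (Lam0 p \<alpha>) M (I_C_dual p \<alpha>)"
    and bij: "bij_betw \<phi> (carrier M) (dual_coset ` PL)"
    and y: "\<And>m. m \<in> carrier M \<Longrightarrow> \<phi> (m \<star>\<^bsub>M\<^esub> frag_of y) = conj_y p \<alpha> ` (\<phi> m)"
    using assms unfolding is_R_def is_bar_def dual_carrier by auto
  interpret M: right_module "Lam p \<alpha>" M by (rule M)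
  have "frag_of x \<in> carrier (Lam0 p \<alpha>)"
    using embed_in[of "frag_of 1"] x_pow_el[of 1] p_gt by simp
  then have x: "\<phi> (m \<star>\<^bsub>M\<^esub> frag_of x) = \<phi> m \<star>\<^bsub>I_C_dual p \<alpha>\<^esub> frag_of x" if "m \<in> carrier M" for m
    using hom that unfolding rmod_hom_def by simp
  have add: "\<phi> (m \<oplus>\<^bsub>M\<^esub> n) = \<phi> m \<oplus>\<^bsub>I_C_dual p \<alpha>\<^esub> \<phi> n"
    if "m \<in> carrier M" "n \<in> carrier M" for m n
    using hom that unfolding rmod_hom_def by simp
  have inj: "inj_on \<phi> (carrier M)" using bij by (simp add: bij_betw_def)
  define \<psi> where "\<psi> u = the_inv_into (carrier M) \<phi> (dual_coset u)" for u
  have img: "\<phi> ` carrier M = dual_coset ` PL" using bij by (simp add: bij_betw_def)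
  have \<phi>\<psi>: "\<phi> (\<psi> u) = dual_coset u" and \<psi>_in: "\<psi> u \<in> carrier M" if "u \<in> PL" for u
  proof -
    have "dual_coset u \<in> \<phi> ` carrier M" using that img by simp
    then show "\<phi> (\<psi> u) = dual_coset u" "\<psi> u \<in> carrier M"
      unfolding \<psi>_def by (rule f_the_inv_into_f[OF inj], rule the_inv_into_into[OF inj _ order_refl])
  qed
  have "\<psi> ` PL = carrier M"
  proof (intro equalityI subsetI)
    fix m assume m: "m \<in> carrier M"
    then obtain u where "u \<in> PL" "\<phi> m = dual_coset u" using bij unfolding bij_betw_def by blast
    then have "m = \<psi> u" using the_inv_into_f_f[OF inj m] by (simp add: \<psi>_def)
    then show "m \<in> \<psi> ` PL" using \<open>u \<in> PL\<close> by blast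
  qed (use \<psi>_in in auto)
  moreover have "\<psi> (u + v) = \<psi> u \<oplus>\<^bsub>M\<^esub> \<psi> v" if "u \<in> PL" "v \<in> PL" for u v
    using that by (intro inj_onD[OF inj]) (simp_all add: add \<phi>\<psi> \<psi>_in dual_add frags_add)
  moreover have "\<psi> u = \<psi> v \<longleftrightarrow> (\<exists>k. u - v = frag_cmul k norm_elt)" if "u \<in> PL" "v \<in> PL" for u v
    using dual_coset_eq_iff[OF that] \<phi>\<psi> that by (metis \<psi>_def)
  moreover have "\<psi> (shift_x u) = \<psi> u \<star>\<^bsub>M\<^esub> frag_of x" if "u \<in> PL" for u
    using that by (intro inj_onD[OF inj])
      (simp_all add: x \<phi>\<psi> \<psi>_in dual_x shift_x_in M.ract_closed frag_of_Lam)
  moreover have "\<psi> (shift_y u) = \<psi> u \<star>\<^bsub>M\<^esub> frag_of y" if "u \<in> PL" for u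
    using that by (intro inj_onD[OF inj])
      (simp_all add: y \<phi>\<psi> \<psi>_in dual_y shift_y_in M.ract_closed frag_of_Lam)
  ultimately have "P_quotient M \<psi>" unfolding P_quotient_def by simp
  then show ?thesis by (intro exI[of _ \<psi>])
qed

lemma c3_free_R3: assumes "is_R p \<alpha> 3 M" shows "\<exists>\<epsilon>. c3_free M d \<epsilon>"
proof -
  obtain \<psi> where "P_quotient M \<psi>" using R3_quotient[OF assms] by (rule exE)
  note \<psi> = P_quotientD[OF this]
  have "equivariant_iso \<psi> (frags \<Omega>) shift_y (carrier M) (ring.add M) (\<lambda>m. m \<star>\<^bsub>M\<^esub> frag_of y)"
    unfolding equivariant_iso_def
  proof (intro conjI ballI)
    have inj: "inj_on \<psi> (frags \<Omega>)"
    proof (rule inj_onI)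
      fix u v assume *: "u \<in> frags \<Omega>" "v \<in> frags \<Omega>" "\<psi> u = \<psi> v"
      then obtain k where k: "u - v = frag_cmul k norm_elt" using \<psi>(3)[of u v] \<Omega>_PL by blast
      have "cf (u - v) 0 = 0" using frags_diff[OF *(1,2)] by (rule frags_lookup) simp
      then have "k = 0" using p_gt by (simp add: k cf_norm_elt)
      then show "u = v" using k by simp
    qed
    have "\<psi> ` frags \<Omega> = carrier M"
    proof (intro equalityI subsetI)
      fix m assume "m \<in> carrier M"
      then obtain u where u: "u \<in> PL" "m = \<psi> u" using \<psi>(1) by blast
      define v where "v = u - frag_cmul (cf u 0) norm_elt"
      have v: "v \<in> PL" unfolding v_def using u(1) norm_elt_in by (intro frags_diff frags_cmul)
      have "cf v 0 = 0" using p_gt by (simp add: v_def lookup_minus cf_norm_elt)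
      then have "v \<in> frags \<Omega>" using v unfolding frags_def
        by (auto simp: in_keys_iff subset_iff) (metis One_nat_def Suc_leI gr0I)
      moreover have "\<psi> u = \<psi> v" using \<psi>(3)[OF u(1) v] by (auto simp: v_def)
      ultimately show "m \<in> \<psi> ` frags \<Omega>" using u by blast
    qed (use \<psi>(1) \<Omega>_PL in blast)
    with inj show "bij_betw \<psi> (frags \<Omega>) (carrier M)" by (simp add: bij_betw_def)
  next
    show "\<psi> (u + v) = \<psi> u \<oplus>\<^bsub>M\<^esub> \<psi> v" if "u \<in> frags \<Omega>" "v \<in> frags \<Omega>" for u v
      by (rule \<psi>(2)[OF subsetD[OF \<Omega>_PL that(1)] subsetD[OF \<Omega>_PL that(2)]])
    show "\<psi> (shift_y u) = \<psi> u \<star>\<^bsub>M\<^esub> frag_of y" if "u \<in> frags \<Omega>" for u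
      by (rule \<psi>(5)[OF subsetD[OF \<Omega>_PL that]])
  qed
  from equivariant_iso_comp[OF orbit_map_iso this] show ?thesis unfolding c3_free_def by blast
qed

subsection \<open>The kernels K(i)\<close>

text \<open>
  As a module over the group ring of \<open>\<langle>y\<rangle>\<close>, the ring \<open>\<Lambda>\<close> is free on the powers of \<open>x\<close>.
\<close>

definition coset_coords :: "(nat \<times> nat \<Rightarrow>\<^sub>0 int) \<Rightarrow> lam" where
  "coset_coords = frag_extend (\<lambda>aj. frag_of (case aj of (a, j) \<Rightarrow> el 0 a \<cdot> y \<up> j))"

lemma coset_coords_iso: "equivariant_iso coset_coords (Fr Z3 {..<p}) (tr Z3 1) (carrier (Lam p \<alpha>)) (+) (rmul G y)"
  unfolding equivariant_iso_def
proof (intro conjI ballI)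
  let ?h = "\<lambda>(a, j). el 0 a \<cdot> y \<up> (j::nat)"
  have h: "?h (a, j) = el j (a * \<beta>^j)" for a j by (simp add: el_y_pow)
  have inj: "inj_on ?h ({..<p} \<times> {..<3})"
  proof (rule inj_onI)
    fix s t assume "s \<in> {..<p} \<times> {..<3}" "t \<in> {..<p} \<times> {..<3}" "?h s = ?h t"
    then obtain a j b k where *: "s = (a, j)" "t = (b, k)" "a < p" "b < p" "j < 3" "k < 3"
      "el j (a * \<beta>^j) = el k (b * \<beta>^k)" using h by (cases s; cases t) auto
    then have jk: "j = k" "[a * \<beta>^j = b * \<beta>^j] (mod p)" by (auto simp: el_eq_iff cong_def)
    have "coprime (\<beta>^j) p" using \<beta>_coprime by simp
    then have "[a = b] (mod p)" using jk(2) by (simp add: cong_mult_rcancel_nat)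
    then have "a = b" using * by (simp add: cong_def)
    then show "s = t" using * jk by simp
  qed
  have "?h ` ({..<p} \<times> {..<3}) = carrier G"
  proof (rule card_subset_eq[OF G.fin_carrier])
    show "?h ` ({..<p} \<times> {..<3}) \<subseteq> carrier G" by auto
    show "card (?h ` ({..<p} \<times> {..<3})) = card (carrier G)"
      using card_image[OF inj] bij_betw_same_card[OF bij_el] by simp
  qed
  with inj have "bij_betw ?h ({..<p} \<times> {..<3}) (carrier G)" by (simp add: bij_betw_def)
  then show "bij_betw coset_coords (Fr Z3 {..<p}) (carrier (Lam p \<alpha>))"
    unfolding coset_coords_def Fr_def carrier_Lam by (intro bij_frag_extend) simp
  show "coset_coords (u + v) = coset_coords u + coset_coords v" for u v by (simp add: coset_coords_def frag_extend_add)
  fix u assume "u \<in> Fr Z3 {..<p}"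
  then show "coset_coords (tr Z3 1 u) = rmul G y (coset_coords u)"
  proof (induction rule: Fr_induct)
    case (one a j)
    then show ?case using y_pow_mod[of "j + 1"] by (simp add: coset_coords_def G.m_assoc)
  qed (auto simp: coset_coords_def tr_diff frag_extend_diff rmul_diff)
qed

lemma regular_Lam [simp]: "carrier (regular_rmod (Lam p \<alpha>)) = carrier (Lam p \<alpha>)"
  "a \<oplus>\<^bsub>regular_rmod (Lam p \<alpha>)\<^esub> b = a + b" "a \<star>\<^bsub>regular_rmod (Lam p \<alpha>)\<^esub> frag_of g = rmul G g a"
  by (simp_all add: regular_rmod_def Lam_def group_ring_mult_of)

lemma short_exact_regular:
  assumes "short_exact (Lam p \<alpha>) K (regular_rmod (Lam p \<alpha>)) R f r"
  shows "right_module (Lam p \<alpha>) K" "right_module (Lam p \<alpha>) R" "inj_on f (carrier K)"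
    "\<And>m. m \<in> carrier K \<Longrightarrow> f m \<in> carrier (Lam p \<alpha>)"
    "\<And>m n. m \<in> carrier K \<Longrightarrow> n \<in> carrier K \<Longrightarrow> f (m \<oplus>\<^bsub>K\<^esub> n) = f m + f n"
    "\<And>m g. m \<in> carrier K \<Longrightarrow> g \<in> carrier G \<Longrightarrow> f (m \<star>\<^bsub>K\<^esub> frag_of g) = rmul G g (f m)"
    "f ` carrier K = {l \<in> carrier (Lam p \<alpha>). r l = \<zero>\<^bsub>R\<^esub>}"
    "r ` carrier (Lam p \<alpha>) = carrier R"
    "\<And>a b. a \<in> carrier (Lam p \<alpha>) \<Longrightarrow> b \<in> carrier (Lam p \<alpha>) \<Longrightarrow> r (a + b) = r a \<oplus>\<^bsub>R\<^esub> r b"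
    "\<And>a g. a \<in> carrier (Lam p \<alpha>) \<Longrightarrow> g \<in> carrier G \<Longrightarrow> r (rmul G g a) = r a \<star>\<^bsub>R\<^esub> frag_of g"
proof -
  let ?A = "regular_rmod (Lam p \<alpha>)"
  show "right_module (Lam p \<alpha>) K" "right_module (Lam p \<alpha>) R" "inj_on f (carrier K)"
    "f ` carrier K = {l \<in> carrier (Lam p \<alpha>). r l = \<zero>\<^bsub>R\<^esub>}" "r ` carrier (Lam p \<alpha>) = carrier R"
    using assms by (simp_all add: short_exact_def)
  have hom: "f \<in> rmod_hom (Lam p \<alpha>) K ?A" "r \<in> rmod_hom (Lam p \<alpha>) ?A R"
    using assms by (simp_all add: short_exact_def)
  show "f m \<in> carrier (Lam p \<alpha>)" if "m \<in> carrier K" for m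
    using hom(1) that unfolding rmod_hom_def by (simp add: Pi_iff)
  show "f (m \<oplus>\<^bsub>K\<^esub> n) = f m + f n" if "m \<in> carrier K" "n \<in> carrier K" for m n
    using hom(1) that unfolding rmod_hom_def by simp
  show "f (m \<star>\<^bsub>K\<^esub> frag_of g) = rmul G g (f m)" if "m \<in> carrier K" "g \<in> carrier G" for m g
    using hom(1) that frag_of_Lam[OF that(2)] unfolding rmod_hom_def by simp
  show "r (a + b) = r a \<oplus>\<^bsub>R\<^esub> r b" if "a \<in> carrier (Lam p \<alpha>)" "b \<in> carrier (Lam p \<alpha>)" for a b
    using hom(2) that unfolding rmod_hom_def by simp
  show "r (rmul G g a) = r a \<star>\<^bsub>R\<^esub> frag_of g" if "a \<in> carrier (Lam p \<alpha>)" "g \<in> carrier G" for a g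
  proof -
    have "\<forall>m\<in>carrier ?A. \<forall>s\<in>carrier (Lam p \<alpha>). r (m \<star>\<^bsub>?A\<^esub> s) = r m \<star>\<^bsub>R\<^esub> s"
      using hom(2) unfolding rmod_hom_def by (elim CollectE conjE)
    from bspec[OF bspec[OF this] frag_of_Lam[OF that(2)]] that show ?thesis by simp
  qed
qed

text \<open>
  The kernel of \<open>\<Lambda> \<rightarrow> R\<close> is free over the group ring of \<open>\<langle>y\<rangle>\<close>. The images of the \<open>\<pi>\<^sub>i\<close> form a
  basis of \<open>R\<close>, so there are no relations between them and only the free part remains of
  the splitting. The rank condition of the splitting is \<open>3d \<le> p\<close>.
\<close>

lemma c3_free_kernel:
  assumes K: "is_K p \<alpha> R K" and R: "c3_free R d \<epsilon>"
  shows "\<exists>\<epsilon>'. c3_free K (p - d) \<epsilon>'"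
proof -
  let ?A = "regular_rmod (Lam p \<alpha>)"
  obtain f g where "short_exact (Lam p \<alpha>) K ?A R f g" using K unfolding is_K_def by blast
  note E = short_exact_regular[OF this]
  note inj = E(3) and f_add = E(5) and ker = E(7) and sur = E(8) and g_add = E(9)
  interpret K: right_module "Lam p \<alpha>" K by (rule E(1))
  interpret R: right_module "Lam p \<alpha>" R by (rule E(2))
  have y_L: "frag_of y \<in> carrier (Lam p \<alpha>)" by (simp add: frag_of_Lam)
  have f_y: "f (m \<star>\<^bsub>K\<^esub> frag_of y) = rmul G y (f m)" if "m \<in> carrier K" for m
    using E(6) that by simp
  have g_y: "g (rmul G y a) = g a \<star>\<^bsub>R\<^esub> frag_of y" and g_in: "g a \<in> carrier R"
    if "a \<in> carrier (Lam p \<alpha>)" for a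
    using E(10) sur that by auto
  have \<epsilon>: "bij_betw \<epsilon> (Fr Z3 {..<d}) (carrier R)"
    "\<And>u v. u \<in> Fr Z3 {..<d} \<Longrightarrow> v \<in> Fr Z3 {..<d} \<Longrightarrow> \<epsilon> (u + v) = \<epsilon> u \<oplus>\<^bsub>R\<^esub> \<epsilon> v"
    "\<And>u. u \<in> Fr Z3 {..<d} \<Longrightarrow> \<epsilon> (tr Z3 1 u) = \<epsilon> u \<star>\<^bsub>R\<^esub> frag_of y"
    using R unfolding c3_free_def equivariant_iso_def by auto
  have coset_coords: "bij_betw coset_coords (Fr Z3 {..<p}) (carrier (Lam p \<alpha>))" "\<And>u v. coset_coords (u + v) = coset_coords u + coset_coords v"
    "\<And>u. u \<in> Fr Z3 {..<p} \<Longrightarrow> coset_coords (tr Z3 1 u) = rmul G y (coset_coords u)"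
    using coset_coords_iso unfolding equivariant_iso_def by (auto simp: coset_coords_def frag_extend_add)
  have coset_coords_in: "coset_coords u \<in> carrier (Lam p \<alpha>)" if "u \<in> Fr Z3 {..<p}" for u
    using coset_coords(1) that by (auto simp: bij_betw_def)
  define q where "q u = g (coset_coords u)" for u
  have q_add: "additive_on (Fr Z3 {..<p}) R q"
    unfolding additive_on_def by (auto simp: q_def coset_coords(2) g_add coset_coords_in g_in)
  have q_1: "q (tr Z3 1 u) = q u \<star>\<^bsub>R\<^esub> frag_of y" if "u \<in> Fr Z3 {..<p}" for u
    using that by (simp only: q_def coset_coords(3) g_y coset_coords_in)
  have q_sur: "q ` Fr Z3 {..<p} = carrier R"
    using sur coset_coords(1) by (simp add: q_def[abs_def] bij_betw_def image_image[symmetric])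
  have \<epsilon>_add: "additive_on (Fr Z3 {..<d}) R \<epsilon>"
    using \<epsilon>(1,2) unfolding additive_on_def by (auto simp: bij_betw_def)
  define N where "N = {v \<in> Fr Z3 {..<p}. q v = \<zero>\<^bsub>R\<^esub>}"
  have tr_iter: "tr Z3 j u = (tr Z3 1 ^^ j) u" if "u \<in> Fr Z3 I" "j < 3" for j u and I :: "nat set"
    using that Z3.tr_one[OF that(1)] tr_Z3_Suc[OF that(1), of 1]
    by (elim less_3_cases) (auto simp: numeral_2_eq_2)
  have N1: "tr Z3 1 u \<in> N" if "u \<in> N" for u
  proof -
    have u: "u \<in> Fr Z3 {..<p}" "q u = \<zero>\<^bsub>R\<^esub>" using that by (auto simp: N_def)
    have "\<zero>\<^bsub>R\<^esub> \<star>\<^bsub>R\<^esub> frag_of y \<oplus>\<^bsub>R\<^esub> \<zero>\<^bsub>R\<^esub> \<star>\<^bsub>R\<^esub> frag_of y = \<zero>\<^bsub>R\<^esub> \<star>\<^bsub>R\<^esub> frag_of y"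
      using R.add_ract[of "\<zero>\<^bsub>R\<^esub>" "\<zero>\<^bsub>R\<^esub>" "frag_of y"] y_L by simp
    then have "\<zero>\<^bsub>R\<^esub> \<star>\<^bsub>R\<^esub> frag_of y = \<zero>\<^bsub>R\<^esub>"
      using R.ract_closed[of "\<zero>\<^bsub>R\<^esub>" "frag_of y"] y_L R.M.add.l_cancel_one by simp
    then show ?thesis using u q_1[OF u(1)] by (simp add: N_def Z3.tr_in)
  qed
  have N: "submodule_of Z3 {..<p} N"
    unfolding submodule_of_def
  proof (intro conjI ballI)
    show "N \<subseteq> Fr Z3 {..<p}" by (auto simp: N_def)
    show "0 \<in> N" using R.M.additive_on_zero[OF q_add] by (simp add: N_def)
    show "a - b \<in> N" if "a \<in> N" "b \<in> N" for a b
      using that R.M.additive_on_diff_zero[OF q_add, of a b] by (simp add: N_def Fr_diff)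
    show "tr Z3 j a \<in> N" if "a \<in> N" "j \<in> carrier Z3" for a j
    proof -
      have a: "a \<in> Fr Z3 {..<p}" using that by (simp add: N_def)
      have "(tr Z3 1 ^^ j) a \<in> N" by (induction j) (use that N1 in auto)
      then show ?thesis using tr_iter[OF a] that by simp
    qed
  qed
  have "\<forall>i<d. \<exists>v. v \<in> Fr Z3 {..<p} \<and> q v = \<epsilon> (frag_of (i, 0))"
  proof (intro allI impI)
    fix i assume "i < d"
    then have "\<epsilon> (frag_of (i, 0)) \<in> carrier R" using \<epsilon>(1) by (auto simp: bij_betw_def)
    then show "\<exists>v. v \<in> Fr Z3 {..<p} \<and> q v = \<epsilon> (frag_of (i, 0))" using q_sur by (metis imageE)
  qed
  then obtain \<pi> where \<pi>: "\<And>i. i < d \<Longrightarrow> \<pi> i \<in> Fr Z3 {..<p}" "\<And>i. i < d \<Longrightarrow> q (\<pi> i) = \<epsilon> (frag_of (i, 0))"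
    by metis
  have lin_in: "lin Z3 \<pi> u \<in> Fr Z3 {..<p}" if "u \<in> Fr Z3 {..<d}" for u
    using that \<pi>(1) by (intro Z3.lin_in) auto
  have q_lin: "q (lin Z3 \<pi> u) = \<epsilon> u" if "u \<in> Fr Z3 {..<d}" for u
  proof -
    have "u \<in> frags ({..<d} \<times> carrier Z3)" using that by (simp add: Fr_def)
    then show ?thesis
    proof (rule R.M.additive_on_eq[rotated 3])
      show "additive_on (frags ({..<d} \<times> carrier Z3)) R \<epsilon>" using \<epsilon>_add by (simp add: Fr_def)
      show "additive_on (frags ({..<d} \<times> carrier Z3)) R (\<lambda>u. q (lin Z3 \<pi> u))"
        using q_add[unfolded Fr_def] lin_in[unfolded Fr_def]
        unfolding additive_on_def by (simp add: lin_add Pi_iff)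
      fix s assume s: "s \<in> {..<d} \<times> carrier Z3"
      then obtain i j where ij: "s = (i, j)" "i < d" "j < 3" by auto
      have it1: "(tr Z3 1 ^^ j) (\<pi> i) \<in> Fr Z3 {..<p} \<and> (tr Z3 1 ^^ j) (frag_of (i, 0)) \<in> Fr Z3 {..<d} \<and>
         q ((tr Z3 1 ^^ j) (\<pi> i)) = \<epsilon> ((tr Z3 1 ^^ j) (frag_of (i, 0)))" for j
      proof (induction j)
        case 0
        then show ?case using ij(2) \<pi> by simp
      next
        case (Suc j)
        then show ?case by (auto simp: q_1[unfolded One_nat_def] \<epsilon>(3)[unfolded One_nat_def] intro: Z3.tr_in)
      qed
      have i0: "frag_of (i, 0) \<in> Fr Z3 {..<d}" using ij by simp
      show "q (lin Z3 \<pi> (frag_of s)) = \<epsilon> (frag_of s)"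
      proof -
        have "frag_of s = tr Z3 j (frag_of (i, 0))" "lin Z3 \<pi> (frag_of s) = tr Z3 j (\<pi> i)"
          using ij by simp_all
        then show ?thesis
          using it1[of j] tr_iter[OF \<pi>(1)[OF ij(2)] ij(3)] tr_iter[OF i0 ij(3)] by metis
      qed
    qed
  qed
  have span: "Fr Z3 {..<p} \<subseteq> lin Z3 \<pi> ` Fr Z3 {..<d} + N"
  proof
    fix v assume v: "v \<in> Fr Z3 {..<p}"
    then have "q v \<in> carrier R" using q_sur by blast
    then obtain u where u: "u \<in> Fr Z3 {..<d}" "q v = \<epsilon> u" using \<epsilon>(1) unfolding bij_betw_def by blast
    then have "v - lin Z3 \<pi> u \<in> N"
      using v lin_in[OF u(1)] R.M.additive_on_diff_zero[OF q_add v lin_in[OF u(1)]] q_lin[OF u(1)]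
      by (simp add: N_def Fr_diff)
    then have "lin Z3 \<pi> u + (v - lin Z3 \<pi> u) \<in> lin Z3 \<pi> ` Fr Z3 {..<d} + N"
      using u(1) by (intro set_plus_intro) auto
    then show "v \<in> lin Z3 \<pi> ` Fr Z3 {..<d} + N" by simp
  qed
  have M: "{\<mu> \<in> Fr Z3 {..<d}. lin Z3 \<pi> \<mu> \<in> N} = {0}"
  proof -
    have "u = 0" if "u \<in> Fr Z3 {..<d}" "lin Z3 \<pi> u \<in> N" for u
    proof -
      have "\<epsilon> u = \<epsilon> 0" using that q_lin[OF that(1)] R.M.additive_on_zero[OF \<epsilon>_add] by (simp add: N_def)
      then show ?thesis using \<epsilon>(1) that(1) by (auto simp: bij_betw_def inj_on_def)
    qed
    moreover have "0 \<in> N" using N by (simp add: submodule_of_def)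
    ultimately show ?thesis by auto
  qed
  have "3 * d \<le> p" using p_eq by simp
  from Z3.submodule_split[OF N this \<pi>(1) span, unfolded M]
  obtain \<theta> :: "(nat \<times> nat \<Rightarrow>\<^sub>0 int) \<Rightarrow> (nat \<times> nat \<Rightarrow>\<^sub>0 int) \<Rightarrow> (nat \<times> nat \<Rightarrow>\<^sub>0 int)"
    where "split_iso Z3 {0} {..<p - d} N \<theta>" by (rule exE)
  note \<theta> = split_isoD[OF this]
  have "bij_betw (\<theta> 0) (Fr Z3 {..<p - d}) N"
  proof -
    have "bij_betw (Pair 0) (Fr Z3 {..<p - d}) ({0} \<times> Fr Z3 {..<p - d})"
      by (auto simp: bij_betw_def inj_on_def)
    from bij_betw_trans[OF this \<theta>(1)] show ?thesis by (simp add: o_def)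
  qed
  then have 1: "equivariant_iso (\<theta> 0) (Fr Z3 {..<p - d}) (tr Z3 1) N (+) (tr Z3 1)"
    using \<theta>(2)[of 0 0] \<theta>(3)[of 0 _ 1] by (simp add: equivariant_iso_def)
  have 2: "equivariant_iso coset_coords N (tr Z3 1) (f ` carrier K) (+) (rmul G y)"
    unfolding equivariant_iso_def
  proof (intro conjI ballI)
    have "coset_coords ` N = f ` carrier K"
    proof (intro equalityI subsetI)
      fix z assume z: "z \<in> f ` carrier K"
      then have "z \<in> coset_coords ` Fr Z3 {..<p}" using coset_coords(1) ker by (simp add: bij_betw_def)
      then obtain u where "u \<in> Fr Z3 {..<p}" "z = coset_coords u" by auto
      then show "z \<in> coset_coords ` N" using z ker by (auto simp: N_def q_def)
    qed (auto simp: ker N_def q_def coset_coords_in)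
    moreover have "inj_on coset_coords N" using coset_coords(1) unfolding bij_betw_def N_def by (auto intro: inj_on_subset)
    ultimately show "bij_betw coset_coords N (f ` carrier K)" by (simp add: bij_betw_def)
  qed (auto simp: coset_coords coset_coords(3)[unfolded One_nat_def] N_def)
  have 3: "equivariant_iso (the_inv_into (carrier K) f) (f ` carrier K) (rmul G y) (carrier K) (ring.add K) (\<lambda>m. m \<star>\<^bsub>K\<^esub> frag_of y)"
    unfolding equivariant_iso_def
  proof (intro conjI ballI)
    show "bij_betw (the_inv_into (carrier K) f) (f ` carrier K) (carrier K)"
      using inj by (intro bij_betw_the_inv_into) (simp add: bij_betw_def)
    fix u assume "u \<in> f ` carrier K"
    then obtain m where m: "m \<in> carrier K" "u = f m" by auto
    then show "the_inv_into (carrier K) f (rmul G y u) = the_inv_into (carrier K) f u \<star>\<^bsub>K\<^esub> frag_of y"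
      using f_y[OF m(1)] the_inv_into_f_f[OF inj] K.ract_closed[OF m(1) y_L] by (metis)
    fix v assume "v \<in> f ` carrier K"
    then obtain n where n: "n \<in> carrier K" "v = f n" by auto
    show "the_inv_into (carrier K) f (u + v) = the_inv_into (carrier K) f u \<oplus>\<^bsub>K\<^esub> the_inv_into (carrier K) f v"
      using f_add[OF m(1) n(1)] the_inv_into_f_f[OF inj] K.M.add.m_closed[OF m(1) n(1)] m n by metis
  qed
  from equivariant_iso_comp[OF equivariant_iso_comp[OF 1 2] 3] show ?thesis unfolding c3_free_def by blast
qed

lemma rmul_in: "l \<in> carrier (Lam p \<alpha>) \<Longrightarrow> g \<in> carrier G \<Longrightarrow> rmul G g l \<in> carrier (Lam p \<alpha>)"
  unfolding carrier_Lam rmul_def by (rule frag_extend_in_frags) auto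

lemma rmul_rmul: "l \<in> carrier (Lam p \<alpha>) \<Longrightarrow> g \<in> carrier G \<Longrightarrow> h \<in> carrier G \<Longrightarrow> rmul G h (rmul G g l) = rmul G (g \<cdot> h) l"
  unfolding carrier_Lam by (induction rule: frags_induct) (auto simp: rmul_diff G.m_assoc)

lemma rmul_one: "l \<in> carrier (Lam p \<alpha>) \<Longrightarrow> rmul G \<one>\<^bsub>G\<^esub> l = l"
  unfolding carrier_Lam by (induction rule: frags_induct) (auto simp: rmul_diff)

text \<open>
  The surjection \<open>\<Lambda> \<rightarrow> R(3)\<close> lifts, as an additive map, to \<open>frag_extend c\<close> with values in
  \<open>\<int>[H\G]\<close>; the kernel is then the set of elements with constant image. The element \<open>\<tau>\<close> lifts the
  class of \<open>1\<close>. Since that class is fixed by \<open>y\<close>, the translates \<open>\<tau> y\<^sup>j x\<^sup>a\<close> lift the classes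
  \<open>x\<^sup>a\<close>.
\<close>

lemma R3_kernel:
  assumes R: "is_R p \<alpha> 3 R" and ex: "short_exact (Lam p \<alpha>) K (regular_rmod (Lam p \<alpha>)) R f r"
  shows "\<exists>c \<tau>. (\<forall>g\<in>carrier G. c g \<in> PL) \<and>
    (\<forall>l\<in>carrier (Lam p \<alpha>). l \<in> f ` carrier K \<longleftrightarrow> (\<exists>z. frag_extend c l = frag_cmul z norm_elt)) \<and>
    \<tau> \<in> carrier (Lam p \<alpha>) \<and>
    (\<forall>j a. a < p \<longrightarrow> (\<exists>z. frag_extend c (rmul G (el j a) \<tau>) = frag_of a + frag_cmul z norm_elt))"
proof -
  note E = short_exact_regular[OF ex]
  interpret R: right_module "Lam p \<alpha>" R by (rule E)
  obtain \<psi> where "P_quotient R \<psi>" using R3_quotient[OF R] by (rule exE)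
  note \<psi> = P_quotientD[OF this]
  have r_in: "r l \<in> carrier R" if "l \<in> carrier (Lam p \<alpha>)" for l using E(8) that by blast
  have "\<forall>g\<in>carrier G. \<exists>u. u \<in> PL \<and> \<psi> u = r (frag_of g)"
    using r_in[OF frag_of_Lam] \<psi>(1) by (metis imageE)
  then obtain c where c: "\<And>g. g \<in> carrier G \<Longrightarrow> c g \<in> PL" "\<And>g. g \<in> carrier G \<Longrightarrow> \<psi> (c g) = r (frag_of g)"
    by metis
  have C_in: "frag_extend c l \<in> PL" if "l \<in> carrier (Lam p \<alpha>)" for l
    using that unfolding carrier_Lam by (rule frag_extend_in_frags) (rule c)
  have \<psi>_in: "\<psi> u \<in> carrier R" if "u \<in> PL" for u using \<psi>(1) that by blast
  have \<psi>C: "\<psi> (frag_extend c l) = r l" if "l \<in> carrier (Lam p \<alpha>)" for l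
  proof -
    have "l \<in> frags (carrier G)" using that by (simp add: carrier_Lam)
    then show ?thesis
    proof (rule R.M.additive_on_eq[rotated 3])
      show "additive_on (frags (carrier G)) R (\<lambda>l. \<psi> (frag_extend c l))"
        using C_in \<psi>_in \<psi>(2) unfolding additive_on_def carrier_Lam by (simp add: frag_extend_add Pi_iff)
      show "additive_on (frags (carrier G)) R r"
        using r_in E(9) unfolding additive_on_def carrier_Lam by (simp add: Pi_iff)
    qed (simp add: c)
  qed
  have add\<psi>: "additive_on PL R \<psi>" using \<psi>_in \<psi>(2) unfolding additive_on_def by auto
  have ker: "l \<in> f ` carrier K \<longleftrightarrow> (\<exists>z. frag_extend c l = frag_cmul z norm_elt)" if "l \<in> carrier (Lam p \<alpha>)" for l
  proof -
    have "l \<in> f ` carrier K \<longleftrightarrow> \<psi> (frag_extend c l) = \<psi> 0"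
      using that \<psi>C[OF that] R.M.additive_on_zero[OF add\<psi>] by (simp add: E(7))
    also have "\<dots> \<longleftrightarrow> (\<exists>z. frag_extend c l = frag_cmul z norm_elt)"
      using \<psi>(3)[OF C_in[OF that], of 0] by simp
    finally show ?thesis .
  qed
  have p0: "frag_of 0 \<in> PL" using p_gt by simp
  obtain \<tau> where \<tau>: "\<tau> \<in> carrier (Lam p \<alpha>)" "r \<tau> = \<psi> (frag_of 0)"
    using E(8) \<psi>_in[OF p0] by (metis imageE)
  have ry: "r (rmul G (y \<up> j) \<tau>) = \<psi> (frag_of 0)" for j :: nat
  proof (induction j)
    case 0
    then show ?case using \<tau> by (simp add: rmul_one)
  next
    case (Suc j)
    have "rmul G (y \<up> Suc j) \<tau> = rmul G y (rmul G (y \<up> j) \<tau>)"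
      using \<tau>(1) by (simp add: rmul_rmul)
    then have "r (rmul G (y \<up> Suc j) \<tau>) = r (rmul G (y \<up> j) \<tau>) \<star>\<^bsub>R\<^esub> frag_of y"
      using E(10)[of "rmul G (y \<up> j) \<tau>" y] \<tau>(1) by (simp add: rmul_in)
    also have "\<dots> = \<psi> (shift_y (frag_of 0))" unfolding Suc by (rule \<psi>(5)[OF p0, symmetric])
    finally show ?case by simp
  qed
  have rx: "r (rmul G (el j a) \<tau>) = \<psi> (frag_of (a mod p))" for j a
  proof (induction a)
    case 0
    then show ?case using ry by (simp add: el_def)
  next
    case (Suc a)
    have "rmul G (el j (Suc a)) \<tau> = rmul G x (rmul G (el j a) \<tau>)"
      using \<tau>(1) el_x[of j a] by (simp add: rmul_rmul)
    then have "r (rmul G (el j (Suc a)) \<tau>) = r (rmul G (el j a) \<tau>) \<star>\<^bsub>R\<^esub> frag_of x"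
      using E(10)[of "rmul G (el j a) \<tau>" x] \<tau>(1) by (simp add: rmul_in)
    also have "\<dots> = \<psi> (shift_x (frag_of (a mod p)))"
      unfolding Suc using p_gt by (intro \<psi>(4)[symmetric]) simp
    finally show ?case by (simp add: mod_Suc_eq)
  qed
  have "\<exists>z. frag_extend c (rmul G (el j a) \<tau>) = frag_of a + frag_cmul z norm_elt" if ap: "a < p" for j a
  proof -
    have l: "rmul G (el j a) \<tau> \<in> carrier (Lam p \<alpha>)" using \<tau>(1) by (simp add: rmul_in)
    have "\<psi> (frag_extend c (rmul G (el j a) \<tau>)) = \<psi> (frag_of a)"
      using \<psi>C[OF l] rx[of j a] ap by simp
    then obtain z where "frag_extend c (rmul G (el j a) \<tau>) - frag_of a = frag_cmul z norm_elt"
      using \<psi>(3)[OF C_in[OF l], of "frag_of a"] ap by auto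
    then show ?thesis by (metis diff_add_cancel add.commute)
  qed
  then show ?thesis using c(1) ker \<tau>(1) by (intro exI[of _ c] exI[of _ \<tau>]) simp
qed

end

section \<open>The tensor product as a submodule of a free module\<close>

text \<open>
  \<open>K\<close> stands for \<open>K(3)\<close>, embedded by \<open>f\<close> into \<open>\<Lambda>\<close> as the kernel of a surjection onto \<open>R(3)\<close>, and
  \<open>X\<close> for a module that is free over the group ring of \<open>\<langle>y\<rangle>\<close>.
\<close>

locale module_pair = metacyclic p d \<alpha> + K: right_module "Lam p \<alpha>" K + X: right_module "Lam p \<alpha>" X
  for p d \<alpha> and K X :: "(lam, 'm) rmod" +
  fixes f :: "'m \<Rightarrow> lam" and k :: nat and \<epsilon> :: "(nat \<times> nat \<Rightarrow>\<^sub>0 int) \<Rightarrow> 'm"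
    and c :: "xy word set \<Rightarrow> (nat \<Rightarrow>\<^sub>0 int)" and \<tau> :: lam
  assumes f_inj: "inj_on f (carrier K)"
    and f_in: "\<And>m. m \<in> carrier K \<Longrightarrow> f m \<in> carrier (Lam p \<alpha>)"
    and f_add: "\<And>m n. m \<in> carrier K \<Longrightarrow> n \<in> carrier K \<Longrightarrow> f (m \<oplus>\<^bsub>K\<^esub> n) = f m + f n"
    and f_act: "\<And>m g. m \<in> carrier K \<Longrightarrow> g \<in> carrier (G3 p \<alpha>) \<Longrightarrow> f (m \<star>\<^bsub>K\<^esub> frag_of g) = rmul (G3 p \<alpha>) g (f m)"
    and \<epsilon>: "c3_free X k \<epsilon>"
    and c_in: "\<And>g. g \<in> carrier (G3 p \<alpha>) \<Longrightarrow> c g \<in> frags {..<p}"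
    and f_image: "\<And>l. l \<in> carrier (Lam p \<alpha>) \<Longrightarrow> l \<in> f ` carrier K \<longleftrightarrow> (\<exists>z. frag_extend c l = frag_cmul z norm_elt)"
    and \<tau>_in: "\<tau> \<in> carrier (Lam p \<alpha>)"
    and c_\<tau>: "\<And>j a. a < p \<Longrightarrow> \<exists>z. frag_extend c (rmul (G3 p \<alpha>) (el j a) \<tau>) = frag_of a + frag_cmul z norm_elt"
begin

abbreviation "B \<equiv> {..<k} \<times> {..<3::nat}"
abbreviation "XL \<equiv> frags B"
abbreviation "V \<equiv> Fr G {..<3 * k}"
abbreviation "VK \<equiv> Fr G {..<k}"

lemma XL: "Fr Z3 {..<k} = XL" by (simp add: Fr_def)

lemma \<epsilon>_bij: "bij_betw \<epsilon> XL (carrier X)"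
  and \<epsilon>_add: "\<And>u v. u \<in> XL \<Longrightarrow> v \<in> XL \<Longrightarrow> \<epsilon> (u + v) = \<epsilon> u \<oplus>\<^bsub>X\<^esub> \<epsilon> v"
  and \<epsilon>_y: "\<And>u. u \<in> XL \<Longrightarrow> \<epsilon> (tr Z3 1 u) = \<epsilon> u \<star>\<^bsub>X\<^esub> frag_of y"
  using \<epsilon> unfolding c3_free_def equivariant_iso_def XL by blast+

lemma \<epsilon>_in: "u \<in> XL \<Longrightarrow> \<epsilon> u \<in> carrier X" using \<epsilon>_bij by (auto simp: bij_betw_def)

definition \<chi> :: "'m \<Rightarrow> (nat \<times> nat \<Rightarrow>\<^sub>0 int)" where "\<chi> = the_inv_into XL \<epsilon>"

lemma \<chi>_\<epsilon> [simp]: "u \<in> XL \<Longrightarrow> \<chi> (\<epsilon> u) = u"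
  using \<epsilon>_bij by (simp add: \<chi>_def bij_betw_def the_inv_into_f_f)

lemma \<epsilon>_\<chi> [simp]: "m \<in> carrier X \<Longrightarrow> \<epsilon> (\<chi> m) = m"
  using \<epsilon>_bij by (simp add: \<chi>_def bij_betw_def f_the_inv_into_f)

lemma \<chi>_in: "m \<in> carrier X \<Longrightarrow> \<chi> m \<in> XL"
  using \<epsilon>_bij unfolding \<chi>_def bij_betw_def by (auto intro: the_inv_into_into)

lemma \<epsilon>_inj: "u \<in> XL \<Longrightarrow> v \<in> XL \<Longrightarrow> \<epsilon> u = \<epsilon> v \<Longrightarrow> u = v" by (metis \<chi>_\<epsilon>)

lemma \<chi>_add: "m \<in> carrier X \<Longrightarrow> n \<in> carrier X \<Longrightarrow> \<chi> (m \<oplus>\<^bsub>X\<^esub> n) = \<chi> m + \<chi> n"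
  by (rule \<epsilon>_inj) (simp_all add: \<chi>_in frags_add \<epsilon>_add)

definition actX :: "xy word set \<Rightarrow> (nat \<times> nat \<Rightarrow>\<^sub>0 int) \<Rightarrow> (nat \<times> nat \<Rightarrow>\<^sub>0 int)" where
  "actX g u = \<chi> (\<epsilon> u \<star>\<^bsub>X\<^esub> frag_of g)"

lemma act_in: "m \<in> carrier X \<Longrightarrow> g \<in> carrier G \<Longrightarrow> m \<star>\<^bsub>X\<^esub> frag_of g \<in> carrier X"
  by (simp add: X.ract_closed frag_of_Lam)

lemma actX_in: "u \<in> XL \<Longrightarrow> g \<in> carrier G \<Longrightarrow> actX g u \<in> XL"
  by (simp add: actX_def \<chi>_in act_in \<epsilon>_in)

lemma \<chi>_act: "m \<in> carrier X \<Longrightarrow> g \<in> carrier G \<Longrightarrow> \<chi> (m \<star>\<^bsub>X\<^esub> frag_of g) = actX g (\<chi> m)"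
  by (simp add: actX_def)

lemma \<epsilon>_actX: "u \<in> XL \<Longrightarrow> g \<in> carrier G \<Longrightarrow> \<epsilon> (actX g u) = \<epsilon> u \<star>\<^bsub>X\<^esub> frag_of g"
  by (simp add: actX_def act_in \<epsilon>_in)

lemma actX_add: "u \<in> XL \<Longrightarrow> v \<in> XL \<Longrightarrow> g \<in> carrier G \<Longrightarrow> actX g (u + v) = actX g u + actX g v"
  by (simp add: actX_def \<epsilon>_add X.add_ract \<epsilon>_in act_in \<chi>_add frag_of_Lam)

lemma actX_diff: "u \<in> XL \<Longrightarrow> v \<in> XL \<Longrightarrow> g \<in> carrier G \<Longrightarrow> actX g (u - v) = actX g u - actX g v"
  using actX_add[of "u - v" v g] by (simp add: frags_diff)

lemma actX_zero [simp]: "g \<in> carrier G \<Longrightarrow> actX g 0 = 0"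
  using actX_add[of 0 0 g] by simp

lemma actX_actX: "u \<in> XL \<Longrightarrow> g \<in> carrier G \<Longrightarrow> h \<in> carrier G \<Longrightarrow> actX h (actX g u) = actX (g \<cdot> h) u"
proof -
  assume *: "u \<in> XL" "g \<in> carrier G" "h \<in> carrier G"
  have "frag_of (g \<cdot> h) = frag_of g \<otimes>\<^bsub>Lam p \<alpha>\<^esub> frag_of h"
    by (simp add: Lam_def group_ring_mult_of)
  then show ?thesis
    using * by (simp add: actX_def act_in \<epsilon>_in X.ract_mult frag_of_Lam)
qed

lemma actX_one: "u \<in> XL \<Longrightarrow> actX \<one>\<^bsub>G\<^esub> u = u"
  using X.ract_one[OF \<epsilon>_in] by (simp add: actX_def Lam_def group_ring_def)

lemma actX_inv: "u \<in> XL \<Longrightarrow> g \<in> carrier G \<Longrightarrow> actX g (actX (inv\<^bsub>G\<^esub> g) u) = u"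
  "u \<in> XL \<Longrightarrow> g \<in> carrier G \<Longrightarrow> actX (inv\<^bsub>G\<^esub> g) (actX g u) = u"
  by (simp_all add: actX_actX actX_one)

lemma actX_y: "u \<in> XL \<Longrightarrow> actX y u = tr Z3 1 u"
  using \<epsilon>_y[of u, symmetric] Z3.tr_in[of u "{..<k}" 1] by (simp add: actX_def XL)

lemma actX_y_pow: "i < k \<Longrightarrow> actX (y \<up> (j::nat)) (frag_of (i, 0)) = frag_of (i, j mod 3)"
proof (induction j)
  case 0
  then show ?case by (simp add: actX_one)
next
  case (Suc j)
  then show ?case
    using actX_actX[of "frag_of (i, 0)" "y \<up> j" y] actX_y[of "frag_of (i, j mod 3)"]
    by (simp add: mod_Suc_eq)
qed

text \<open>
  \<open>tens l u\<close> is the image of \<open>l \<otimes> u\<close> in the standard free module: the basis element \<open>(n, g)\<close>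
  stands for \<open>(1 \<otimes> e\<^sub>n) g = g \<otimes> e\<^sub>n g\<close>, so that \<open>g \<otimes> u\<close> has the coordinates of \<open>u g\<^sup>-\<^sup>1\<close> at \<open>g\<close>.
  The pair \<open>(i, j)\<close> is encoded as \<open>3 i + j\<close>.
\<close>

definition insert_at :: "xy word set \<Rightarrow> (nat \<times> nat \<Rightarrow>\<^sub>0 int) \<Rightarrow> (nat \<times> xy word set \<Rightarrow>\<^sub>0 int)" where
  "insert_at g = frag_extend (\<lambda>ij. frag_of (3 * fst ij + snd ij, g))"

definition tens :: "lam \<Rightarrow> (nat \<times> nat \<Rightarrow>\<^sub>0 int) \<Rightarrow> (nat \<times> xy word set \<Rightarrow>\<^sub>0 int)" where
  "tens l u = frag_extend (\<lambda>g. insert_at g (actX (inv\<^bsub>G\<^esub> g) u)) l"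

lemma frag_cmul_diff_right: "frag_cmul z (u - v) = frag_cmul z u - frag_cmul z v"
  by (rule poly_mapping_eqI) (simp add: lookup_minus algebra_simps)

lemma insert_at_diff: "insert_at g (u - v) = insert_at g u - insert_at g v" by (simp add: insert_at_def frag_extend_diff)
lemma insert_at_zero: "insert_at g 0 = 0" by (simp add: insert_at_def)
lemma tens_zero: "tens 0 u = 0" by (simp add: tens_def)

lemma insert_at_in: "u \<in> XL \<Longrightarrow> g \<in> carrier G \<Longrightarrow> insert_at g u \<in> V"
  unfolding insert_at_def Fr_def by (rule frag_extend_in_frags) auto

lemma tens_in: "l \<in> carrier (Lam p \<alpha>) \<Longrightarrow> u \<in> XL \<Longrightarrow> tens l u \<in> V"
  unfolding tens_def carrier_Lam
  by (rule frag_extend_closed[of _ "carrier G"]) (auto intro: Fr_diff insert_at_in actX_in)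

lemma tens_add_left: "tens (l + l') u = tens l u + tens l' u" by (simp add: tens_def frag_extend_add)
lemma tens_diff_left: "tens (l - l') u = tens l u - tens l' u" by (simp add: tens_def frag_extend_diff)
lemma tens_of: "tens (frag_of g) u = insert_at g (actX (inv\<^bsub>G\<^esub> g) u)" by (simp add: tens_def)

lemma tens_add_right: "l \<in> carrier (Lam p \<alpha>) \<Longrightarrow> u \<in> XL \<Longrightarrow> v \<in> XL \<Longrightarrow> tens l (u + v) = tens l u + tens l v"
proof -
  assume l: "l \<in> carrier (Lam p \<alpha>)" and uv: "u \<in> XL" "v \<in> XL"
  have "tens l (u + v) = frag_extend (\<lambda>g. insert_at g (actX (inv\<^bsub>G\<^esub> g) u) + insert_at g (actX (inv\<^bsub>G\<^esub> g) v)) l"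
    unfolding tens_def using l uv
    by (intro frag_extend_cong[of _ "carrier G"]) (auto simp: carrier_Lam actX_add insert_at_def frag_extend_add)
  then show ?thesis by (simp add: tens_def frag_extend_plus_fun)
qed

lemma tens_zero_right: "l \<in> carrier (Lam p \<alpha>) \<Longrightarrow> tens l 0 = 0"
  using tens_add_right[of l 0 0] by simp

lemma tens_diff_right: "l \<in> carrier (Lam p \<alpha>) \<Longrightarrow> u \<in> XL \<Longrightarrow> v \<in> XL \<Longrightarrow> tens l (u - v) = tens l u - tens l v"
  using tens_add_right[of l "u - v" v] by (simp add: frags_diff)

lemma tens_act:
  assumes "l \<in> carrier (Lam p \<alpha>)" "u \<in> XL" "h \<in> carrier G"
  shows "tr G h (tens l u) = tens (rmul G h l) (actX h u)"
proof -
  have insert_at_tr: "tr G h (insert_at g w) = insert_at (g \<cdot> h) w" for g w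
    by (simp add: insert_at_def tr_def frag_extend_frag_extend)
  have "l \<in> frags (carrier G)" using assms(1) by (simp add: carrier_Lam)
  then show ?thesis
  proof (induction rule: frags_induct)
    case (one g)
    then have "actX (inv\<^bsub>G\<^esub> (g \<cdot> h)) (actX h u) = actX (inv\<^bsub>G\<^esub> g) u"
      using assms by (simp add: actX_actX G.inv_mult_group flip: G.m_assoc)
    then show ?case by (simp add: tens_of insert_at_tr)
  qed (auto simp: tens_diff_left rmul_diff tr_diff tens_zero)
qed

text \<open>
  A functional \<open>E\<close> on \<open>\<Lambda>\<close>, given by its values \<open>e\<close> on \<open>G\<close>, induces the map \<open>l \<otimes> u \<mapsto> E(l) u\<close> into
  the coordinates of \<open>X\<close>. Coefficient functionals separate the elements of the tensor product.
\<close>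

definition contract :: "(xy word set \<Rightarrow> int) \<Rightarrow> (nat \<times> xy word set \<Rightarrow>\<^sub>0 int) \<Rightarrow> (nat \<times> nat \<Rightarrow>\<^sub>0 int)" where
  "contract e = frag_extend (\<lambda>(l, g). frag_cmul (e g) (actX g (frag_of (l div 3, l mod 3))))"

lemma contract_diff: "contract e (u - v) = contract e u - contract e v" by (simp add: contract_def frag_extend_diff)
lemma contract_add: "contract e (u + v) = contract e u + contract e v" by (simp add: contract_def frag_extend_add)
lemma contract_zero [simp]: "contract e 0 = 0" by (simp add: contract_def)

lemma contract_in: "v \<in> V \<Longrightarrow> contract e v \<in> XL"
  unfolding contract_def Fr_def
  by (rule frag_extend_in_frags) (auto intro!: frags_cmul actX_in)

lemma contract_tens:
  assumes l: "l \<in> carrier (Lam p \<alpha>)" and u: "u \<in> XL"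
    and E: "\<And>a b. E (a - b) = E a - E b" "\<And>g. E (frag_of g) = e g"
  shows "contract e (tens l u) = frag_cmul (E l) u"
proof -
  have E0: "E 0 = 0" using E(1)[of 0 0] by simp
  have contract_insert_at: "contract e (insert_at g w) = frag_cmul (e g) (actX g w)" if "g \<in> carrier G" "w \<in> XL" for g w
    using that(2)
  proof (induction rule: frags_induct)
    case (one ij)
    then show ?case by (auto simp: insert_at_def contract_def)
  next
    case (diff a b)
    then show ?case using that(1)
      by (simp add: insert_at_diff contract_diff actX_diff frag_cmul_diff_right)
  qed (use that(1) in \<open>simp_all add: insert_at_zero\<close>)
  have "l \<in> frags (carrier G)" using l by (simp add: carrier_Lam)
  then show ?thesis
  proof (induction rule: frags_induct)
    case zero
    then show ?case by (simp add: E0 tens_def)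
  next
    case (one g)
    then show ?case using u by (simp add: tens_of contract_insert_at actX_in actX_inv E(2))
  qed (simp add: tens_diff_left contract_diff E(1) frag_cmul_diff_distrib)
qed

definition tens_sum :: "(nat \<times> nat \<Rightarrow> lam) \<Rightarrow> (nat \<times> xy word set \<Rightarrow>\<^sub>0 int)" where
  "tens_sum L = (\<Sum>ij\<in>B. tens (L ij) (frag_of ij))"

lemma tens_sum_single: "ij \<in> B \<Longrightarrow> tens_sum (\<lambda>s. if s = ij then l else 0) = tens l (frag_of ij)"
  unfolding tens_sum_def by (subst sum.remove[of _ ij]) (auto simp: tens_def intro!: sum.neutral)

lemma tens_sum_diff: "tens_sum (\<lambda>s. L s - L' s) = tens_sum L - tens_sum L'"
  by (simp add: tens_sum_def tens_diff_left sum_subtractf)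

lemma V_tens_sum:
  assumes "v \<in> V"
  shows "\<exists>L. (\<forall>ij. L ij \<in> carrier (Lam p \<alpha>)) \<and> v = tens_sum L"
proof -
  define D where "D = {v. \<exists>L. (\<forall>ij. L ij \<in> carrier (Lam p \<alpha>)) \<and> v = tens_sum L}"
  have D0: "0 \<in> D"
    unfolding D_def by (auto intro!: exI[of _ "\<lambda>_. 0"] simp: tens_sum_def tens_def carrier_Lam)
  have Dd: "a - b \<in> D" if ab: "a \<in> D" "b \<in> D" for a b
  proof -
    obtain L L' where "\<And>ij. L ij \<in> carrier (Lam p \<alpha>)" "a = tens_sum L" "\<And>ij. L' ij \<in> carrier (Lam p \<alpha>)" "b = tens_sum L'"
      using ab unfolding D_def by auto
    then show ?thesis unfolding D_def
      by (intro CollectI exI[of _ "\<lambda>s. L s - L' s"]) (auto simp: tens_sum_diff carrier_Lam frags_diff)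
  qed
  have DT: "tens (frag_of g) u \<in> D" if g: "g \<in> carrier G" and "u \<in> XL" for g u
    using that(2)
  proof (induction rule: frags_induct)
    case zero
    then show ?case using D0 g by (simp add: tens_zero_right frag_of_Lam)
  next
    case (one ij)
    then show ?case
      unfolding D_def using g tens_sum_single[OF one, of "frag_of g"]
      by (intro CollectI exI[of _ "\<lambda>s. if s = ij then frag_of g else 0"]) (auto simp: carrier_Lam)
  next
    case (diff a b)
    then show ?case using Dd g by (simp add: tens_diff_right frag_of_Lam)
  qed
  have "v \<in> D"
    using assms
  proof (induction rule: Fr_induct)
    case (one l g)
    then have e: "frag_of (l div 3, l mod 3) \<in> XL" by auto
    then have "tens (frag_of g) (actX g (frag_of (l div 3, l mod 3))) = frag_of (l, g)"
      using one by (simp add: tens_of actX_inv) (simp add: insert_at_def)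
    then show ?case using DT[OF _ actX_in[OF e]] one by metis
  qed (use D0 Dd in auto)
  then show ?thesis by (simp add: D_def)
qed

lemma contract_tens_sum:
  assumes L: "\<And>ij. L ij \<in> carrier (Lam p \<alpha>)"
    and E: "\<And>a b. E (a - b) = E a - E b" "\<And>g. E (frag_of g) = e g" and ij: "ij \<in> B"
  shows "cf (contract e (tens_sum L)) ij = E (L ij)"
proof -
  have "contract e (\<Sum>s\<in>A. tens (L s) (frag_of s)) = (\<Sum>s\<in>A. frag_cmul (E (L s)) (frag_of s))" if "A \<subseteq> B" for A
    using finite_subset[OF that] that
    by (induction A rule: infinite_finite_induct) (auto simp: contract_add contract_tens[OF L _ E])
  then have "contract e (tens_sum L) = (\<Sum>s\<in>B. frag_cmul (E (L s)) (frag_of s))" by (simp add: tens_sum_def)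
  then have "cf (contract e (tens_sum L)) ij = (\<Sum>s\<in>B. cf (frag_cmul (E (L s)) (frag_of s)) ij)"
    by (simp only: lookup_sum)
  also have "\<dots> = (\<Sum>s\<in>B. if ij = s then E (L s) else 0)"
    by (rule sum.cong[OF refl]) (simp add: lookup_single when_def)
  also have "\<dots> = E (L ij)" using ij by (subst sum.delta') auto
  finally show ?thesis .
qed

abbreviation "contract_at a \<equiv> contract (\<lambda>g. cf (c g) a)"

lemma contract_at_functional:
  "cf (frag_extend c (l - l')) a = cf (frag_extend c l) a - cf (frag_extend c l') a"
  "cf (frag_extend c (frag_of g)) a = cf (c g) a"
  by (simp_all add: frag_extend_diff lookup_minus)

lemmas contract_at_tens = contract_tens[where E = "\<lambda>l. cf (frag_extend c l) a" and e = "\<lambda>g. cf (c g) a" for a, OF _ _ contract_at_functional]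

text \<open>
  The kernel of \<open>\<Lambda> \<otimes> X \<rightarrow> R(3) \<otimes> X\<close>: its elements have an image in \<open>\<int>[H\G] \<otimes> X\<close>, a family of
  elements of \<open>X\<close> indexed by residues, that is constant. It turns out to be \<open>K \<otimes> X\<close>.
\<close>

definition tensor_part :: "(nat \<times> xy word set \<Rightarrow>\<^sub>0 int) set" where
  "tensor_part = {v \<in> V. \<exists>w. \<forall>a<p. contract_at a v = w}"

lemma tens_tensor_part: "\<kappa> \<in> carrier K \<Longrightarrow> u \<in> XL \<Longrightarrow> tens (f \<kappa>) u \<in> tensor_part"
proof -
  assume *: "\<kappa> \<in> carrier K" "u \<in> XL"
  then obtain z where z: "frag_extend c (f \<kappa>) = frag_cmul z norm_elt" using f_image[OF f_in] by blast
  have "contract_at a (tens (f \<kappa>) u) = frag_cmul z u" if "a < p" for a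
    using * that by (simp add: contract_at_tens f_in z cf_norm_elt)
  then show ?thesis using * by (auto simp: tensor_part_def tens_in f_in)
qed

lemma tensor_part_diff: "u \<in> tensor_part \<Longrightarrow> v \<in> tensor_part \<Longrightarrow> u - v \<in> tensor_part"
  unfolding tensor_part_def by (auto simp: Fr_diff contract_diff)

lemma tensor_part_tens_sum:
  assumes "v \<in> tensor_part"
  shows "\<exists>\<kappa>. (\<forall>ij. \<kappa> ij \<in> carrier K) \<and> v = tens_sum (\<lambda>ij. f (\<kappa> ij))"
proof -
  obtain L where L: "\<And>ij. L ij \<in> carrier (Lam p \<alpha>)" "v = tens_sum L"
    using V_tens_sum[of v] assms by (auto simp: tensor_part_def)
  obtain w where w: "\<And>a. a < p \<Longrightarrow> contract_at a v = w" using assms by (auto simp: tensor_part_def)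
  have "L ij \<in> f ` carrier K" if ij: "ij \<in> B" for ij
  proof -
    have "cf (frag_extend c (L ij)) a = cf w ij" if "a < p" for a
      
      using contract_tens_sum[where E = "\<lambda>l. cf (frag_extend c l) a" and e = "\<lambda>g. cf (c g) a" and L = L and ij = ij,
          OF L(1) contract_at_functional ij]
        w[OF that] L(2) by simp
    moreover have "cf (frag_extend c (L ij)) a = 0" if "\<not> a < p" for a
    proof -
      have "frag_extend c (L ij) \<in> PL"
        using L(1)[of ij] unfolding carrier_Lam by (rule frag_extend_in_frags) (rule c_in)
      then show ?thesis using that by (intro frags_lookup) auto
    qed
    ultimately have "frag_extend c (L ij) = frag_cmul (cf w ij) norm_elt"
      by (intro poly_mapping_eqI) (simp add: cf_norm_elt)
    then show ?thesis using f_image[OF L(1)] by blast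
  qed
  then have "\<forall>ij. \<exists>\<kappa>. \<kappa> \<in> carrier K \<and> (ij \<in> B \<longrightarrow> L ij = f \<kappa>)"
    using K.M.zero_closed by (metis imageE)
  then obtain \<kappa> where "\<And>ij. \<kappa> ij \<in> carrier K" "\<And>ij. ij \<in> B \<Longrightarrow> L ij = f (\<kappa> ij)" by metis
  then show ?thesis using L(2) by (intro exI[of _ \<kappa>]) (auto simp: tens_sum_def intro!: sum.cong)
qed

lemma tensor_part_zero: "0 \<in> tensor_part" by (auto simp: tensor_part_def)

lemma tensor_part_sum: "finite A \<Longrightarrow> (\<And>s. s \<in> A \<Longrightarrow> h s \<in> tensor_part) \<Longrightarrow> sum h A \<in> tensor_part"
proof (induction A rule: finite_induct)
  case (insert a A)
  have "h a - (0 - sum h A) \<in> tensor_part" using insert by (intro tensor_part_diff tensor_part_zero) auto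
  then show ?case using insert by simp
qed (simp add: tensor_part_zero)

lemma tensor_part_submodule: "submodule_of G {..<3 * k} tensor_part"
  unfolding submodule_of_def
proof (intro conjI ballI)
  show "tensor_part \<subseteq> V" by (auto simp: tensor_part_def)
  fix v g assume v: "v \<in> tensor_part" and g: "g \<in> carrier G"
  obtain \<kappa> where \<kappa>: "\<And>ij. \<kappa> ij \<in> carrier K" "v = tens_sum (\<lambda>ij. f (\<kappa> ij))" using tensor_part_tens_sum[OF v] by auto
  have "tr G g v = (\<Sum>ij\<in>B. tr G g (tens (f (\<kappa> ij)) (frag_of ij)))"
    unfolding \<kappa>(2) tens_sum_def tr_def by (simp add: frag_extend_sum o_def)
  also have "\<dots> = (\<Sum>ij\<in>B. tens (f (\<kappa> ij \<star>\<^bsub>K\<^esub> frag_of g)) (actX g (frag_of ij)))"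
    using g by (intro sum.cong refl) (simp add: tens_act f_in \<kappa>(1) f_act)
  also have "\<dots> \<in> tensor_part"
    using g by (intro tensor_part_sum tens_tensor_part actX_in K.ract_closed \<kappa>(1) frag_of_Lam) auto
  finally show "tr G g v \<in> tensor_part" .
qed (auto intro: tensor_part_zero tensor_part_diff)

lemma G_cases: "g \<in> carrier G \<Longrightarrow> (\<And>j b. j < 3 \<Longrightarrow> b < p \<Longrightarrow> g = el j b \<Longrightarrow> thesis) \<Longrightarrow> thesis"
  using carrier_el by auto

text \<open>
  Next come the relations between the generators \<open>\<tau> \<otimes> e\<^sub>i\<close> of \<open>R(3) \<otimes> X\<close>, one for each basis element
  \<open>e\<^sub>i\<close> of \<open>X\<close> over \<open>\<int>[H]\<close>. A combination of the \<open>(\<tau> \<otimes> e\<^sub>i) y\<^sup>j x\<^sup>a\<close> is the same as a family \<open>\<xi> a\<close> in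
  \<open>X\<close>, where \<open>\<xi> a\<close> collects the coefficients with the exponent \<open>a\<close>.
\<close>

definition \<xi> :: "nat \<Rightarrow> (nat \<times> xy word set \<Rightarrow>\<^sub>0 int) \<Rightarrow> (nat \<times> nat \<Rightarrow>\<^sub>0 int)" where
  "\<xi> a = frag_extend (\<lambda>(i, g). if snd (exponents g) = a then frag_of (i, fst (exponents g)) else 0)"

definition spread :: "nat \<Rightarrow> (nat \<times> nat \<Rightarrow>\<^sub>0 int) \<Rightarrow> (nat \<times> xy word set \<Rightarrow>\<^sub>0 int)" where
  "spread b = frag_extend (\<lambda>ij. frag_of (fst ij, el (snd ij) b))"

lemma \<xi>_maps: "\<xi> a (u - v) = \<xi> a u - \<xi> a v" "\<xi> a (u + v) = \<xi> a u + \<xi> a v" "\<xi> a 0 = 0"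
  by (simp_all add: \<xi>_def frag_extend_diff frag_extend_add)

lemma \<xi>_of: "j < 3 \<Longrightarrow> b < p \<Longrightarrow> \<xi> a (frag_of (i, el j b)) = (if b = a then frag_of (i, j) else 0)"
  by (simp add: \<xi>_def exponents_el)

lemma \<xi>_in: "\<mu> \<in> VK \<Longrightarrow> \<xi> a \<mu> \<in> XL"
proof (induction rule: Fr_induct)
  case (one i g)
  from one(2) obtain j b where "j < 3" "b < p" "g = el j b" by (rule G_cases)
  then show ?case using one(1) by (simp add: \<xi>_of)
qed (auto simp: \<xi>_maps frags_diff)

lemma \<xi>_sum: "finite A \<Longrightarrow> \<xi> a (sum h A) = (\<Sum>s\<in>A. \<xi> a (h s))"
  by (simp add: \<xi>_def frag_extend_sum o_def)

lemma spread_in: "u \<in> XL \<Longrightarrow> spread b u \<in> VK"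
  unfolding spread_def Fr_def by (rule frag_extend_in_frags) auto

lemma \<xi>_spread: "u \<in> XL \<Longrightarrow> b < p \<Longrightarrow> \<xi> a (spread b u) = (if a = b then u else 0)"
proof (induction rule: frags_induct)
  case (one ij)
  then show ?case by (auto simp: spread_def \<xi>_of)
qed (auto simp: spread_def frag_extend_diff \<xi>_maps)

lemma spread_\<xi>: "\<mu> \<in> VK \<Longrightarrow> \<mu> = (\<Sum>b<p. spread b (\<xi> b \<mu>))"
proof (induction rule: Fr_induct)
  case (one i g)
  from one(2) obtain j b where g: "j < 3" "b < p" "g = el j b" by (rule G_cases)
  have "(\<Sum>a<p. spread a (\<xi> a (frag_of (i, g)))) = (\<Sum>a<p. if b = a then frag_of (i, g) else 0)"
    using g by (intro sum.cong) (auto simp: \<xi>_of spread_def)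
  also have "\<dots> = frag_of (i, g)" using g(2) by (subst sum.delta') auto
  finally show ?case ..
qed (auto simp: \<xi>_maps spread_def frag_extend_diff sum_subtractf)

lemma \<xi>_surj:
  assumes "\<And>b. b < p \<Longrightarrow> fam b \<in> XL"
  shows "\<exists>\<mu>\<in>VK. \<forall>b<p. \<xi> b \<mu> = fam b"
proof (intro bexI allI impI)
  have "(\<Sum>b\<in>A. spread b (fam b)) \<in> VK" if "A \<subseteq> {..<p}" for A
    using finite_subset[OF that] that assms
    by (induction A rule: infinite_finite_induct) (auto intro!: Fr_add spread_in)
  then show "(\<Sum>b<p. spread b (fam b)) \<in> VK" by simp
  fix a assume "a < p"
  then have "\<xi> a (\<Sum>b<p. spread b (fam b)) = (\<Sum>b<p. if a = b then fam b else 0)"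
    using assms by (auto simp: \<xi>_sum \<xi>_spread intro!: sum.cong)
  also have "\<dots> = fam a" using \<open>a < p\<close> by (subst sum.delta') auto
  finally show "\<xi> a (\<Sum>b<p. spread b (fam b)) = fam a" .
qed

definition \<pi> :: "nat \<Rightarrow> (nat \<times> xy word set \<Rightarrow>\<^sub>0 int)" where "\<pi> i = tens \<tau> (frag_of (i, 0))"

lemma \<pi>_in: "i < k \<Longrightarrow> \<pi> i \<in> V" by (simp add: \<pi>_def tens_in \<tau>_in)

lemma lin_\<pi>_in: "\<mu> \<in> VK \<Longrightarrow> lin G \<pi> \<mu> \<in> V"
  by (rule G.lin_in) (auto intro: \<pi>_in)

lemma contract_lin: "\<exists>W. \<forall>\<mu>\<in>VK. \<forall>b<p. contract_at b (lin G \<pi> \<mu>) = actX (x \<up> b) (\<xi> b \<mu>) + W \<mu>"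
proof -
  have "\<forall>g\<in>carrier G. \<exists>z. frag_extend c (rmul G g \<tau>) = frag_of (snd (exponents g)) + frag_cmul z norm_elt"
  proof
    fix g assume "g \<in> carrier G"
    then obtain j b where "j < 3" "b < p" "g = el j b" by (rule G_cases)
    then show "\<exists>z. frag_extend c (rmul G g \<tau>) = frag_of (snd (exponents g)) + frag_cmul z norm_elt"
      using c_\<tau>[of b j] by (simp add: exponents_el)
  qed
  then obtain z where z: "\<And>g. g \<in> carrier G \<Longrightarrow> frag_extend c (rmul G g \<tau>) = frag_of (snd (exponents g)) + frag_cmul (z g) norm_elt"
    by metis
  define W where "W = frag_extend (\<lambda>(i, g). frag_cmul (z g) (actX g (frag_of (i, 0::nat))))"
  have "contract_at b (lin G \<pi> \<mu>) = actX (x \<up> b) (\<xi> b \<mu>) + W \<mu>" if "\<mu> \<in> VK" "b < p" for \<mu> b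
    using that(1)
  proof (induction rule: Fr_induct)
    case zero
    then show ?case by (simp add: \<xi>_maps W_def)
  next
    case (one i g)
    have e: "frag_of (i, 0) \<in> XL" using one by simp
    obtain j a where g: "j < 3" "a < p" "g = el j a" using one(2) by (rule G_cases)
    have "lin G \<pi> (frag_of (i, g)) = tens (rmul G g \<tau>) (actX g (frag_of (i, 0)))"
      using tens_act[OF \<tau>_in e one(2)] by (simp add: \<pi>_def)
    then have "contract_at b (lin G \<pi> (frag_of (i, g))) =
        frag_cmul (cf (frag_extend c (rmul G g \<tau>)) b) (actX g (frag_of (i, 0)))"
      using contract_at_tens[OF rmul_in[OF \<tau>_in one(2)] actX_in[OF e one(2)]] by simp
    also have "cf (frag_extend c (rmul G g \<tau>)) b = (if a = b then 1 else 0) + z g"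
      using that(2) g(1,2) unfolding z[OF one(2)]
      by (simp add: g(3) lookup_add cf_norm_elt exponents_el lookup_single when_def)
    also have "frag_cmul ((if a = b then 1 else 0) + z g) (actX g (frag_of (i, 0))) =
        (if a = b then actX g (frag_of (i, 0)) else 0) + W (frag_of (i, g))"
      by (simp add: W_def frag_cmul_distrib)
    also have "(if a = b then actX g (frag_of (i, 0)) else 0) = actX (x \<up> b) (\<xi> b (frag_of (i, g)))"
    proof (cases "a = b")
      case True
      have "actX g (frag_of (i, 0)) = actX (x \<up> a) (actX (y \<up> j) (frag_of (i, 0)))"
        using actX_actX[OF e, of "y \<up> j" "x \<up> a"] g(3) by (simp add: el_def)
      then show ?thesis using True g one(1) actX_y_pow[of i j] by (simp add: \<xi>_of)
    qed (use g in \<open>simp add: \<xi>_of\<close>)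
    finally show ?case .
  next
    case (diff u v)
    then show ?case
      by (simp add: lin_diff contract_diff \<xi>_maps W_def frag_extend_diff actX_diff \<xi>_in)
  qed
  then show ?thesis by blast
qed

text \<open>
  The combination is a relation if and only if the elements \<open>\<xi> a \<cdot> x\<^sup>a\<close> of \<open>X\<close> all agree, and then
  it is determined by \<open>\<xi> 0\<close>. Thus the module of relations is a copy of \<open>X\<close>.
\<close>

definition M :: "(nat \<times> xy word set \<Rightarrow>\<^sub>0 int) set" where "M = {\<mu> \<in> VK. lin G \<pi> \<mu> \<in> tensor_part}"

lemma M_iff: "\<mu> \<in> M \<longleftrightarrow> \<mu> \<in> VK \<and> (\<forall>b<p. actX (x \<up> b) (\<xi> b \<mu>) = \<xi> 0 \<mu>)"
proof (cases "\<mu> \<in> VK")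
  case True
  obtain W where W: "\<And>b. b < p \<Longrightarrow> contract_at b (lin G \<pi> \<mu>) = actX (x \<up> b) (\<xi> b \<mu>) + W"
    using contract_lin True by blast
  have 0: "actX (x \<up> (0::nat)) (\<xi> 0 \<mu>) = \<xi> 0 \<mu>" using \<xi>_in[OF True] by (simp add: actX_one)
  have "(\<exists>w. \<forall>b<p. contract_at b (lin G \<pi> \<mu>) = w) \<longleftrightarrow> (\<forall>b<p. actX (x \<up> b) (\<xi> b \<mu>) = \<xi> 0 \<mu>)"
  proof
    assume "\<exists>w. \<forall>b<p. contract_at b (lin G \<pi> \<mu>) = w"
    then obtain w where w: "\<And>b. b < p \<Longrightarrow> contract_at b (lin G \<pi> \<mu>) = w" by blast
    then have "\<xi> 0 \<mu> + W = w" using W[of 0] 0 p_gt by simp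
    then show "\<forall>b<p. actX (x \<up> b) (\<xi> b \<mu>) = \<xi> 0 \<mu>" using W w by (metis add_right_cancel)
  next
    assume "\<forall>b<p. actX (x \<up> b) (\<xi> b \<mu>) = \<xi> 0 \<mu>"
    then show "\<exists>w. \<forall>b<p. contract_at b (lin G \<pi> \<mu>) = w" using W by auto
  qed
  then show ?thesis using True lin_\<pi>_in[OF True] by (simp add: M_def tensor_part_def)
qed (simp add: M_def)

lemma M_VK: "\<mu> \<in> M \<Longrightarrow> \<mu> \<in> VK" by (simp add: M_def)

lemma M_diff: "u \<in> M \<Longrightarrow> v \<in> M \<Longrightarrow> u - v \<in> M"
  by (simp add: M_def Fr_diff lin_diff tensor_part_diff)

lemma M_zero: "0 \<in> M" by (simp add: M_def tensor_part_zero)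

lemma M_tr: "\<mu> \<in> M \<Longrightarrow> g \<in> carrier G \<Longrightarrow> tr G g \<mu> \<in> M"
  using tensor_part_submodule G.lin_tr[of \<mu> "{..<k}" \<pi> "{..<3 * k}" g]
  by (auto simp: M_def G.tr_in submodule_of_def \<pi>_in)

lemma V_span: "V \<subseteq> lin G \<pi> ` VK + tensor_part"
proof
  fix v assume v: "v \<in> V"
  \<comment> \<open>These components make \<open>lin G \<pi> \<mu>\<close> agree with \<open>v\<close> in \<open>\<int>[H\G] \<otimes> X\<close> up to a constant.\<close>
  define fam where "fam b = actX (inv\<^bsub>G\<^esub> (x \<up> b)) (contract_at b v)" for b
  have fam: "fam b \<in> XL" for b unfolding fam_def by (intro actX_in contract_in v) simp
  obtain \<mu> where \<mu>: "\<mu> \<in> VK" "\<And>b. b < p \<Longrightarrow> \<xi> b \<mu> = fam b" using \<xi>_surj[of fam] fam by blast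
  obtain W where W: "\<And>b. b < p \<Longrightarrow> contract_at b (lin G \<pi> \<mu>) = actX (x \<up> b) (\<xi> b \<mu>) + W"
    using contract_lin \<mu>(1) by blast
  have "contract_at b (v - lin G \<pi> \<mu>) = - W" if "b < p" for b
    using W[OF that] contract_in[OF v] by (simp add: contract_diff \<mu>(2)[OF that] fam_def actX_inv)
  then have "v - lin G \<pi> \<mu> \<in> tensor_part" using v lin_\<pi>_in[OF \<mu>(1)] by (auto simp: tensor_part_def Fr_diff)
  then have "lin G \<pi> \<mu> + (v - lin G \<pi> \<mu>) \<in> lin G \<pi> ` VK + tensor_part"
    using \<mu>(1) by (intro set_plus_intro) auto
  then show "v \<in> lin G \<pi> ` VK + tensor_part" by simp
qed

lemma \<xi>0_bij: "bij_betw (\<xi> 0) M XL"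
  unfolding bij_betw_def
proof
  have zero: "\<mu> = 0" if \<mu>: "\<mu> \<in> M" "\<xi> 0 \<mu> = 0" for \<mu>
  proof -
    have V: "\<mu> \<in> VK" using \<mu>(1) by (rule M_VK)
    have "\<xi> b \<mu> = 0" if "b < p" for b
    proof -
      have "actX (x \<up> b) (\<xi> b \<mu>) = 0" using \<mu> that M_iff by simp
      then have "actX (inv\<^bsub>G\<^esub> (x \<up> b)) (actX (x \<up> b) (\<xi> b \<mu>)) = 0" by simp
      then show ?thesis by (simp add: actX_inv \<xi>_in[OF V])
    qed
    then have "(\<Sum>b<p. spread b (\<xi> b \<mu>)) = 0" by (intro sum.neutral) (simp add: spread_def)
    then show ?thesis using spread_\<xi>[OF V] by simp
  qed
  show "inj_on (\<xi> 0) M"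
  proof (rule inj_onI)
    fix u v assume "u \<in> M" "v \<in> M" "\<xi> 0 u = \<xi> 0 v"
    then show "u = v" using zero[of "u - v"] by (simp add: M_diff \<xi>_maps)
  qed
  show "\<xi> 0 ` M = XL"
  proof (intro equalityI subsetI)
    fix u assume u: "u \<in> XL"
    obtain \<mu> where \<mu>: "\<mu> \<in> VK" "\<And>b. b < p \<Longrightarrow> \<xi> b \<mu> = actX (inv\<^bsub>G\<^esub> (x \<up> b)) u"
      using \<xi>_surj[of "\<lambda>b. actX (inv\<^bsub>G\<^esub> (x \<up> b)) u"] actX_in[OF u] by auto
    have 0: "\<xi> 0 \<mu> = u" using \<mu>(2)[of 0] p_gt u by (simp add: actX_one)
    then have "\<mu> \<in> M" using \<mu> u by (simp add: M_iff actX_inv)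
    then show "u \<in> \<xi> 0 ` M" using 0 by blast
  qed (auto intro: \<xi>_in M_VK)
qed

lemma \<xi>0_act: assumes \<mu>: "\<mu> \<in> M" and g: "g \<in> carrier G" shows "\<xi> 0 (tr G g \<mu>) = actX g (\<xi> 0 \<mu>)"
proof -
  have x: "\<xi> 0 (tr G x \<nu>) = actX x (\<xi> 0 \<nu>)" if "\<nu> \<in> M" for \<nu>
  proof -
    have V: "\<nu> \<in> VK" using that by (rule M_VK)
    have "\<xi> 0 (tr G x \<nu>) = \<xi> (p - 1) \<nu>"
      using V
    proof (induction rule: Fr_induct)
      case (one i g)
      from one(2) obtain j b where g: "j < 3" "b < p" "g = el j b" by (rule G_cases)
      have "tr G x (frag_of (i, g)) = frag_of (i, el j ((b + 1) mod p))"
        using g by (simp add: el_x el_mod)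
      moreover have "(b + 1) mod p = 0 \<longleftrightarrow> b = p - 1" "(b + 1) mod p < p"
        using g(2) by (cases "b + 1 = p", auto)
      ultimately show ?case using g by (simp only: \<xi>_of)
    qed (auto simp: tr_diff \<xi>_maps)
    moreover have "actX x (actX (x \<up> (p - 1)) (\<xi> (p - 1) \<nu>)) = actX x (\<xi> 0 \<nu>)"
      using that p_gt by (simp add: M_iff)
    moreover have "actX x (actX (x \<up> (p - 1)) (\<xi> (p - 1) \<nu>)) = \<xi> (p - 1) \<nu>"
    proof -
      have "x \<up> (p - 1) \<cdot> x = \<one>\<^bsub>G\<^esub>"
        unfolding x_inv[symmetric] by simp
      then show ?thesis using \<xi>_in[OF V] by (simp add: actX_actX actX_one)
    qed
    ultimately show ?thesis by simp
  qed
  have y: "\<xi> 0 (tr G y \<nu>) = actX y (\<xi> 0 \<nu>)" if "\<nu> \<in> M" for \<nu>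
  proof -
    have V: "\<nu> \<in> VK" using that by (rule M_VK)
    have "\<xi> 0 (tr G y \<nu>) = tr Z3 1 (\<xi> 0 \<nu>)"
      using V
    proof (induction rule: Fr_induct)
      case (one i g)
      from one(2) obtain j b where g: "j < 3" "b < p" "g = el j b" by (rule G_cases)
      have "el (j + 1) (b * \<beta>) = el ((j + 1) mod 3) (b * \<beta> mod p)" by (simp only: el_mod)
      then have t: "tr G y (frag_of (i, g)) = frag_of (i, el ((j + 1) mod 3) (b * \<beta> mod p))"
        using g by (simp add: el_y)
      have "b * \<beta> mod p = 0 \<longleftrightarrow> b = 0" "b * \<beta> mod p < p"
        using g(2) \<alpha>\<beta>_cancel(1)[of b] p_gt by auto
      then show ?case unfolding t using g by (simp add: \<xi>_of)
    qed (auto simp: tr_diff \<xi>_maps)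
    then show ?thesis using actX_y[OF \<xi>_in[OF V]] by simp
  qed
  show ?thesis
    using g
  proof (induction rule: G_induct)
    case one
    then show ?case using M_VK[OF \<mu>] \<xi>_in by (simp add: G.tr_one[of _ "{..<k}"] actX_one)
  next
    case (x g)
    have "tr G (g \<cdot> x) \<mu> = tr G x (tr G g \<mu>)" using M_VK[OF \<mu>] x by (simp add: G.tr_tr)
    then show ?case using \<open>\<And>\<nu>. \<nu> \<in> M \<Longrightarrow> \<xi> 0 (tr G x \<nu>) = actX x (\<xi> 0 \<nu>)\<close> M_tr[OF \<mu>] x \<xi>_in[OF M_VK[OF \<mu>]]
      by (simp add: actX_actX)
  next
    case (y g)
    have "tr G (g \<cdot> y) \<mu> = tr G y (tr G g \<mu>)" using M_VK[OF \<mu>] y by (simp add: G.tr_tr)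
    then show ?case using \<open>\<And>\<nu>. \<nu> \<in> M \<Longrightarrow> \<xi> 0 (tr G y \<nu>) = actX y (\<xi> 0 \<nu>)\<close> M_tr[OF \<mu>] y \<xi>_in[OF M_VK[OF \<mu>]]
      by (simp add: actX_actX)
  qed
qed

subsection \<open>Cosets of the tensor relations\<close>

abbreviation "KX \<equiv> carrier K \<times> carrier X"
abbreviation "sub \<equiv> tensor_sub K X"

definition \<Phi> :: "('m \<times> 'm \<Rightarrow>\<^sub>0 int) \<Rightarrow> (nat \<times> xy word set \<Rightarrow>\<^sub>0 int)" where
  "\<Phi> = frag_extend (\<lambda>(\<kappa>, m). tens (f \<kappa>) (\<chi> m))"

lemma \<Phi>_maps: "\<Phi> (a - b) = \<Phi> a - \<Phi> b" "\<Phi> (a + b) = \<Phi> a + \<Phi> b" "\<Phi> 0 = 0"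
  "\<Phi> (frag_of (\<kappa>, m)) = tens (f \<kappa>) (\<chi> m)"
  by (simp_all add: \<Phi>_def frag_extend_diff frag_extend_add)

lemma f_zero: "f \<zero>\<^bsub>K\<^esub> = 0"
  using f_add[of "\<zero>\<^bsub>K\<^esub>" "\<zero>\<^bsub>K\<^esub>"] by simp

lemma rels_in: "tensor_rels K X \<subseteq> frags KX"
  unfolding tensor_rels_def by (auto intro!: frags_diff)

lemma rels_carrier: "tensor_rels K X \<subseteq> carrier (free_Abelian_group KX)"
  using rels_in unfolding frags_def by (intro subsetI) (simp add: subset_iff)

lemma sub_in: "a \<in> sub \<Longrightarrow> a \<in> frags KX"
  using group.generate_in_carrier[OF group_free_Abelian_group rels_carrier, of a]
  by (simp add: tensor_sub_def tensor_free_def frags_def)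

lemma sub_zero: "0 \<in> sub"
  using generate.one[of "tensor_free K X" "tensor_rels K X"] by (simp add: tensor_sub_def tensor_free_def)

lemma sub_diff: assumes "a \<in> sub" "b \<in> sub" shows "a - b \<in> sub"
proof -
  let ?F = "free_Abelian_group KX"
  have "inv\<^bsub>?F\<^esub> b \<in> generate ?F (tensor_rels K X)"
    using assms(2) rels_carrier
    by (intro group.generate_m_inv_closed) (simp_all add: tensor_sub_def tensor_free_def)
  moreover have "inv\<^bsub>?F\<^esub> b = - b" using sub_in[OF assms(2)] by (simp add: frags_def)
  ultimately have "a + - b \<in> generate ?F (tensor_rels K X)"
    using assms(1) generate.eng[of a ?F "tensor_rels K X" "- b"] by (simp add: tensor_sub_def tensor_free_def)
  then show ?thesis by (simp add: tensor_sub_def tensor_free_def)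
qed

lemma sub_add: "a \<in> sub \<Longrightarrow> b \<in> sub \<Longrightarrow> a + b \<in> sub"
  using sub_diff[of a "0 - b"] sub_diff[of 0 b] sub_zero by simp

lemma sub_rels: "a \<in> tensor_rels K X \<Longrightarrow> a \<in> sub"
  unfolding tensor_sub_def by (rule generate.incl)

lemma sub_left: "\<kappa> \<in> carrier K \<Longrightarrow> \<kappa>' \<in> carrier K \<Longrightarrow> m \<in> carrier X \<Longrightarrow>
    frag_of (\<kappa> \<oplus>\<^bsub>K\<^esub> \<kappa>', m) - frag_of (\<kappa>, m) - frag_of (\<kappa>', m) \<in> sub"
  by (rule sub_rels) (auto simp: tensor_rels_def)

lemma sub_right: "\<kappa> \<in> carrier K \<Longrightarrow> m \<in> carrier X \<Longrightarrow> m' \<in> carrier X \<Longrightarrow>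
    frag_of (\<kappa>, m \<oplus>\<^bsub>X\<^esub> m') - frag_of (\<kappa>, m) - frag_of (\<kappa>, m') \<in> sub"
  by (rule sub_rels) (auto simp: tensor_rels_def)

lemma sub_zero_left: "m \<in> carrier X \<Longrightarrow> frag_of (\<zero>\<^bsub>K\<^esub>, m) \<in> sub"
  using sub_diff[OF sub_zero sub_left[of "\<zero>\<^bsub>K\<^esub>" "\<zero>\<^bsub>K\<^esub>" m]] by simp

lemma \<Phi>_sub: "a \<in> sub \<Longrightarrow> \<Phi> a = 0"
proof -
  have rel: "\<Phi> h = 0" if "h \<in> tensor_rels K X" for h
    using that unfolding tensor_rels_def
    by (auto simp: \<Phi>_maps f_add tens_add_left \<chi>_add tens_add_right f_in \<chi>_in)
  assume "a \<in> sub"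
  then have "a \<in> generate (free_Abelian_group KX) (tensor_rels K X)"
    by (simp add: tensor_sub_def tensor_free_def)
  then show ?thesis
  proof (induction rule: generate.induct)
    case (inv h)
    then have "inv\<^bsub>free_Abelian_group KX\<^esub> h = - h" using rels_in by (auto simp: frags_def)
    then show ?case using rel[OF inv] \<Phi>_maps(1)[of 0 h] by (simp add: \<Phi>_maps)
  qed (auto simp: \<Phi>_maps rel)
qed

definition tsum :: "(nat \<times> nat \<Rightarrow> 'm) \<Rightarrow> ('m \<times> 'm \<Rightarrow>\<^sub>0 int)" where
  "tsum \<kappa> = (\<Sum>ij\<in>B. frag_of (\<kappa> ij, \<epsilon> (frag_of ij)))"

lemma sub_sum: "finite A \<Longrightarrow> (\<And>s. s \<in> A \<Longrightarrow> h s \<in> sub) \<Longrightarrow> sum h A \<in> sub"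
  by (induction A rule: finite_induct) (auto intro: sub_zero sub_add)

lemma \<epsilon>_of_in: "ij \<in> B \<Longrightarrow> \<epsilon> (frag_of ij) \<in> carrier X" by (intro \<epsilon>_in) simp

lemma tsum_zero: "tsum (\<lambda>_. \<zero>\<^bsub>K\<^esub>) \<in> sub"
  unfolding tsum_def by (intro sub_sum sub_zero_left \<epsilon>_of_in) auto

text \<open>
  Expanding the right factors in the \<open>\<int>\<close>-basis of \<open>X\<close> brings every tensor into the form
  \<open>\<Sum> \<kappa>\<^sub>i\<^sub>j \<otimes> e\<^sub>i\<^sub>j\<close>; the coefficients are unique by the contraction maps, so this normal form gives
  the kernel of \<open>\<Phi>\<close>.
\<close>

lemma reduce:
  assumes "a \<in> frags KX"
  shows "\<exists>\<kappa>. (\<forall>ij. \<kappa> ij \<in> carrier K) \<and> a - tsum \<kappa> \<in> sub"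
proof -
  define D where "D = {a. \<exists>\<kappa>. (\<forall>ij. \<kappa> ij \<in> carrier K) \<and> a - tsum \<kappa> \<in> sub}"
  have D_sub: "b \<in> D" if "a \<in> D" "b - a \<in> sub" for a b
  proof -
    from that(1) have "\<exists>\<kappa>. (\<forall>ij. \<kappa> ij \<in> carrier K) \<and> a - tsum \<kappa> \<in> sub" by (simp only: D_def mem_Collect_eq)
    then obtain \<kappa> where "\<forall>ij. \<kappa> ij \<in> carrier K" "a - tsum \<kappa> \<in> sub" by (elim exE conjE)
    then show ?thesis
      using sub_add[OF that(2), of "a - tsum \<kappa>"] unfolding D_def by (intro CollectI exI[of _ \<kappa>]) simp
  qed
  have D0: "0 \<in> D"
    unfolding D_def using tsum_zero sub_diff[OF sub_zero]
    by (intro CollectI exI[of _ "\<lambda>_. \<zero>\<^bsub>K\<^esub>"]) auto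
  have Dd: "a - b \<in> D" if ab: "a \<in> D" "b \<in> D" for a b
  proof -
    from ab have ex: "\<exists>\<kappa>. (\<forall>ij. \<kappa> ij \<in> carrier K) \<and> a - tsum \<kappa> \<in> sub"
      "\<exists>\<kappa>. (\<forall>ij. \<kappa> ij \<in> carrier K) \<and> b - tsum \<kappa> \<in> sub" by (simp_all only: D_def mem_Collect_eq)
    from ex(1) obtain \<kappa> where k1: "\<forall>ij. \<kappa> ij \<in> carrier K" "a - tsum \<kappa> \<in> sub" by (elim exE conjE)
    from ex(2) obtain \<kappa>' where k2: "\<forall>ij. \<kappa>' ij \<in> carrier K" "b - tsum \<kappa>' \<in> sub" by (elim exE conjE)
    note k = spec[OF k1(1)] k1(2) spec[OF k2(1)] k2(2)
    let ?\<kappa> = "\<lambda>ij. \<kappa> ij \<ominus>\<^bsub>K\<^esub> \<kappa>' ij"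
    have "(\<Sum>ij\<in>B. frag_of (?\<kappa> ij \<oplus>\<^bsub>K\<^esub> \<kappa>' ij, \<epsilon> (frag_of ij)) - frag_of (?\<kappa> ij, \<epsilon> (frag_of ij))
        - frag_of (\<kappa>' ij, \<epsilon> (frag_of ij))) \<in> sub"
      using k by (intro sub_sum sub_left \<epsilon>_of_in) auto
    moreover have "?\<kappa> ij \<oplus>\<^bsub>K\<^esub> \<kappa>' ij = \<kappa> ij" for ij
      using k by (simp add: a_minus_def K.M.a_assoc K.M.l_neg)
    ultimately have "tsum \<kappa> - tsum ?\<kappa> - tsum \<kappa>' \<in> sub"
      by (simp add: tsum_def sum_subtractf)
    from sub_add[OF sub_diff[OF k(2,4)] this]
    have "(a - b) - tsum ?\<kappa> \<in> sub" by (simp add: algebra_simps)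
    then show ?thesis using k unfolding D_def by (intro CollectI exI[of _ ?\<kappa>]) auto
  qed
  have DT: "frag_of (\<kappa>, \<epsilon> u) \<in> D" if \<kappa>: "\<kappa> \<in> carrier K" and "u \<in> XL" for \<kappa> u
    using that(2)
  proof (induction rule: frags_induct)
    case zero
    have "\<epsilon> 0 \<oplus>\<^bsub>X\<^esub> \<epsilon> 0 = \<epsilon> 0" using \<epsilon>_add[of 0 0] by simp
    then have "frag_of (\<kappa>, \<epsilon> 0) \<in> sub"
      using sub_diff[OF sub_zero sub_right[OF \<kappa> \<epsilon>_in \<epsilon>_in, of 0 0]] by simp
    then show ?case using D_sub[OF D0] by simp
  next
    case (one ij)
    let ?\<kappa> = "\<lambda>s. if s = ij then \<kappa> else \<zero>\<^bsub>K\<^esub>"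
    have "tsum ?\<kappa> = frag_of (\<kappa>, \<epsilon> (frag_of ij)) + (\<Sum>s\<in>B - {ij}. frag_of (?\<kappa> s, \<epsilon> (frag_of s)))"
      using one by (simp add: tsum_def sum.remove[of _ ij])
    moreover have "(\<Sum>s\<in>B - {ij}. frag_of (?\<kappa> s, \<epsilon> (frag_of s))) \<in> sub"
      by (intro sub_sum) (auto intro!: sub_zero_left \<epsilon>_of_in)
    ultimately have "frag_of (\<kappa>, \<epsilon> (frag_of ij)) - tsum ?\<kappa> \<in> sub"
      using sub_diff[OF sub_zero, of "\<Sum>s\<in>B - {ij}. frag_of (?\<kappa> s, \<epsilon> (frag_of s))"] by simp
    then show ?case using \<kappa> unfolding D_def by (intro CollectI exI[of _ ?\<kappa>]) auto
  next
    case (diff u v)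
    have "u - v \<in> XL" using diff(1,2) by (rule frags_diff)
    then have "\<epsilon> u = \<epsilon> (u - v) \<oplus>\<^bsub>X\<^esub> \<epsilon> v" using \<epsilon>_add[of "u - v" v] diff(2) by simp
    then have "frag_of (\<kappa>, \<epsilon> u) - frag_of (\<kappa>, \<epsilon> (u - v)) - frag_of (\<kappa>, \<epsilon> v) \<in> sub"
      using sub_right[OF \<kappa> \<epsilon>_in[OF \<open>u - v \<in> XL\<close>] \<epsilon>_in[OF diff(2)]] by simp
    then have "frag_of (\<kappa>, \<epsilon> (u - v)) - (frag_of (\<kappa>, \<epsilon> u) - frag_of (\<kappa>, \<epsilon> v)) \<in> sub"
      using sub_diff[OF sub_zero] by (fastforce simp: algebra_simps)
    then show ?case using D_sub[OF Dd[OF diff(3,4)]] by blast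
  qed
  have "a \<in> D"
    using assms
  proof (induction rule: frags_induct)
    case (one s)
    then obtain \<kappa> m where "s = (\<kappa>, m)" "\<kappa> \<in> carrier K" "m \<in> carrier X" by auto
    then show ?case using DT[of \<kappa> "\<chi> m"] by (simp add: \<chi>_in)
  qed (use D0 Dd in auto)
  then show ?thesis by (simp add: D_def)
qed

lemma \<Phi>_tsum: "\<Phi> (tsum \<kappa>) = tens_sum (\<lambda>ij. f (\<kappa> ij))"
proof -
  have "\<Phi> (tsum \<kappa>) = (\<Sum>ij\<in>B. tens (f (\<kappa> ij)) (\<chi> (\<epsilon> (frag_of ij))))"
    by (simp add: tsum_def \<Phi>_def frag_extend_sum o_def)
  then show ?thesis by (auto simp: tens_sum_def intro!: sum.cong)
qed

lemma \<Phi>_kernel: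
  assumes a: "a \<in> frags KX"
  shows "\<Phi> a = 0 \<longleftrightarrow> a \<in> sub"
proof
  assume 0: "\<Phi> a = 0"
  obtain \<kappa> where k: "\<forall>ij. \<kappa> ij \<in> carrier K" "a - tsum \<kappa> \<in> sub"
    using reduce[OF a] by (elim exE conjE)
  note \<kappa> = spec[OF k(1)] k(2)
  have T0: "tens_sum (\<lambda>ij. f (\<kappa> ij)) = 0" using \<Phi>_sub[OF \<kappa>(2)] 0 by (simp add: \<Phi>_maps \<Phi>_tsum)
  have "\<kappa> ij = \<zero>\<^bsub>K\<^esub>" if ij: "ij \<in> B" for ij
  proof -
    have "f (\<kappa> ij) = 0"
    proof (rule poly_mapping_eqI)
      fix g
      show "cf (f (\<kappa> ij)) g = cf 0 g"
        using contract_tens_sum[where E = "\<lambda>l. cf l g" and e = "\<lambda>h. if h = g then 1 else 0" and L = "\<lambda>ij. f (\<kappa> ij)", OF f_in[OF \<kappa>(1)] _ _ ij]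
        by (simp add: T0 lookup_minus lookup_single when_def)
    qed
    then show ?thesis using f_inj \<kappa>(1) f_zero K.M.zero_closed by (metis inj_onD)
  qed
  then have "tsum \<kappa> = tsum (\<lambda>_. \<zero>\<^bsub>K\<^esub>)" by (auto simp: tsum_def intro!: sum.cong)
  then show "a \<in> sub" using sub_add[OF \<kappa>(2) tsum_zero] by simp
qed (rule \<Phi>_sub)

lemma tsum_in: "(\<And>ij. \<kappa> ij \<in> carrier K) \<Longrightarrow> tsum \<kappa> \<in> frags KX"
proof -
  assume \<kappa>: "\<And>ij. \<kappa> ij \<in> carrier K"
  have "(\<Sum>ij\<in>A. frag_of (\<kappa> ij, \<epsilon> (frag_of ij))) \<in> frags KX" if "A \<subseteq> B" for A
    using finite_subset[OF that] that
    by (induction A rule: infinite_finite_induct) (auto intro!: frags_add \<kappa> \<epsilon>_of_in)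
  then show ?thesis by (simp add: tsum_def)
qed

lemma \<Phi>_image: "\<Phi> ` frags KX = tensor_part"
proof (intro equalityI subsetI)
  fix v assume "v \<in> \<Phi> ` frags KX"
  then obtain a where "a \<in> frags KX" "v = \<Phi> a" by auto
  have "\<Phi> a \<in> tensor_part"
    using \<open>a \<in> frags KX\<close>
    by (induction rule: frags_induct) (auto simp: \<Phi>_maps tensor_part_zero intro!: tensor_part_diff tens_tensor_part \<chi>_in)
  then show "v \<in> tensor_part" using \<open>v = \<Phi> a\<close> by simp
next
  fix v assume "v \<in> tensor_part"
  from tensor_part_tens_sum[OF this] obtain \<kappa> where k: "\<forall>ij. \<kappa> ij \<in> carrier K" "v = tens_sum (\<lambda>ij. f (\<kappa> ij))"
    by (elim exE conjE)
  show "v \<in> \<Phi> ` frags KX"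
    using tsum_in[of \<kappa>, OF spec[OF k(1)]] k(2) by (intro image_eqI[of _ _ "tsum \<kappa>"]) (simp_all only: \<Phi>_tsum)
qed

end

section \<open>The isomorphism\<close>

text \<open>
  Two modules are isomorphic if the same set with operations \<open>pl\<close> and \<open>ac\<close> maps bijectively and
  compatibly onto both. This spares inverting the second map by hand.
\<close>

lemma rmod_iso_via:
  assumes E: "bij_betw E S (carrier A)" and D: "bij_betw D S (carrier B)"
    and pl: "\<And>s t. s \<in> S \<Longrightarrow> t \<in> S \<Longrightarrow> pl s t \<in> S"
      "\<And>s t. s \<in> S \<Longrightarrow> t \<in> S \<Longrightarrow> E (pl s t) = E s \<oplus>\<^bsub>A\<^esub> E t"
      "\<And>s t. s \<in> S \<Longrightarrow> t \<in> S \<Longrightarrow> D (pl s t) = D s \<oplus>\<^bsub>B\<^esub> D t"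
    and ac: "\<And>s r. s \<in> S \<Longrightarrow> r \<in> carrier R \<Longrightarrow> ac s r \<in> S"
      "\<And>s r. s \<in> S \<Longrightarrow> r \<in> carrier R \<Longrightarrow> E (ac s r) = E s \<star>\<^bsub>A\<^esub> r"
      "\<And>s r. s \<in> S \<Longrightarrow> r \<in> carrier R \<Longrightarrow> D (ac s r) = D s \<star>\<^bsub>B\<^esub> r"
  shows "rmod_iso R A B"
proof -
  let ?i = "the_inv_into S E"
  have inj: "inj_on E S" and im: "E ` S = carrier A" using E by (auto simp: bij_betw_def)
  note iE = the_inv_into_f_f[OF inj]
  have bij: "bij_betw (D \<circ> ?i) (carrier A) (carrier B)"
    using bij_betw_the_inv_into[OF E] D by (rule bij_betw_trans)
  have "D \<circ> ?i \<in> rmod_hom R A B"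
    unfolding rmod_hom_def
  proof (intro CollectI conjI ballI)
    show "D \<circ> ?i \<in> carrier A \<rightarrow> carrier B" using bij by (auto simp: bij_betw_def)
  next
    fix m n assume "m \<in> carrier A" "n \<in> carrier A"
    then obtain s t where st: "s \<in> S" "t \<in> S" "m = E s" "n = E t" using im by blast
    then have "?i (m \<oplus>\<^bsub>A\<^esub> n) = pl s t" using pl(1,2) iE by metis
    then show "(D \<circ> ?i) (m \<oplus>\<^bsub>A\<^esub> n) = (D \<circ> ?i) m \<oplus>\<^bsub>B\<^esub> (D \<circ> ?i) n"
      using st pl(3) iE by simp
  next
    fix m r assume "m \<in> carrier A" and r: "r \<in> carrier R"
    then obtain s where s: "s \<in> S" "m = E s" using im by blast
    then have "?i (m \<star>\<^bsub>A\<^esub> r) = ac s r" using ac(1,2) r iE by metis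
    then show "(D \<circ> ?i) (m \<star>\<^bsub>A\<^esub> r) = (D \<circ> ?i) m \<star>\<^bsub>B\<^esub> r" using s r ac(3) iE by simp
  qed
  with bij show ?thesis unfolding rmod_iso_def by blast
qed

context module_pair begin

lemma Lam_add: "a \<oplus>\<^bsub>Lam p \<alpha>\<^esub> b = a + b" by (simp add: Lam_def)

definition vact :: "('i \<times> xy word set \<Rightarrow>\<^sub>0 int) \<Rightarrow> lam \<Rightarrow> ('i \<times> xy word set \<Rightarrow>\<^sub>0 int)" where
  "vact v l = frag_extend (\<lambda>g. tr G g v) l"

lemma vact_maps: "vact v (l - l') = vact v l - vact v l'" "vact v 0 = 0" "vact v (frag_of g) = tr G g v"
  by (simp_all add: vact_def frag_extend_diff)

lemma vact_in: "v \<in> Fr G J \<Longrightarrow> l \<in> carrier (Lam p \<alpha>) \<Longrightarrow> vact v l \<in> Fr G J"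
  unfolding vact_def carrier_Lam
  by (rule frag_extend_closed[of _ "carrier G"]) (auto intro: Fr_diff G.tr_in)

lemma vact_M: "v \<in> M \<Longrightarrow> l \<in> carrier (Lam p \<alpha>) \<Longrightarrow> vact v l \<in> M"
  unfolding vact_def carrier_Lam
  by (rule frag_extend_closed[of _ "carrier G"]) (auto intro: M_diff M_zero M_tr)

text \<open>
  The elements of the tensor product are cosets, and the coset with image \<open>w\<close> is the fibre over
  \<open>w\<close>.
\<close>

definition fibre :: "(nat \<times> xy word set \<Rightarrow>\<^sub>0 int) \<Rightarrow> ('m \<times> 'm \<Rightarrow>\<^sub>0 int) set" where
  "fibre w = {a \<in> frags KX. \<Phi> a = w}"

lemma coset_fibre: "a \<in> frags KX \<Longrightarrow> sub #>\<^bsub>tensor_free K X\<^esub> a = fibre (\<Phi> a)"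
proof (intro equalityI subsetI)
  assume a: "a \<in> frags KX"
  fix b assume "b \<in> sub #>\<^bsub>tensor_free K X\<^esub> a"
  then obtain h where "h \<in> sub" "b = h + a" by (auto simp: r_coset_def tensor_free_def)
  then show "b \<in> fibre (\<Phi> a)" using a sub_in[of h] \<Phi>_sub[of h] by (simp add: fibre_def frags_add \<Phi>_maps)
next
  assume a: "a \<in> frags KX"
  fix b assume b: "b \<in> fibre (\<Phi> a)"
  then have "b - a \<in> sub" using a \<Phi>_kernel[of "b - a"] by (simp add: fibre_def frags_diff \<Phi>_maps)
  then show "b \<in> sub #>\<^bsub>tensor_free K X\<^esub> a"
    unfolding r_coset_def by (rule UN_I) (simp add: tensor_free_def)
qed

lemma fibre_nonempty: "w \<in> tensor_part \<Longrightarrow> \<exists>a. a \<in> frags KX \<and> \<Phi> a = w"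
proof -
  assume "w \<in> tensor_part"
  then have "w \<in> \<Phi> ` frags KX" by (simp only: \<Phi>_image)
  then show ?thesis by (elim imageE) (intro exI conjI, assumption, simp)
qed

lemma tensor_carrier: "carrier (tensor_rmod K X) = fibre ` tensor_part"
proof -
  have "carrier (tensor_rmod K X) = (\<lambda>a. sub #>\<^bsub>tensor_free K X\<^esub> a) ` frags KX"
    by (auto simp: tensor_rmod_def FactGroup_def RCOSETS_def tensor_free_def frags_def)
  also have "\<dots> = fibre ` \<Phi> ` frags KX" unfolding image_image by (intro image_cong) (auto simp: coset_fibre)
  finally show ?thesis by (simp only: \<Phi>_image)
qed

lemma inj_fibre: "inj_on fibre tensor_part"
proof (rule inj_onI)
  fix v w assume v: "v \<in> tensor_part" and "w \<in> tensor_part" and eq: "fibre v = fibre w"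
  obtain a where "a \<in> frags KX" "\<Phi> a = v" using fibre_nonempty[OF v] by (elim exE conjE)
  then have "a \<in> fibre v" by (simp add: fibre_def)
  then show "v = w" unfolding eq using \<open>\<Phi> a = v\<close> by (simp add: fibre_def)
qed

lemma tensor_add: "v \<in> tensor_part \<Longrightarrow> w \<in> tensor_part \<Longrightarrow> fibre v \<oplus>\<^bsub>tensor_rmod K X\<^esub> fibre w = fibre (v + w)"
proof -
  assume vw: "v \<in> tensor_part" "w \<in> tensor_part"
  have "fibre v \<oplus>\<^bsub>tensor_rmod K X\<^esub> fibre w = {a + b | a b. a \<in> fibre v \<and> b \<in> fibre w}"
    by (auto simp: tensor_rmod_def FactGroup_def set_mult_def tensor_free_def)
  also have "\<dots> = fibre (v + w)"
  proof (intro equalityI subsetI)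
    fix s assume "s \<in> fibre (v + w)"
    then have s: "s \<in> frags KX" "\<Phi> s = v + w" by (auto simp: fibre_def)
    obtain a where a: "a \<in> frags KX" "\<Phi> a = v" using fibre_nonempty[OF vw(1)] by (elim exE conjE)
    have "s = a + (s - a)" by simp
    moreover have "s - a \<in> fibre w" "a \<in> fibre v" using a s by (auto simp: fibre_def frags_diff \<Phi>_maps)
    ultimately show "s \<in> {a + b | a b. a \<in> fibre v \<and> b \<in> fibre w}" by blast
  qed (auto simp: fibre_def frags_add \<Phi>_maps)
  finally show ?thesis .
qed

lemma diag_act_in: "a \<in> frags KX \<Longrightarrow> l \<in> carrier (Lam p \<alpha>) \<Longrightarrow> diag_act K X a l \<in> frags KX"
  unfolding diag_act_def carrier_Lam
proof (rule frag_extend_in_frags)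
  fix g assume a: "a \<in> frags KX" and "g \<in> carrier G"
  then show "frag_extend (\<lambda>(m, n). frag_of (m \<star>\<^bsub>K\<^esub> frag_of g, n \<star>\<^bsub>X\<^esub> frag_of g)) a \<in> frags KX"
    by (intro frag_extend_in_frags[OF a]) (auto intro!: K.ract_closed X.ract_closed frag_of_Lam)
qed

lemma \<Phi>_diag_act:
  assumes a: "a \<in> frags KX" and l: "l \<in> carrier (Lam p \<alpha>)"
  shows "\<Phi> (diag_act K X a l) = vact (\<Phi> a) l"
proof -
  have "\<Phi> (frag_extend (\<lambda>(m, n). frag_of (m \<star>\<^bsub>K\<^esub> frag_of g, n \<star>\<^bsub>X\<^esub> frag_of g)) a) = tr G g (\<Phi> a)"
    if g: "g \<in> carrier G" for g
    using a
  proof (induction rule: frags_induct)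
    case (one s)
    then obtain m n where "s = (m, n)" "m \<in> carrier K" "n \<in> carrier X" by auto
    then show ?case using g by (simp add: \<Phi>_maps f_act \<chi>_act tens_act f_in \<chi>_in)
  qed (auto simp: \<Phi>_maps frag_extend_diff tr_diff)
  then show ?thesis
    unfolding diag_act_def vact_def \<Phi>_def frag_extend_frag_extend
    using l by (intro frag_extend_cong[of _ "carrier G"]) (simp_all add: carrier_Lam)
qed

lemma tensor_act:
  assumes w: "w \<in> tensor_part" and l: "l \<in> carrier (Lam p \<alpha>)"
  shows "fibre w \<star>\<^bsub>tensor_rmod K X\<^esub> l = fibre (vact w l)"
proof -
  have "fibre w \<star>\<^bsub>tensor_rmod K X\<^esub> l = (\<Union>a\<in>fibre w. sub #>\<^bsub>tensor_free K X\<^esub> diag_act K X a l)"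
    by (simp add: tensor_rmod_def)
  also have "\<dots> = (\<Union>a\<in>fibre w. fibre (vact w l))"
  proof (rule SUP_cong[OF refl])
    fix a assume "a \<in> fibre w"
    then have a: "a \<in> frags KX" "\<Phi> a = w" by (auto simp: fibre_def)
    show "sub #>\<^bsub>tensor_free K X\<^esub> diag_act K X a l = fibre (vact w l)"
      using coset_fibre[OF diag_act_in[OF a(1) l]] \<Phi>_diag_act[OF a(1) l] a(2) by simp
  qed
  also have "\<dots> = fibre (vact w l)" using fibre_nonempty[OF w] by (auto simp: fibre_def)
  finally show ?thesis .
qed

definition component :: "nat \<Rightarrow> (nat \<times> xy word set \<Rightarrow>\<^sub>0 int) \<Rightarrow> lam" where
  "component i = frag_extend (\<lambda>(i', g). if i' = i then frag_of g else 0)"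

lemma component_maps: "component i (u - v) = component i u - component i v" "component i (u + v) = component i u + component i v" "component i 0 = 0"
  by (simp_all add: component_def frag_extend_diff frag_extend_add)

lemma component_in: "v \<in> Fr G J \<Longrightarrow> component i v \<in> carrier (Lam p \<alpha>)"
  unfolding component_def Fr_def carrier_Lam by (rule frag_extend_in_frags) auto

lemma cf_component: "v \<in> Fr G J \<Longrightarrow> cf (component i v) g = cf v (i, g)"
  by (induction rule: Fr_induct) (auto simp: component_def frag_extend_diff lookup_minus lookup_single when_def)

lemma component_tr: "v \<in> Fr G J \<Longrightarrow> component i (tr G g v) = rmul G g (component i v)"
  by (induction rule: Fr_induct) (auto simp: component_maps tr_diff rmul_diff, auto simp: component_def)

lemma component_vact:
  assumes v: "v \<in> Fr G J" and l: "l \<in> carrier (Lam p \<alpha>)"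
  shows "component i (vact v l) = component i v \<otimes>\<^bsub>Lam p \<alpha>\<^esub> l"
proof -
  have "l \<in> frags (carrier G)" using l by (simp add: carrier_Lam)
  then show ?thesis
  proof (induction rule: frags_induct)
    case zero
    then show ?case by (simp add: vact_maps component_maps Lam_def group_ring_mult frag_extend_eq_0)
  next
    case (one g)
    then show ?case using v by (simp add: vact_maps component_tr Lam_def group_ring_mult_of)
  next
    case (diff a b)
    have "component i v \<otimes>\<^bsub>Lam p \<alpha>\<^esub> (a - b) + component i v \<otimes>\<^bsub>Lam p \<alpha>\<^esub> b = component i v \<otimes>\<^bsub>Lam p \<alpha>\<^esub> a"
      unfolding Lam_def group_ring_add_right[symmetric] by simp
    then have "component i v \<otimes>\<^bsub>Lam p \<alpha>\<^esub> a - component i v \<otimes>\<^bsub>Lam p \<alpha>\<^esub> b = component i v \<otimes>\<^bsub>Lam p \<alpha>\<^esub> (a - b)"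
      by (metis add_diff_cancel_right')
    then show ?case using diff by (simp add: vact_maps component_maps)
  qed
qed

definition components :: "nat \<Rightarrow> (nat \<times> xy word set \<Rightarrow>\<^sub>0 int) \<Rightarrow> (nat \<Rightarrow> lam)" where
  "components n v = (\<lambda>i\<in>{..<n}. component i v)"

lemma components_bij: "bij_betw (components n) (Fr G {..<n}) ({..<n} \<rightarrow>\<^sub>E carrier (Lam p \<alpha>))"
  unfolding bij_betw_def
proof
  show "inj_on (components n) (Fr G {..<n})"
  proof (rule inj_onI)
    fix u v assume uv: "u \<in> Fr G {..<n}" "v \<in> Fr G {..<n}" "components n u = components n v"
    show "u = v"
    proof (rule poly_mapping_eqI)
      fix s :: "nat \<times> xy word set"
      obtain i g where s: "s = (i, g)" by force
      show "cf u s = cf v s"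
      proof (cases "i < n")
        case True
        then have "component i u = component i v" using fun_cong[OF uv(3), of i] by (simp add: components_def)
        then show ?thesis using cf_component[OF uv(1)] cf_component[OF uv(2)] s by metis
      next
        case False
        then have "s \<notin> {..<n} \<times> carrier G" using s by simp
        then show ?thesis using uv(1,2) unfolding Fr_def by (metis frags_lookup)
      qed
    qed
  qed
  show "components n ` Fr G {..<n} = {..<n} \<rightarrow>\<^sub>E carrier (Lam p \<alpha>)"
  proof (intro equalityI subsetI)
    fix h assume h: "h \<in> {..<n} \<rightarrow>\<^sub>E carrier (Lam p \<alpha>)"
    define pt where "pt i = frag_extend (\<lambda>g. frag_of (i, g)) (h i)" for i
    have pt: "pt i \<in> Fr G {..<n}" if "i < n" for i
      unfolding pt_def Fr_def using h that
      by (intro frag_extend_in_frags[of _ "carrier G"]) (auto simp: carrier_Lam PiE_iff)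
    have v: "(\<Sum>i\<in>A. pt i) \<in> Fr G {..<n}" if "A \<subseteq> {..<n}" for A
      using finite_subset[OF that] that
      by (induction A rule: infinite_finite_induct) (auto intro!: Fr_add pt)
    have component_pt: "component j (pt i) = (if j = i then h i else 0)" for i j
    proof -
      have "component j (pt i) = frag_extend (\<lambda>g. if i = j then frag_of g else 0) (h i)"
        by (simp add: component_def pt_def frag_extend_frag_extend)
      then show ?thesis by (cases "i = j") (auto simp: frag_extend_eq_0 simp flip: frag_expansion)
    qed
    have "components n (\<Sum>i<n. pt i) = h"
    proof (rule ext)
      fix j
      show "components n (\<Sum>i<n. pt i) j = h j"
      proof (cases "j < n")
        case True
        have "component j (\<Sum>i<n. pt i) = (\<Sum>i<n. component j (pt i))"
          by (simp add: component_def frag_extend_sum o_def)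
        also have "\<dots> = h j" using True by (simp only: component_pt) (subst sum.delta', auto)
        finally show ?thesis using True by (simp add: components_def)
      next
        case False
        then show ?thesis using h by (auto simp: components_def PiE_iff extensional_def)
      qed
    qed
    then show "h \<in> components n ` Fr G {..<n}" using v[of "{..<n}"] by (intro image_eqI) auto
  next
    fix h assume "h \<in> components n ` Fr G {..<n}"
    then obtain v where "v \<in> Fr G {..<n}" "h = components n v" by auto
    then show "h \<in> {..<n} \<rightarrow>\<^sub>E carrier (Lam p \<alpha>)" by (intro PiE_I) (simp_all add: components_def component_in)
  qed
qed

text \<open>
  The splitting of \<open>K \<otimes> X\<close> in \<open>\<Lambda>\<^sup>3\<^sup>k\<close> with \<open>m = k\<close>: the relations contribute \<open>X\<close>, and the rest is free of
  rank \<open>3k - k = 2k\<close>.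
\<close>

theorem tensor_iso:
  "rmod_iso (Lam p \<alpha>) (tensor_rmod K X) (direct_sum X (free_rmod (Lam p \<alpha>) (2 * k)))"
proof -
  have "3 * k \<le> 3 * k" by simp
  from G.submodule_split[OF tensor_part_submodule this \<pi>_in V_span]
  have "\<exists>\<theta>. split_iso G M {..<2 * k} tensor_part \<theta>" unfolding M_def by simp
  then obtain \<theta> where "split_iso G M {..<2 * k} tensor_part \<theta>" by (rule exE)
  note \<theta> = split_isoD[OF this]
  let ?L = "Fr G {..<2 * k}"
  have \<theta>_tensor_part: "\<theta> \<mu> l \<in> tensor_part" if "\<mu> \<in> M" "l \<in> ?L" for \<mu> l
    using bij_betw_apply[OF \<theta>(1), of "(\<mu>, l)"] that by simp
  have M_add: "u + v \<in> M" if "u \<in> M" "v \<in> M" for u v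
    using M_diff[OF that(1) M_diff[OF M_zero that(2)]] by simp
  have \<theta>_diff: "\<theta> (a - b) (l - l') = \<theta> a l - \<theta> b l'" if "a \<in> M" "b \<in> M" "l \<in> ?L" "l' \<in> ?L" for a b l l'
    using \<theta>(2)[of "a - b" b "l - l'" l'] that by (simp add: M_diff Fr_diff)
  have \<theta>_zero: "\<theta> 0 0 = 0" using \<theta>(2)[of 0 0 0 0] M_zero by simp
  have \<theta>_act: "\<theta> (vact \<mu> r) (vact l r) = vact (\<theta> \<mu> l) r"
    if \<mu>: "\<mu> \<in> M" and l: "l \<in> ?L" and r: "r \<in> carrier (Lam p \<alpha>)" for \<mu> l r
  proof -
    have "r \<in> frags (carrier G)" using r by (simp add: carrier_Lam)
    then show ?thesis
    proof (induction rule: frags_induct)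
      case (diff a b)
      then have "a \<in> carrier (Lam p \<alpha>)" "b \<in> carrier (Lam p \<alpha>)" by (simp_all add: carrier_Lam)
      then show ?case using diff \<mu> l by (simp add: vact_maps \<theta>_diff vact_M vact_in)
    qed (use \<mu> l \<theta>(3) in \<open>auto simp: vact_maps \<theta>_zero\<close>)
  qed
  have \<xi>_act: "\<epsilon> (\<xi> 0 (vact \<mu> r)) = \<epsilon> (\<xi> 0 \<mu>) \<star>\<^bsub>X\<^esub> r" if \<mu>: "\<mu> \<in> M" and r: "r \<in> carrier (Lam p \<alpha>)" for \<mu> r
  proof -
    have V: "\<mu> \<in> VK" using \<mu> by (rule M_VK)
    have "r \<in> frags (carrier G)" using r by (simp add: carrier_Lam)
    then show ?thesis
    proof (rule X.M.additive_on_eq[rotated 3])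
      show "additive_on (frags (carrier G)) X (\<lambda>r. \<epsilon> (\<xi> 0 (vact \<mu> r)))"
        unfolding additive_on_def
      proof (intro conjI ballI)
        show "(\<lambda>r. \<epsilon> (\<xi> 0 (vact \<mu> r))) \<in> frags (carrier G) \<rightarrow> carrier X"
          using vact_in[OF V] by (auto simp: carrier_Lam intro!: \<epsilon>_in \<xi>_in)
        fix u v assume "u \<in> frags (carrier G)" "v \<in> frags (carrier G)"
        then show "\<epsilon> (\<xi> 0 (vact \<mu> (u + v))) = \<epsilon> (\<xi> 0 (vact \<mu> u)) \<oplus>\<^bsub>X\<^esub> \<epsilon> (\<xi> 0 (vact \<mu> v))"
          using vact_in[OF V, of u] vact_in[OF V, of v]
          by (simp add: carrier_Lam vact_def frag_extend_add \<xi>_maps \<epsilon>_add \<xi>_in)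
      qed
      show "additive_on (frags (carrier G)) X (\<lambda>r. \<epsilon> (\<xi> 0 \<mu>) \<star>\<^bsub>X\<^esub> r)"
        unfolding additive_on_def
      proof (intro conjI ballI)
        have e: "\<epsilon> (\<xi> 0 \<mu>) \<in> carrier X" by (intro \<epsilon>_in \<xi>_in V)
        show "(\<lambda>r. \<epsilon> (\<xi> 0 \<mu>) \<star>\<^bsub>X\<^esub> r) \<in> frags (carrier G) \<rightarrow> carrier X"
          using X.ract_closed[OF e] by (auto simp: carrier_Lam)
        fix u v assume "u \<in> frags (carrier G)" "v \<in> frags (carrier G)"
        then show "\<epsilon> (\<xi> 0 \<mu>) \<star>\<^bsub>X\<^esub> (u + v) = \<epsilon> (\<xi> 0 \<mu>) \<star>\<^bsub>X\<^esub> u \<oplus>\<^bsub>X\<^esub> \<epsilon> (\<xi> 0 \<mu>) \<star>\<^bsub>X\<^esub> v"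
          using X.ract_add[OF e, of u v] by (simp add: carrier_Lam Lam_add)
      qed
      fix g assume "g \<in> carrier G"
      then show "\<epsilon> (\<xi> 0 (vact \<mu> (frag_of g))) = \<epsilon> (\<xi> 0 \<mu>) \<star>\<^bsub>X\<^esub> frag_of g"
        using \<xi>0_act[OF \<mu>] \<epsilon>_actX[OF \<xi>_in[OF V]] by (simp add: vact_maps)
    qed
  qed
  let ?E = "\<lambda>(\<mu>, l). fibre (\<theta> \<mu> l)" and ?D = "\<lambda>(\<mu>, l). (\<epsilon> (\<xi> 0 \<mu>), components (2 * k) l)"
  let ?pl = "\<lambda>(\<mu>, l) (\<mu>', l'). (\<mu> + \<mu>', l + l')" and ?ac = "\<lambda>(\<mu>, l) r. (vact \<mu> r, vact l r)"
  show ?thesis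
  proof (rule rmod_iso_via[where E = ?E and D = ?D and S = "M \<times> ?L" and pl = ?pl and ac = ?ac])
    have "bij_betw (fibre \<circ> case_prod \<theta>) (M \<times> ?L) (fibre ` tensor_part)"
      using \<theta>(1) inj_fibre by (intro bij_betw_trans[of _ _ tensor_part]) (auto simp: bij_betw_def)
    then show "bij_betw ?E (M \<times> ?L) (carrier (tensor_rmod K X))"
      unfolding tensor_carrier by (subst bij_betw_cong[of _ _ "fibre \<circ> case_prod \<theta>"]) auto
    have "bij_betw (\<epsilon> \<circ> \<xi> 0) M (carrier X)" using \<xi>0_bij \<epsilon>_bij by (rule bij_betw_trans)
    from bij_betw_map_prod[OF this components_bij[of "2 * k"]]
    have "bij_betw (map_prod (\<epsilon> \<circ> \<xi> 0) (components (2 * k))) (M \<times> ?L)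
        (carrier X \<times> ({..<2 * k} \<rightarrow>\<^sub>E carrier (Lam p \<alpha>)))" .
    then show "bij_betw ?D (M \<times> ?L) (carrier (direct_sum X (free_rmod (Lam p \<alpha>) (2 * k))))"
      by (subst bij_betw_cong[of _ _ "map_prod (\<epsilon> \<circ> \<xi> 0) (components (2 * k))"])
         (auto simp: direct_sum_def free_rmod_def)
  next
    fix s t assume "s \<in> M \<times> ?L" "t \<in> M \<times> ?L"
    then obtain \<mu> l \<mu>' l' where *: "s = (\<mu>, l)" "t = (\<mu>', l')" "\<mu> \<in> M" "\<mu>' \<in> M" "l \<in> ?L" "l' \<in> ?L" by auto
    show "?pl s t \<in> M \<times> ?L" using * by (simp add: M_add Fr_add)
    show "?E (?pl s t) = ?E s \<oplus>\<^bsub>tensor_rmod K X\<^esub> ?E t"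
      using * by (simp add: \<theta>(2) tensor_add \<theta>_tensor_part)
    have "components (2 * k) (l + l') = (\<lambda>i\<in>{..<2 * k}. components (2 * k) l i \<oplus>\<^bsub>Lam p \<alpha>\<^esub> components (2 * k) l' i)"
      by (auto simp: components_def component_maps Lam_def intro!: restrict_ext)
    then show "?D (?pl s t) = ?D s \<oplus>\<^bsub>direct_sum X (free_rmod (Lam p \<alpha>) (2 * k))\<^esub> ?D t"
      using * M_VK by (simp add: direct_sum_def free_rmod_def \<xi>_maps \<epsilon>_add \<xi>_in)
  next
    fix s r assume "s \<in> M \<times> ?L" and r: "r \<in> carrier (Lam p \<alpha>)"
    then obtain \<mu> l where *: "s = (\<mu>, l)" "\<mu> \<in> M" "l \<in> ?L" by auto
    show "?ac s r \<in> M \<times> ?L" using * r by (simp add: vact_M vact_in)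
    show "?E (?ac s r) = ?E s \<star>\<^bsub>tensor_rmod K X\<^esub> r"
      using * r by (simp add: \<theta>_act tensor_act \<theta>_tensor_part)
    have "components (2 * k) (vact l r) = (\<lambda>i\<in>{..<2 * k}. components (2 * k) l i \<otimes>\<^bsub>Lam p \<alpha>\<^esub> r)"
      using component_vact[OF *(3) r] by (auto simp: components_def intro!: restrict_ext)
    then show "?D (?ac s r) = ?D s \<star>\<^bsub>direct_sum X (free_rmod (Lam p \<alpha>) (2 * k))\<^esub> r"
      using * r by (simp add: direct_sum_def free_rmod_def \<xi>_act)
  qed
qed

end

theorem theorem1:
  fixes p d \<alpha> :: nat
    and R K :: "nat \<Rightarrow> (lam, 'm) rmod"
    and X :: "(lam, 'm) rmod"
  assumes "prime p" and "p = 3 * d + 1"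
    and "\<alpha> \<in> {2..p - 2}" and "ord p \<alpha> = 3"
    and "\<And>i. i \<in> {1, 2, 3} \<Longrightarrow> is_R p \<alpha> i (R i)"
    and "\<And>i. i \<in> {1, 2, 3} \<Longrightarrow> is_K p \<alpha> (R i) (K i)"
    and "X \<in> {R 1, R 2, R 3, K 1, K 2, K 3}"
  shows "\<exists>a :: nat. rmod_iso (Lam p \<alpha>) (tensor_rmod (K 3) X)
                      (direct_sum X (free_rmod (Lam p \<alpha>) a))"
proof -
  interpret metacyclic p d \<alpha> by unfold_locales (use assms in auto)
  have R: "is_R p \<alpha> i (R i)" "is_K p \<alpha> (R i) (K i)" if "i \<in> {1, 2, 3}" for i
    using assms(5,6) that by blast+
  have freeR: "\<exists>\<epsilon>. c3_free (R i) d \<epsilon>" if "i \<in> {1, 2, 3}" for i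
    using that R(1)[OF that] c3_free_R1 c3_free_R2 c3_free_R3 by auto
  have freeK: "\<exists>\<epsilon>. c3_free (K i) (p - d) \<epsilon>" if "i \<in> {1, 2, 3}" for i
    using freeR[OF that] c3_free_kernel[OF R(2)[OF that]] by blast
  have modR: "right_module (Lam p \<alpha>) (R i)" and modK: "right_module (Lam p \<alpha>) (K i)" if "i \<in> {1, 2, 3}" for i
    using R(2)[OF that] by (auto simp: is_K_def short_exact_def)
  have X: "(\<exists>k \<epsilon>. c3_free X k \<epsilon>) \<and> right_module (Lam p \<alpha>) X"
    using assms(7) freeR[of 1] freeR[of 2] freeR[of 3] freeK[of 1] freeK[of 2] freeK[of 3]
      modR[of 1] modR[of 2] modR[of 3] modK[of 1] modK[of 2] modK[of 3] by auto
  then obtain k \<epsilon> where \<epsilon>: "c3_free X k \<epsilon>" by blast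
  obtain f r where ex: "short_exact (Lam p \<alpha>) (K 3) (regular_rmod (Lam p \<alpha>)) (R 3) f r"
    using R(2)[of 3] by (auto simp: is_K_def)
  note E = short_exact_regular[OF ex]
  from R3_kernel[OF R(1)[of 3] ex]
  obtain c \<tau> where c: "\<forall>g\<in>carrier G. c g \<in> PL"
    "\<forall>l\<in>carrier (Lam p \<alpha>). l \<in> f ` carrier (K 3) \<longleftrightarrow> (\<exists>z. frag_extend c l = frag_cmul z norm_elt)"
    "\<tau> \<in> carrier (Lam p \<alpha>)"
    "\<forall>j a. a < p \<longrightarrow> (\<exists>z. frag_extend c (rmul G (el j a) \<tau>) = frag_of a + frag_cmul z norm_elt)"
    by auto
  have "module_pair p d \<alpha> (K 3) X f k \<epsilon> c \<tau>"
  proof (rule module_pair.intro)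
    show "metacyclic p d \<alpha>" by unfold_locales
    show "right_module (Lam p \<alpha>) (K 3)" by (rule E(1))
    show "right_module (Lam p \<alpha>) X" using X by blast
    show "module_pair_axioms p \<alpha> (K 3) X f k \<epsilon> c \<tau>"
      using E(3-6) \<epsilon> c by unfold_locales blast+
  qed
  from module_pair.tensor_iso[OF this] show ?thesis by (rule exI)
qed

end
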